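(* Let $((Y_{n,t},X_{n,t})_{t\in\{1,\dots,n\}})_{n\in\mathbb{N}}$ satisfy the asymptotic change point model and multivariate normality assumptions, let $S\subseteq\{1,\dots,d\}$, let $\alpha\in(0,1)$ and let $(\mathcal{E}_n)_{n\in\mathbb{N}}$ be a sequence of collections of pairwise disjoint non-empty environments with the properties (C1), (C2) and (C3,$k$) defined in the context. Assume that for all $n\in\mathbb{N}$ it holds that $(\mathbf{Y}_n,\mathbf{X}_n)\sim P_n\in H^n_{A,S}(a_n,b_n)$, where $a_n$ and $b_n$ satisfy $$\frac{|\mathcal{E}_n|^{1/k}}{\sqrt{r_n}}=o(a_n)\quad\text{or}\quad\frac{|\mathcal{E}_n|^{1/k}}{\sqrt{r_n}}=o(b_n^2)\qquad(n\to\infty).$$ Then $$\lim_{n\to\infty}\lim_{B\to\infty}\mathbb{P}_{P_n}\left(\varphi_{T_3^{\max,\mathcal{F}^1(\mathcal{E}_n)},B}(\mathbf{Y}_n,\mathbf{X}^S_n)=1\right)=1 .$$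
   Context: Notation: for each $n$, $\mathbf{Y}_n=(Y_{n,1},\dots,Y_{n,n})^\top\in\mathbb{R}^n$ and $\mathbf{X}_n\in\mathbb{R}^{n\times d}$ has rows $X_{n,t}\in\mathbb{R}^{1\times d}$; the index $n$ is often dropped. For $S\subseteq\{1,\dots,d\}$ a superscript $S$ means restriction to the columns in $S$; for an environment $e\subseteq\{1,\dots,n\}$ a subscript $e$ means restriction to the rows in $e$; $|e|$ is the cardinality. Intercepts are neglected (they may be absorbed by a constant term in $X$). Change points: for $\mathrm{CP}=(t_1,\dots,t_L)\in\{1,\dots,n-1\}^L$ with $t_1<\dots<t_L$ let $e_1(\mathrm{CP})=\{1,\dots,t_1\}$, $e_i(\mathrm{CP})=\{t_{i-1}+1,\dots,t_i\}$ for $1<i\le L$, $e_{L+1}(\mathrm{CP})=\{t_L+1,\dots,n\}$, and $\mathcal{E}(\mathrm{CP})=\{e_1(\mathrm{CP}),\dots,e_{L+1}(\mathrm{CP})\}$. Asymptotic change point model: there exist a fixed $L$, fixed relative change points $\alpha^*_1,\dots,\alpha^*_L\in(0,1)$ and true change points $\mathrm{CP}^*_n=(t^*_{n,1},\dots,t^*_{n,L})$ with $\lim_{n\to\infty}t^*_{n,i}/n=\alpha^*_i$ for all $i$; and for all $i\in\{1,\dots,L+1\}$ the variables $(Y_{n,t},X_{n,t})_{t\in e_i(\mathrm{CP}^*_n)}$ are i.i.d. with some fixed distribution $F_{n,i}$. Multivariate normality: for all $n$ and all $e\in\mathcal{E}(\mathrm{CP}^*_n)$, $(Y_{n,t},X_{n,t})_{t\in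 e}$ is multivariate normal. Consequently for every $S$ and every $e\in\mathcal{E}(\mathrm{CP}^*_n)$ there are unique $\beta_{e,S},\sigma_{e,S}$ with $Y_t=X^S_t\beta_{e,S}+\epsilon_t$ for all $t\in e$, where $\epsilon_t\sim\mathcal{N}(0,\sigma^2_{e,S})$ is independent of $X^S_t$. For $f\subseteq e\in\mathcal{E}(\mathrm{CP}^*_n)$ put $\beta_{f,S}=\beta_{e,S}$, $\sigma_{f,S}=\sigma_{e,S}$. Alternatives: $H^n_{A,S}(a,b)$ is the set of laws $P$ such that for $(\mathbf{Y}_n,\mathbf{X}_n)\sim P$ there exist $i,j\in\{1,\dots,L+1\}$ with $a=|\sigma^2_{e_i(\mathrm{CP}^*_n),S}-\sigma^2_{e_j(\mathrm{CP}^*_n),S}|>0$ and $b=\|\beta_{e_i(\mathrm{CP}^*_n),S}-\beta_{e_j(\mathrm{CP}^*_n),S}\|_2>0$. Conditions on $\mathcal{E}_n\subseteq\mathcal{P}(\{1,\dots,n\})$: (C1) $r_n:=\min_{e\in\mathcal{E}_n}|e|$ satisfies $\lim_{n\to\infty}r_n=\infty$. (C2) For all $i\in\{1,\dots,L+1\}$ there are a sequence $(f_n)$ with $f_n\in\mathcal{E}_n$ and $N\in\mathbb{N}$ such that $f_n\subseteq e_i(\mathrm{CP}^*_n)$ for all $n\ge N$, the sequences $(\sigma^2_{f_n,S})$ and $(\beta_{f_n,S})$ converge, and $\lim_{n\to\infty}\sigma^2_{f_n,S}>0$. (C3,$k$) ($k\in\mathbb{N}$) For all $e_n\in\mathcal{E}_n$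 the matrix $\frac{1}{|e_n|}\mathbf{X}_{e_n}^\top\mathbf{X}_{e_n}$ is a.s. invertible, and there are constants $c,C$ such that for all $n$ and all $e_n\in\mathcal{E}_n$, $0<c\le\mathbb{E}\big(\lambda_{\min}(\tfrac{1}{|e_n|}\mathbf{X}_{e_n}^\top\mathbf{X}_{e_n})^{2k}\big)\le\mathbb{E}\big(\lambda_{\max}(\tfrac{1}{|e_n|}\mathbf{X}_{e_n}^\top\mathbf{X}_{e_n})^{2k}\big)\le C<\infty$. Scaled residuals and test statistic: with $\mathbf{P}^S_{\mathbf{X}}=\mathbf{X}^S((\mathbf{X}^S)^\top\mathbf{X}^S)^{-1}(\mathbf{X}^S)^\top$, $\widetilde{\mathbf{R}}^S=(\mathbf{Id}-\mathbf{P}^S_{\mathbf{X}})\mathbf{Y}/\|(\mathbf{Id}-\mathbf{P}^S_{\mathbf{X}})\mathbf{Y}\|_2$. For $h\subseteq\{1,\dots,n\}$ let $\hat\gamma_{h,S}=((\mathbf{X}^S_h)^\top\mathbf{X}^S_h)^{-1}(\mathbf{X}^S_h)^\top\widetilde{\mathbf{R}}^S_h$ and $\hat s^2_{h,S}=\|\widetilde{\mathbf{R}}^S_h-\mathbf{X}^S_h\hat\gamma_{h,S}\|_2^2/|h|$. Let $T^3_{e,f}(\widetilde{\mathbf{R}}^S)=\dfrac{\|\widetilde{\mathbf{R}}^S_e-\mathbf{X}^S_e\hat\gamma_{f,S}\|_2^2}{\hat s^2_{f,S}\,|e|}-1$. With $\mathcal{F}^1(\mathcal{E}_n)=\{(e,f)\in\mathcal{E}_n\times\mathcal{E}_n: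 e\cap f=\varnothing\}$, let $T_3^{\max,\mathcal{F}^1(\mathcal{E}_n)}(\widetilde{\mathbf{R}}^S)=\max_{(e,f)\in\mathcal{F}^1(\mathcal{E}_n)}|T^3_{e,f}(\widetilde{\mathbf{R}}^S)|$. Resampling test (level $\alpha$): for a statistic $T$ of the scaled residuals (which may depend on $\mathbf{X}^S$) and $B\in\mathbb{N}$: draw i.i.d. $\tilde{\boldsymbol\epsilon}_b\sim\mathcal{N}(\mathbf{0},\mathbf{Id})$, $b=1,\dots,B$, independent of the data, set $\widetilde{\mathbf{R}}^{S}_b=(\mathbf{Id}-\mathbf{P}^S_{\mathbf{X}})\tilde{\boldsymbol\epsilon}_b/\|(\mathbf{Id}-\mathbf{P}^S_{\mathbf{X}})\tilde{\boldsymbol\epsilon}_b\|_2$, let $c_{T,B}$ be the $\lceil B(1-\alpha)\rceil$-th smallest value of $|T(\widetilde{\mathbf{R}}^{S}_1)|,\dots,|T(\widetilde{\mathbf{R}}^{S}_B)|$ and let $\varphi_{T,B}=\mathbf{1}\{|T(\widetilde{\mathbf{R}}^S)|>c_{T,B}\}$. *)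

theory Defs
  imports "HOL-Probability.Probability" "HOL-Library.Landau_Symbols"
begin

(* A law of (Y_n, X_n) is a probability measure P on (R x R^d)^n.  The variables
   are the coordinates: Y_t = fst (w t) and X_t = snd (w t), for t in {1..n}. *)

definition data_law :: "nat \<Rightarrow> (nat \<Rightarrow> real \<times> (real ^ 'd)) measure \<Rightarrow> bool" where
  "data_law n P \<longleftrightarrow> prob_space P \<and> sets P = sets (Pi\<^sub>M {1..n} (\<lambda>_. borel))"

subsection \<open>Columns in S\<close>

(* Vectors of R^S are represented as vectors of R^d that vanish outside S, and
   S x S matrices as d x d matrices that vanish outside S x S. *)

definition restr :: "'d set \<Rightarrow> real ^ 'd \<Rightarrow> real ^ 'd" where
  "restr S x = (\<chi> j. if j \<in> S then x $ j else 0)"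

(* gram S x h is (X^S_h)^T X^S_h, where x t is row t of X. *)
definition gram :: "'d set \<Rightarrow> (nat \<Rightarrow> real ^ 'd) \<Rightarrow> nat set \<Rightarrow> real ^ 'd ^ 'd" where
  "gram S x h = (\<chi> i j. \<Sum>t\<in>h. restr S (x t) $ i * restr S (x t) $ j)"

definition id_on :: "'d set \<Rightarrow> real ^ 'd ^ 'd" where
  "id_on S = (\<chi> i j. if i = j \<and> i \<in> S then 1 else 0)"

(* The inverse of an S x S matrix; for S = UNIV this is matrix_inv.  As with
   matrix_inv, all singular matrices are sent to one and the same unspecified matrix. *)
definition inv_on :: "'d::finite set \<Rightarrow> real ^ 'd ^ 'd \<Rightarrow> real ^ 'd ^ 'd" where
  "inv_on S A = (SOME B. (\<forall>i j. i \<notin> S \<or> j \<notin> S \<longrightarrow> B $ i $ j = 0)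
      \<and> A ** B = id_on S \<and> B ** A = id_on S)"

(* ((X^S_h)^T X^S_h)^{-1} (X^S_h)^T y_h *)
definition ols :: "'d::finite set \<Rightarrow> (nat \<Rightarrow> real ^ 'd) \<Rightarrow> nat set \<Rightarrow> (nat \<Rightarrow> real) \<Rightarrow> real ^ 'd" where
  "ols S x h y = inv_on S (gram S x h) *v (\<Sum>t\<in>h. y t *\<^sub>R restr S (x t))"

subsection \<open>Scaled residuals, test statistic and resampling test\<close>

(* Entry t of (Id - P^S_X) y. *)
definition resid :: "nat \<Rightarrow> 'd::finite set \<Rightarrow> (nat \<Rightarrow> real ^ 'd) \<Rightarrow> (nat \<Rightarrow> real) \<Rightarrow> nat \<Rightarrow> real" where
  "resid n S x y t = y t - restr S (x t) \<bullet> ols S x {1..n} y"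

definition scaled_resid :: "nat \<Rightarrow> 'd::finite set \<Rightarrow> (nat \<Rightarrow> real ^ 'd) \<Rightarrow> (nat \<Rightarrow> real) \<Rightarrow> nat \<Rightarrow> real" where
  "scaled_resid n S x y t = resid n S x y t / sqrt (\<Sum>s=1..n. (resid n S x y s)\<^sup>2)"

definition s_hat_sq :: "'d::finite set \<Rightarrow> (nat \<Rightarrow> real ^ 'd) \<Rightarrow> (nat \<Rightarrow> real) \<Rightarrow> nat set \<Rightarrow> real" where
  "s_hat_sq S x r h = (\<Sum>t\<in>h. (r t - restr S (x t) \<bullet> ols S x h r)\<^sup>2) / real (card h)"

definition T3 :: "'d::finite set \<Rightarrow> nat set \<Rightarrow> nat set \<Rightarrow> (nat \<Rightarrow> real ^ 'd) \<Rightarrow> (nat \<Rightarrow> real) \<Rightarrow> real" where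
  "T3 S e f x r =
     (\<Sum>t\<in>e. (r t - restr S (x t) \<bullet> ols S x f r)\<^sup>2) / (s_hat_sq S x r f * real (card e)) - 1"

definition F1 :: "nat set set \<Rightarrow> (nat set \<times> nat set) set" where
  "F1 \<E> = {(e, f) \<in> \<E> \<times> \<E>. e \<inter> f = {}}"

definition T3_max :: "'d::finite set \<Rightarrow> nat set set \<Rightarrow> (nat \<Rightarrow> real ^ 'd) \<Rightarrow> (nat \<Rightarrow> real) \<Rightarrow> real" where
  "T3_max S \<E> x r = Max ((\<lambda>(e, f). \<bar>T3 S e f x r\<bar>) ` F1 \<E>)"

definition critical_value ::
  "((nat \<Rightarrow> real ^ 'd) \<Rightarrow> (nat \<Rightarrow> real) \<Rightarrow> real) \<Rightarrow> nat \<Rightarrow> 'd::finite set \<Rightarrow> real \<Rightarrow> nat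
    \<Rightarrow> (nat \<Rightarrow> real ^ 'd) \<Rightarrow> (nat \<Rightarrow> nat \<Rightarrow> real) \<Rightarrow> real" where
  "critical_value T n S \<alpha> B x \<epsilon> =
     sort (map (\<lambda>b. \<bar>T x (scaled_resid n S x (\<epsilon> b))\<bar>) [1..<B + 1])
       ! (nat \<lceil>real B * (1 - \<alpha>)\<rceil> - 1)"

definition resampling_test ::
  "((nat \<Rightarrow> real ^ 'd) \<Rightarrow> (nat \<Rightarrow> real) \<Rightarrow> real) \<Rightarrow> nat \<Rightarrow> 'd::finite set \<Rightarrow> real \<Rightarrow> nat
    \<Rightarrow> (nat \<Rightarrow> real) \<Rightarrow> (nat \<Rightarrow> real ^ 'd) \<Rightarrow> (nat \<Rightarrow> nat \<Rightarrow> real) \<Rightarrow> nat" where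
  "resampling_test T n S \<alpha> B y x \<epsilon> =
     of_bool (\<bar>T x (scaled_resid n S x y)\<bar> > critical_value T n S \<alpha> B x \<epsilon>)"

(* The law of (eps_1, ..., eps_B), i.i.d. N(0, Id) vectors in R^n. *)
definition resampling_law :: "nat \<Rightarrow> nat \<Rightarrow> (nat \<Rightarrow> nat \<Rightarrow> real) measure" where
  "resampling_law n B =
     Pi\<^sub>M {1..B} (\<lambda>_. Pi\<^sub>M {1..n} (\<lambda>_. density lborel (\<lambda>u. ennreal (std_normal_density u))))"

(* The probability that the test rejects.  The resampled vectors are independent of the
   data, so the joint law is the product measure. *)
definition rejection_prob ::
  "((nat \<Rightarrow> real ^ 'd) \<Rightarrow> (nat \<Rightarrow> real) \<Rightarrow> real) \<Rightarrow> nat \<Rightarrow> 'd::finite set \<Rightarrow> real \<Rightarrow> nat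
    \<Rightarrow> (nat \<Rightarrow> real \<times> (real ^ 'd)) measure \<Rightarrow> real" where
  "rejection_prob T n S \<alpha> B P =
     measure (P \<Otimes>\<^sub>M resampling_law n B)
       {(w, \<epsilon>) \<in> space (P \<Otimes>\<^sub>M resampling_law n B).
          resampling_test T n S \<alpha> B (\<lambda>t. fst (w t)) (\<lambda>t. snd (w t)) \<epsilon> = 1}"

subsection \<open>Change point model and multivariate normality\<close>

definition change_points :: "nat \<Rightarrow> nat list \<Rightarrow> bool" where
  "change_points n cp \<longleftrightarrow> set cp \<subseteq> {1..n - 1} \<and> sorted_wrt (<) cp"

(* segment n cp i is e_i(CP), for i in {1..L+1}. *)
definition segment :: "nat \<Rightarrow> nat list \<Rightarrow> nat \<Rightarrow> nat set" where
  "segment n cp i = {(0 # cp @ [n]) ! (i - 1) + 1 .. (0 # cp @ [n]) ! i}"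

definition segments :: "nat \<Rightarrow> nat list \<Rightarrow> nat set set" where
  "segments n cp = segment n cp ` {1..length cp + 1}"

(* n0 is the first index of the sequence: n <= L leaves no room for L change points. *)
definition asymptotic_cp_model ::
  "nat \<Rightarrow> nat \<Rightarrow> (nat \<Rightarrow> real) \<Rightarrow> (nat \<Rightarrow> nat list)
    \<Rightarrow> (nat \<Rightarrow> (nat \<Rightarrow> real \<times> (real ^ 'd)) measure) \<Rightarrow> bool" where
  "asymptotic_cp_model n0 L \<alpha>s CP P \<longleftrightarrow>
     (\<forall>i\<in>{1..L}. 0 < \<alpha>s i \<and> \<alpha>s i < 1 \<and> (\<lambda>n. real (CP n ! (i - 1)) / real n) \<longlonglongrightarrow> \<alpha>s i) \<and>
     (\<forall>n\<ge>n0. length (CP n) = L \<and> change_points n (CP n) \<and> data_law n (P n) \<and>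
        (\<forall>i\<in>{1..L + 1}.
           prob_space.indep_vars (P n) (\<lambda>_. borel) (\<lambda>t w. w t) (segment n (CP n) i) \<and>
           (\<exists>F. \<forall>t\<in>segment n (CP n) i. distr (P n) borel (\<lambda>w. w t) = F)))"

definition normal_law :: "real \<Rightarrow> real \<Rightarrow> real measure" where
  "normal_law m s =
     (if s = 0 then return borel m else density lborel (\<lambda>u. ennreal (normal_density m s u)))"

(* Every linear combination is normal.  Degenerate laws are allowed, so that a component
   of X may be constant (intercept). *)
definition jointly_normal :: "'w measure \<Rightarrow> 'i set \<Rightarrow> ('i \<Rightarrow> 'w \<Rightarrow> 'b::euclidean_space) \<Rightarrow> bool" where
  "jointly_normal M I Z \<longleftrightarrow>
     (\<forall>i\<in>I. Z i \<in> borel_measurable M) \<and>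
     (\<forall>u. \<exists>m s. 0 \<le> s \<and> distr M borel (\<lambda>w. \<Sum>i\<in>I. u i \<bullet> Z i w) = normal_law m s)"

definition multivariate_normality ::
  "nat \<Rightarrow> (nat \<Rightarrow> nat list) \<Rightarrow> (nat \<Rightarrow> (nat \<Rightarrow> real \<times> (real ^ 'd::finite)) measure) \<Rightarrow> bool" where
  "multivariate_normality n0 CP P \<longleftrightarrow>
     (\<forall>n\<ge>n0. \<forall>e\<in>segments n (CP n). jointly_normal (P n) e (\<lambda>t w. w t))"

(* Y_t = X^S_t b + eps_t for all t in e, with eps_t ~ N(0, s^2) independent of X^S_t. *)
definition regression_on ::
  "(nat \<Rightarrow> real \<times> (real ^ 'd::finite)) measure \<Rightarrow> 'd set \<Rightarrow> nat set \<Rightarrow> real ^ 'd \<Rightarrow> real \<Rightarrow> bool" where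
  "regression_on P S e b s \<longleftrightarrow>
     (\<forall>j. j \<notin> S \<longrightarrow> b $ j = 0) \<and> 0 \<le> s \<and>
     (\<forall>t\<in>e.
        distr P borel (\<lambda>w. fst (w t) - restr S (snd (w t)) \<bullet> b) = normal_law 0 s \<and>
        prob_space.indep_set P
          (sets (vimage_algebra (space P) (\<lambda>w. fst (w t) - restr S (snd (w t)) \<bullet> b) borel))
          (sets (vimage_algebra (space P) (\<lambda>w. restr S (snd (w t))) borel)))"

(* Existence and uniqueness of (beta_{e,S}, sigma_{e,S}).  In the centred nonsingular case it
   follows from multivariate normality; with nonzero means it also restricts S (an
   intercept has to be among the columns in S). *)
definition regression_parameters_exist ::
  "nat \<Rightarrow> (nat \<Rightarrow> nat list) \<Rightarrow> (nat \<Rightarrow> (nat \<Rightarrow> real \<times> (real ^ 'd::finite)) measure) \<Rightarrow> 'd set \<Rightarrow> bool" where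
  "regression_parameters_exist n0 CP P S \<longleftrightarrow>
     (\<forall>n\<ge>n0. \<forall>e\<in>segments n (CP n). \<exists>!(b, s). regression_on (P n) S e b s)"

(* The parameters for nonempty f are those of the segment e that contains f. *)
definition reg_coef ::
  "nat \<Rightarrow> nat list \<Rightarrow> (nat \<Rightarrow> real \<times> (real ^ 'd::finite)) measure \<Rightarrow> 'd set \<Rightarrow> nat set \<Rightarrow> real ^ 'd" where
  "reg_coef n cp P S f = (THE b. \<exists>e\<in>segments n cp. f \<subseteq> e \<and> (\<exists>s. regression_on P S e b s))"

definition reg_sd ::
  "nat \<Rightarrow> nat list \<Rightarrow> (nat \<Rightarrow> real \<times> (real ^ 'd::finite)) measure \<Rightarrow> 'd set \<Rightarrow> nat set \<Rightarrow> real" where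
  "reg_sd n cp P S f = (THE s. \<exists>e\<in>segments n cp. f \<subseteq> e \<and> (\<exists>b. regression_on P S e b s))"

definition H_A ::
  "nat \<Rightarrow> nat list \<Rightarrow> 'd::finite set \<Rightarrow> real \<Rightarrow> real \<Rightarrow> (nat \<Rightarrow> real \<times> (real ^ 'd)) measure set" where
  "H_A n cp S a b = {P. data_law n P \<and>
     (\<exists>i\<in>{1..length cp + 1}. \<exists>j\<in>{1..length cp + 1}.
        a = \<bar>(reg_sd n cp P S (segment n cp i))\<^sup>2 - (reg_sd n cp P S (segment n cp j))\<^sup>2\<bar> \<and> a > 0 \<and>
        b = norm (reg_coef n cp P S (segment n cp i) - reg_coef n cp P S (segment n cp j)) \<and> b > 0)}"

subsection \<open>Conditions on the environments\<close>

definition r_min :: "(nat \<Rightarrow> nat set set) \<Rightarrow> nat \<Rightarrow> nat" where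
  "r_min \<E> n = Min (card ` \<E> n)"

definition C1 :: "(nat \<Rightarrow> nat set set) \<Rightarrow> bool" where
  "C1 \<E> \<longleftrightarrow> filterlim (r_min \<E>) at_top sequentially"

definition C2 ::
  "nat \<Rightarrow> nat \<Rightarrow> (nat \<Rightarrow> nat list) \<Rightarrow> (nat \<Rightarrow> (nat \<Rightarrow> real \<times> (real ^ 'd::finite)) measure)
    \<Rightarrow> 'd set \<Rightarrow> (nat \<Rightarrow> nat set set) \<Rightarrow> bool" where
  "C2 n0 L CP P S \<E> \<longleftrightarrow>
     (\<forall>i\<in>{1..L + 1}. \<exists>f N.
        (\<forall>n\<ge>n0. f n \<in> \<E> n) \<and>
        (\<forall>n\<ge>N. f n \<subseteq> segment n (CP n) i) \<and>
        convergent (\<lambda>n. reg_coef n (CP n) (P n) S (f n)) \<and>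
        (\<exists>v>0. (\<lambda>n. (reg_sd n (CP n) (P n) S (f n))\<^sup>2) \<longlonglongrightarrow> v))"

definition eigenvalues :: "real ^ 'd ^ 'd \<Rightarrow> real set" where
  "eigenvalues A = {l. \<exists>v. v \<noteq> 0 \<and> A *v v = l *\<^sub>R v}"

(* (1/|e|) X_e^T X_e, with all columns of X. *)
definition cov_matrix :: "(nat \<Rightarrow> real ^ 'd) \<Rightarrow> nat set \<Rightarrow> real ^ 'd ^ 'd" where
  "cov_matrix x e = (1 / real (card e)) *\<^sub>R gram UNIV x e"

definition C3 ::
  "nat \<Rightarrow> (nat \<Rightarrow> (nat \<Rightarrow> real \<times> (real ^ 'd::finite)) measure) \<Rightarrow> nat \<Rightarrow> (nat \<Rightarrow> nat set set) \<Rightarrow> bool" where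
  "C3 n0 P k \<E> \<longleftrightarrow>
     (\<forall>n\<ge>n0. \<forall>e\<in>\<E> n. AE w in P n. invertible (cov_matrix (\<lambda>t. snd (w t)) e)) \<and>
     (\<exists>c C. 0 < c \<and> (\<forall>n\<ge>n0. \<forall>e\<in>\<E> n.
        integrable (P n) (\<lambda>w. Min (eigenvalues (cov_matrix (\<lambda>t. snd (w t)) e)) ^ (2 * k)) \<and>
        integrable (P n) (\<lambda>w. Max (eigenvalues (cov_matrix (\<lambda>t. snd (w t)) e)) ^ (2 * k)) \<and>
        c \<le> (LINT w|P n. Min (eigenvalues (cov_matrix (\<lambda>t. snd (w t)) e)) ^ (2 * k)) \<and>
        (LINT w|P n. Max (eigenvalues (cov_matrix (\<lambda>t. snd (w t)) e)) ^ (2 * k)) \<le> C))"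

end

theory Submission
  imports Defs
begin

text \<open>
Write u for the larger of a_n and b_n^2, r for the smallest size of an environment, and Sigma_e
for X_e^T X_e / |e|. The statistic compares the mean squared residual on e of the fit made on f
with the residual variance on f. The proof exhibits a level of order u that all resampled
statistics stay below and that the observed statistic exceeds, both with probability tending to
one.

Deterministic part. T3 does not change when the response is rescaled or shifted by X beta, so
the scaled residuals may be replaced by the responses, and under resampling by the Gaussian
noise itself (\<open>T3_scaled_resid\<close>). On environments whose Sigma has its eigenvalues
between two positive constants, everything is governed by two empirical quantities of an
environment: the mean of the squared errors and the mean of error times row. If all of them are
within eta of their expectations, every resampled statistic is at most a constant times eta
(\<open>T3_null_bound\<close>). For a pair of environments in segments with different
parameters, with the larger variance in the role of e, the observed statistic is at least a
constant times the variance difference plus the squared norm of the coefficient difference,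
minus a constant times eta (\<open>T3_alternative_bound\<close>). Taking eta = theta u with a
small constant theta separates the two.

Design. The eigenvalue moments enter through the environments that lie inside the segments. For
Gaussian rows a moment of order 4k is at most a constant times the power 2k of the second
moment, so these moments confine the second moments of X in every segment between two positive
constants (\<open>second_moment_bounds_of_eigenvalue_moments\<close>). Any environment then has
a well conditioned Sigma outside an event that is exponentially small in its size
(\<open>well_conditioned_exponential\<close>). This covers environments that meet several
segments, whose rows may depend on each other in any way: one of the at most L + 1 pieces
carries a fixed proportion of the rows.

Rates. For Gaussian noise the probability that an environment is off by eta is exponentially
small in eta^2 r (\<open>null_concentration\<close>), and the events concern single
environments, not pairs. The rate hypothesis gives |E_n|^2 \<le> (u^2 r)^k, so the union bound
over the environments is beaten by the exponential (\<open>exponential_beats_rate\<close>). For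
the two environments that witness the alternative, Chebyshev's inequality is enough
(\<open>regression_error_concentration\<close>).

The limit in B. Given the data, the test rejects iff the number of resampled statistics below
the observed one, a binomial variable, is at least B (1 - alpha). Hoeffding's inequality, and
the central limit theorem at the boundary, show that the conditional rejection probability
always converges, and its limit is 1 as soon as the observed statistic exceeds more than a
proportion 1 - alpha of the resampling law (\<open>hit_frequency_limit\<close>,
\<open>rejection_prob_limit\<close>).
\<close>

section \<open>Least squares restricted to the columns in S\<close>

lemma restr_linear: "linear (restr S)"
  by (rule linearI) (auto simp: restr_def vec_eq_iff)

lemma restr_idem [simp]: "restr S (restr S x) = restr S x"
  by (simp add: restr_def vec_eq_iff)

lemma inner_restr_commute: "restr S x \<bullet> v = x \<bullet> restr S v"
  by (auto simp: restr_def inner_vec_def intro!: sum.cong)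

lemma restr_inner_restr: "restr S x \<bullet> restr S v = restr S x \<bullet> v"
  by (metis inner_restr_commute restr_idem)

lemma gram_mult_vector:
  "gram S x h *v v = (\<Sum>t\<in>h. (restr S (x t) \<bullet> v) *\<^sub>R restr S (x t))"
  by (simp add: gram_def vec_eq_iff matrix_vector_mult_def inner_vec_def sum_distrib_right
      sum_distrib_left sum_component) (subst sum.swap, simp add: mult_ac)

lemma id_on_mult_vector: "id_on S *v v = restr S v"
  by (auto simp: id_on_def restr_def vec_eq_iff matrix_vector_mult_def if_distrib if_distribR
      cong: if_cong)

lemma matrix_ring_distribs:
  fixes A B C :: "real ^ 'd ^ 'd"
  shows matrix_add_ldistrib: "A ** (B + C) = A ** B + A ** C"
    and matrix_add_rdistrib: "(B + C) ** A = B ** A + C ** A"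
    and matrix_diff_ldistrib: "A ** (B - C) = A ** B - A ** C"
    and matrix_diff_rdistrib: "(B - C) ** A = B ** A - C ** A"
  by (simp_all add: matrix_matrix_mult_def vec_eq_iff algebra_simps sum.distrib sum_subtractf)

lemma matrix_inv_right_left:
  fixes A :: "real ^ 'd ^ 'd"
  assumes "invertible A"
  shows "A ** matrix_inv A = mat 1" "matrix_inv A ** A = mat 1"
  using someI_ex[OF assms[unfolded invertible_def]] by (simp_all add: matrix_inv_def)

text \<open>
Adding the identity on the coordinates outside S turns invertibility of an S x S block into
invertibility of an ordinary matrix: the bordered matrix is block diagonal, and its inverse
minus the border is the inverse of the block. This also gives a formula in the entries, which
the measurability of least squares needs, including the constant value in the singular case.
\<close>

lemma inv_on_bordered:
  fixes A :: "real^'d::finite^'d"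
  assumes supp: "\<And>i j. i \<notin> S \<or> j \<notin> S \<Longrightarrow> A $ i $ j = 0"
  shows "inv_on S A = (if det (A + id_on (- S)) \<noteq> 0 then matrix_inv (A + id_on (- S)) - id_on (- S)
     else (SOME B. False))"
    and "det (A + id_on (- S)) \<noteq> 0 \<Longrightarrow> inv_on S A ** A = id_on S \<and> A ** inv_on S A = id_on S
      \<and> (\<forall>i j. i \<notin> S \<or> j \<notin> S \<longrightarrow> inv_on S A $ i $ j = 0)"
proof -
  let ?D = "id_on (-S) :: real^'d^'d" and ?E = "id_on S :: real^'d^'d"
  let ?Q = "\<lambda>B :: real^'d^'d. (\<forall>i j. i \<notin> S \<or> j \<notin> S \<longrightarrow> B $ i $ j = 0) \<and> A ** B = ?E \<and> B ** A = ?E"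
  have ED: "?E + ?D = mat 1"
    by (auto simp: id_on_def mat_def vec_eq_iff)
  have D_left: "?D ** B = (\<chi> i j. if i \<in> S then 0 else B $ i $ j)" for B :: "real^'d^'d"
    by (auto simp: id_on_def matrix_matrix_mult_def vec_eq_iff if_distrib if_distribR cong: if_cong)
  have D_right: "B ** ?D = (\<chi> i j. if j \<in> S then 0 else B $ i $ j)" for B :: "real^'d^'d"
  proof -
    have "(\<Sum>k\<in>UNIV. B $ i $ k * (if k = j \<and> k \<in> - S then 1 else 0)) = (if j \<in> S then 0 else B $ i $ j)"
      for i j
      by (subst sum.cong[OF refl, of _ _ "\<lambda>k. if k = j then (if j \<in> S then 0 else B $ i $ j) else 0"])
        auto
    then show ?thesis by (simp add: id_on_def matrix_matrix_mult_def vec_eq_iff)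
  qed
  have DD: "?D ** ?D = ?D" unfolding D_left by (auto simp: id_on_def vec_eq_iff)
  have AD: "A ** ?D = 0" "?D ** A = 0"
    unfolding D_left D_right using supp by (auto simp: vec_eq_iff)
  have inv: "?Q B \<Longrightarrow> (A + ?D) ** (B + ?D) = mat 1" for B
  proof -
    assume Q: "?Q B"
    then have "?D ** B = 0" unfolding D_left by (auto simp: vec_eq_iff)
    with Q AD DD ED show ?thesis
      by (simp add: matrix_add_ldistrib matrix_add_rdistrib)
  qed
  have ex: "?Q (matrix_inv (A + ?D) - ?D)" if "det (A + ?D) \<noteq> 0"
  proof -
    let ?M = "A + ?D" and ?B = "matrix_inv (A + ?D)"
    have I: "?M ** ?B = mat 1" "?B ** ?M = mat 1"
      using that matrix_inv_right_left[of ?M] invertible_det_nz by auto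
    have MD: "?M ** ?D = ?D" "?D ** ?M = ?D"
      using AD DD by (simp_all add: matrix_add_ldistrib matrix_add_rdistrib)
    have BD: "?B ** ?D = ?D"
      by (metis I(2) MD(1) matrix_mul_assoc matrix_mul_lid)
    have DB: "?D ** ?B = ?D"
      by (metis I(1) MD(2) matrix_mul_assoc matrix_mul_rid)
    have "?D ** (?B - ?D) = 0" "(?B - ?D) ** ?D = 0"
      using BD DB DD by (simp_all add: matrix_diff_ldistrib matrix_diff_rdistrib)
    then have 1: "\<forall>i j. i \<notin> S \<or> j \<notin> S \<longrightarrow> (?B - ?D) $ i $ j = 0"
      unfolding D_left D_right vec_eq_iff vec_lambda_beta zero_index by metis
    have A: "A = ?M - ?D" by simp
    have 2: "A ** (?B - ?D) = ?E"
    proof -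
      have "A ** (?B - ?D) = A ** ?B" using AD by (simp add: matrix_diff_ldistrib)
      also have "\<dots> = ?M ** ?B - ?D ** ?B" by (subst A) (simp only: matrix_diff_rdistrib)
      also have "\<dots> = ?E" using I DB ED by (simp add: algebra_simps)
      finally show ?thesis .
    qed
    have 3: "(?B - ?D) ** A = ?E"
    proof -
      have "(?B - ?D) ** A = ?B ** A" using AD by (simp add: matrix_diff_rdistrib)
      also have "\<dots> = ?B ** ?M - ?B ** ?D" by (subst A) (simp only: matrix_diff_ldistrib)
      also have "\<dots> = ?E" using I BD ED by (simp add: algebra_simps)
      finally show ?thesis .
    qed
    from 1 2 3 show ?thesis by blast
  qed
  have uniq: "B = matrix_inv (A + ?D) - ?D" if "?Q B" "det (A + ?D) \<noteq> 0" for B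
  proof -
    have "B + ?D = matrix_inv (A + ?D)"
      using inv[OF that(1)] matrix_inv_right_left[of "A + ?D"] that(2) invertible_det_nz
      by (metis matrix_mul_assoc matrix_mul_lid matrix_mul_rid)
    then show ?thesis by (simp add: algebra_simps)
  qed
  have no: "\<not> ?Q B" if "det (A + ?D) = 0" for B
    using inv[of B] that by (metis det_I det_mul mult_zero_left zero_neq_one)
  have some: "inv_on S A = (SOME B. ?Q B)"
    by (simp add: inv_on_def conj_assoc)
  show "inv_on S A = (if det (A + ?D) \<noteq> 0 then matrix_inv (A + ?D) - ?D else (SOME B. False))"
  proof (cases "det (A + ?D) = 0")
    case True
    then have "?Q = (\<lambda>B. False)" using no by (intro ext) (simp only: not_False_eq_True)
    then show ?thesis using True some by simp
  next
    case False
    have "(SOME B. ?Q B) = matrix_inv (A + ?D) - ?D"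
      by (rule some_equality[of ?Q, OF ex[OF False] uniq[OF _ False]])
    then show ?thesis using some False by simp
  qed
  show "inv_on S A ** A = ?E \<and> A ** inv_on S A = ?E
      \<and> (\<forall>i j. i \<notin> S \<or> j \<notin> S \<longrightarrow> inv_on S A $ i $ j = 0)" if "det (A + ?D) \<noteq> 0"
    using someI[of ?Q, OF ex[OF that]] some by simp
qed


lemma gram_outside: "i \<notin> S \<or> j \<notin> S \<Longrightarrow> gram S x h $ i $ j = 0"
  by (auto simp: gram_def restr_def)

lemmas inv_on_gram = inv_on_bordered[of S "gram S x h" for S x h, OF gram_outside]

section \<open>Scale and shift invariance of the statistic\<close>

definition emp_mean :: "nat set \<Rightarrow> (nat \<Rightarrow> 'a::real_vector) \<Rightarrow> 'a" where
  "emp_mean h g = (1 / real (card h)) *\<^sub>R (\<Sum>t\<in>h. g t)"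

text \<open>
The eigenvalues of X_h^T X_h / |h| lie between c and K; the quadratic form expresses this
without spectral theory. The bounds for all columns imply those for the columns in S.
\<close>

definition well_conditioned :: "real \<Rightarrow> real \<Rightarrow> (nat \<Rightarrow> real ^ 'd) \<Rightarrow> nat set \<Rightarrow> bool" where
  "well_conditioned c K x h \<longleftrightarrow>
     (\<forall>v. c * (norm v)\<^sup>2 \<le> emp_mean h (\<lambda>t. (x t \<bullet> v)\<^sup>2) \<and>
          emp_mean h (\<lambda>t. (x t \<bullet> v)\<^sup>2) \<le> K * (norm v)\<^sup>2)"

text \<open>
For a given design, the statistic depends on the errors only through these two empirical
quantities on e and on f; v and 0 are their expectations.
\<close>

definition errors_within :: "real \<Rightarrow> real \<Rightarrow> (nat \<Rightarrow> real) \<Rightarrow> (nat \<Rightarrow> real ^ 'd) \<Rightarrow> nat set \<Rightarrow> bool" where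
  "errors_within \<eta> v \<epsilon> z h \<longleftrightarrow>
     \<bar>emp_mean h (\<lambda>t. (\<epsilon> t)\<^sup>2) - v\<bar> \<le> \<eta> \<and> norm (emp_mean h (\<lambda>t. \<epsilon> t *\<^sub>R z t)) \<le> \<eta>"

text \<open>
Full column rank of X^S_h.
\<close>

definition regular_design :: "'d::finite set \<Rightarrow> (nat \<Rightarrow> real ^ 'd) \<Rightarrow> nat set \<Rightarrow> bool" where
  "regular_design S x h \<longleftrightarrow> det (gram S x h + id_on (- S)) \<noteq> 0"

lemma restr_add_compl: "restr S v + restr (- S) v = v"
  by (auto simp: restr_def vec_eq_iff)

lemma well_conditioned_regular:
  assumes "0 < c" "well_conditioned c K x h"
  shows "regular_design S x h"
proof -
  let ?M = "gram S x h + id_on (- S)"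
  have "v = 0" if "?M *v v = 0" for v
  proof -
    have eq: "gram S x h *v v + restr (- S) v = 0"
      using that by (simp add: matrix_vector_mult_add_rdistrib id_on_mult_vector)
    have o: "restr S v \<bullet> restr (- S) v = 0"
      by (auto simp: restr_def inner_vec_def intro!: sum.neutral)
    have "0 = restr S v \<bullet> (gram S x h *v v + restr (- S) v)"
      unfolding eq by simp
    also have "\<dots> = restr S v \<bullet> (gram S x h *v v)" by (simp add: inner_add_right o)
    also have "\<dots> = (\<Sum>t\<in>h. (x t \<bullet> restr S v)\<^sup>2)"
    proof -
      have "restr S v \<bullet> restr S (x t) = x t \<bullet> restr S v" for t
        by (metis inner_commute inner_restr_commute restr_inner_restr)
      then show ?thesis
        by (simp add: gram_mult_vector inner_sum_right power2_eq_square inner_restr_commute)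
    qed
    finally have "emp_mean h (\<lambda>t. (x t \<bullet> restr S v)\<^sup>2) = 0" by (simp add: emp_mean_def)
    then have "c * (norm (restr S v))\<^sup>2 \<le> 0"
      using assms(2) by (metis well_conditioned_def)
    then have 0: "restr S v = 0" using \<open>0 < c\<close> by (simp add: mult_le_0_iff)
    have "gram S x h *v v = 0"
      unfolding gram_mult_vector inner_restr_commute 0 by simp
    with eq 0 restr_add_compl[of S v] show "v = 0" by simp
  qed
  then have "invertible ?M"
    by (metis invertible_left_inverse matrix_left_invertible_ker)
  then show ?thesis by (simp add: regular_design_def invertible_det_nz)
qed

lemma ols_restr:
  assumes "regular_design S x h"
  shows "restr S (ols S x h y) = ols S x h y"
  using inv_on_gram(2)[of S x h] assms
  by (auto simp: regular_design_def restr_def ols_def vec_eq_iff matrix_vector_mult_def intro!: sum.neutral[symmetric])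

lemma gram_mult_ols:
  assumes "regular_design S x h"
  shows "gram S x h *v ols S x h y = (\<Sum>t\<in>h. y t *\<^sub>R restr S (x t))"
proof -
  have "gram S x h *v ols S x h y = restr S (\<Sum>t\<in>h. y t *\<^sub>R restr S (x t))"
    using inv_on_gram(2)[of S x h] assms
    by (simp add: ols_def regular_design_def matrix_vector_mul_assoc id_on_mult_vector)
  then show ?thesis
    by (simp add: linear_sum[OF restr_linear] linear_cmul[OF restr_linear])
qed

lemma ols_affine:
  assumes "regular_design S x h"
  shows "ols S x h (\<lambda>t. u * (y t - restr S (x t) \<bullet> \<beta>)) = u *\<^sub>R (ols S x h y - restr S \<beta>)"
proof -
  have "(\<Sum>t\<in>h. (u * (y t - restr S (x t) \<bullet> \<beta>)) *\<^sub>R restr S (x t))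
      = u *\<^sub>R ((\<Sum>t\<in>h. y t *\<^sub>R restr S (x t)) - gram S x h *v \<beta>)"
    by (simp add: gram_mult_vector scaleR_sum_right scaleR_diff_left right_diff_distrib sum_subtractf
        scaleR_diff_right)
  moreover have "inv_on S (gram S x h) *v (gram S x h *v \<beta>) = restr S \<beta>"
    using inv_on_gram(2)[of S x h] assms
    by (simp add: regular_design_def matrix_vector_mul_assoc id_on_mult_vector)
  ultimately show ?thesis
    by (simp add: ols_def matrix_vector_mult_diff_distrib matrix_vector_mult_scaleR)
qed

lemma ols_cong: "(\<And>t. t \<in> h \<Longrightarrow> y t = y' t) \<Longrightarrow> ols S x h y = ols S x h y'"
  by (simp add: ols_def)

text \<open>
Least squares is equivariant: the fit of u (y - X beta) is u times the fit of y, shifted by - u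
beta, so the residuals are only rescaled, also on rows outside h.
\<close>

lemma residual_affine:
  assumes "regular_design S x h"
  shows "u * (y t - restr S (x t) \<bullet> \<beta>)
      - restr S (x t) \<bullet> ols S x h (\<lambda>t. u * (y t - restr S (x t) \<bullet> \<beta>))
      = u * (y t - restr S (x t) \<bullet> ols S x h y)"
  unfolding ols_affine[OF assms] by (simp add: inner_diff_right restr_inner_restr algebra_simps)

lemma s_hat_sq_affine:
  assumes "regular_design S x f"
  shows "s_hat_sq S x (\<lambda>t. u * (y t - restr S (x t) \<bullet> \<beta>)) f = u\<^sup>2 * s_hat_sq S x y f"
  by (simp add: s_hat_sq_def residual_affine[OF assms] power_mult_distrib sum_distrib_left)

lemma T3_affine:
  assumes "regular_design S x f" "u \<noteq> 0"
  shows "T3 S e f x (\<lambda>t. u * (y t - restr S (x t) \<bullet> \<beta>)) = T3 S e f x y"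
  using assms
  by (simp add: T3_def s_hat_sq_affine residual_affine power_mult_distrib mult.assoc flip: sum_distrib_left)

lemma s_hat_sq_cong:
  assumes "\<And>t. t \<in> h \<Longrightarrow> y t = y' t"
  shows "s_hat_sq S x y h = s_hat_sq S x y' h"
proof -
  have "ols S x h y = ols S x h y'" by (rule ols_cong) (fact assms)
  then show ?thesis using assms by (simp add: s_hat_sq_def)
qed

text \<open>
The scaled residuals are an affine image of the response, so invariance applies once the
scaling factor is finite. It is: if all residuals vanished, the response would be linear in the
rows and the residual variance on f would be 0.
\<close>

lemma T3_scaled_resid:
  assumes f: "f \<subseteq> {1..n}" and reg: "regular_design S x f" and pos: "0 < s_hat_sq S x y f"
  shows "T3 S e f x (scaled_resid n S x y) = T3 S e f x y"
proof -
  let ?\<beta> = "ols S x {1..n} y"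
  let ?Q = "\<Sum>s=1..n. (resid n S x y s)\<^sup>2"
  have "?Q \<noteq> 0"
  proof
    assume "?Q = 0"
    then have "\<forall>t\<in>{1..n}. resid n S x y t = 0" by (simp add: sum_nonneg_eq_0_iff)
    then have z: "y t - restr S (x t) \<bullet> ?\<beta> = 0" if "t \<in> f" for t
      using f that unfolding resid_def by blast
    have "s_hat_sq S x y f = s_hat_sq S x (\<lambda>t. 1 * (y t - restr S (x t) \<bullet> ?\<beta>)) f"
      by (subst s_hat_sq_affine[OF reg]) simp
    also have "\<dots> = s_hat_sq S x (\<lambda>t. 0) f" by (rule s_hat_sq_cong) (simp only: z mult_zero_right)
    also have "\<dots> = 0" by (simp add: s_hat_sq_def ols_def)
    finally show False using pos by simp
  qed
  moreover have "scaled_resid n S x y = (\<lambda>t. (1 / sqrt ?Q) * (y t - restr S (x t) \<bullet> ?\<beta>))"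
    by (simp add: scaled_resid_def[abs_def] resid_def)
  ultimately show ?thesis
    using T3_affine[OF reg, of "1 / sqrt ?Q" e y ?\<beta>] by simp
qed

section \<open>Deterministic bounds on the statistic\<close>

lemma emp_mean_quadratic:
  "emp_mean h (\<lambda>t. (\<epsilon> t + z t \<bullet> v)\<^sup>2)
     = emp_mean h (\<lambda>t. (\<epsilon> t)\<^sup>2) + 2 * (emp_mean h (\<lambda>t. \<epsilon> t *\<^sub>R z t) \<bullet> v) + emp_mean h (\<lambda>t. (z t \<bullet> v)\<^sup>2)"
proof -
  have "(\<Sum>t\<in>h. (\<epsilon> t + z t \<bullet> v)\<^sup>2)
      = (\<Sum>t\<in>h. (\<epsilon> t)\<^sup>2) + 2 * ((\<Sum>t\<in>h. \<epsilon> t *\<^sub>R z t) \<bullet> v) + (\<Sum>t\<in>h. (z t \<bullet> v)\<^sup>2)"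
    by (simp add: power2_sum sum.distrib inner_sum_left sum_distrib_left mult_ac)
  then show ?thesis by (simp add: emp_mean_def add_divide_distrib)
qed

lemma emp_mean_restr: "restr S v = v \<Longrightarrow> emp_mean h (\<lambda>t. (restr S (x t) \<bullet> v)\<^sup>2) = emp_mean h (\<lambda>t. (x t \<bullet> v)\<^sup>2)"
  by (simp add: inner_restr_commute)

lemma s_hat_sq_emp_mean:
  "s_hat_sq S x r f = emp_mean f (\<lambda>t. (r t - restr S (x t) \<bullet> ols S x f r)\<^sup>2)"
  by (simp add: s_hat_sq_def emp_mean_def)

text \<open>
The normal equations identify delta' Sigma delta with Z' delta. The lower bound on Sigma and
the Cauchy-Schwarz inequality then bound the estimation error delta by |Z| / c, and the
residual variance differs from the mean squared error by exactly Z' delta.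
\<close>

lemma ols_error:
  fixes x :: "nat \<Rightarrow> real ^ 'd::finite" and S :: "'d set" and \<epsilon> :: "nat \<Rightarrow> real"
  assumes c: "0 < c" and wc: "well_conditioned c K x f"
  defines "\<delta> \<equiv> ols S x f \<epsilon>" and "Z \<equiv> emp_mean f (\<lambda>t. \<epsilon> t *\<^sub>R restr S (x t))"
  shows "norm \<delta> \<le> norm Z / c"
    and "s_hat_sq S x \<epsilon> f \<le> emp_mean f (\<lambda>t. (\<epsilon> t)\<^sup>2)"
    and "emp_mean f (\<lambda>t. (\<epsilon> t)\<^sup>2) - (norm Z)\<^sup>2 / c \<le> s_hat_sq S x \<epsilon> f"
proof -
  note reg = well_conditioned_regular[OF c wc]
  have r: "restr S \<delta> = \<delta>" unfolding \<delta>_def by (rule ols_restr[OF reg])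
  have "(\<Sum>t\<in>f. (restr S (x t) \<bullet> \<delta>)\<^sup>2) = (gram S x f *v \<delta>) \<bullet> \<delta>"
    by (simp add: gram_mult_vector inner_sum_left power2_eq_square)
  also have "\<dots> = (\<Sum>t\<in>f. \<epsilon> t *\<^sub>R restr S (x t)) \<bullet> \<delta>"
    unfolding \<delta>_def gram_mult_ols[OF reg] ..
  finally have normal: "emp_mean f (\<lambda>t. (restr S (x t) \<bullet> \<delta>)\<^sup>2) = Z \<bullet> \<delta>"
    by (simp add: emp_mean_def Z_def)
  have "c * (norm \<delta>)\<^sup>2 \<le> Z \<bullet> \<delta>"
    using wc r normal emp_mean_restr[of S \<delta> f x] by (metis well_conditioned_def)
  also have "Z \<bullet> \<delta> \<le> norm Z * norm \<delta>" by (rule norm_cauchy_schwarz)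
  finally have "norm \<delta> * (c * norm \<delta>) \<le> norm \<delta> * norm Z"
    by (simp add: power2_eq_square mult_ac)
  then have "c * norm \<delta> \<le> norm Z"
    by (cases "norm \<delta> = 0") (simp_all only: mult_le_cancel_left_pos[of "norm \<delta>"] zero_less_norm_iff norm_eq_zero, simp_all)
  then show d: "norm \<delta> \<le> norm Z / c" using c by (simp add: field_simps)
  have s: "s_hat_sq S x \<epsilon> f = emp_mean f (\<lambda>t. (\<epsilon> t)\<^sup>2) - Z \<bullet> \<delta>"
    using emp_mean_quadratic[of f \<epsilon> "\<lambda>t. restr S (x t)" "- \<delta>"] normal
    by (simp add: s_hat_sq_emp_mean \<delta>_def[symmetric] Z_def[symmetric])
  have "0 \<le> Z \<bullet> \<delta>" unfolding normal[symmetric] by (simp add: emp_mean_def sum_nonneg)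
  then show "s_hat_sq S x \<epsilon> f \<le> emp_mean f (\<lambda>t. (\<epsilon> t)\<^sup>2)" using s by simp
  have "Z \<bullet> \<delta> \<le> norm Z * (norm Z / c)"
    using norm_cauchy_schwarz[of Z \<delta>] d mult_left_mono[OF d, of "norm Z"] by simp
  then show "emp_mean f (\<lambda>t. (\<epsilon> t)\<^sup>2) - (norm Z)\<^sup>2 / c \<le> s_hat_sq S x \<epsilon> f"
    using s by (simp add: power2_eq_square)
qed

lemma T3_emp_mean:
  assumes "card e \<noteq> 0" "s_hat_sq S x r f \<noteq> 0"
  shows "T3 S e f x r
    = (emp_mean e (\<lambda>t. (r t - restr S (x t) \<bullet> ols S x f r)\<^sup>2) - s_hat_sq S x r f) / s_hat_sq S x r f"
  using assms by (simp add: T3_def emp_mean_def field_simps)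

text \<open>
With pure noise as response, the numerator and the denominator of the statistic are both within
(1 + 2 / c + K / c^2) eta of 1.
\<close>

lemma T3_null_bound:
  assumes c: "0 < c" and K: "0 \<le> K" and wc: "well_conditioned c K x e" "well_conditioned c K x f" and e: "card e \<noteq> 0"
    and err: "errors_within \<eta> 1 \<epsilon> (\<lambda>t. restr S (x t)) e" "errors_within \<eta> 1 \<epsilon> (\<lambda>t. restr S (x t)) f"
    and \<eta>: "\<eta> \<le> 1" "(1 + 2 / c + K / c\<^sup>2) * \<eta> \<le> 1 / 2"
  shows "0 < s_hat_sq S x \<epsilon> f" "\<bar>T3 S e f x \<epsilon>\<bar> \<le> 4 * ((1 + 2 / c + K / c\<^sup>2) * \<eta>)"
proof -
  let ?\<delta> = "ols S x f \<epsilon>" and ?Ze = "emp_mean e (\<lambda>t. \<epsilon> t *\<^sub>R restr S (x t))"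
    and ?Zf = "emp_mean f (\<lambda>t. \<epsilon> t *\<^sub>R restr S (x t))"
  let ?N = "emp_mean e (\<lambda>t. (\<epsilon> t - restr S (x t) \<bullet> ?\<delta>)\<^sup>2)" and ?s = "s_hat_sq S x \<epsilon> f"
  have A: "\<bar>emp_mean e (\<lambda>t. (\<epsilon> t)\<^sup>2) - 1\<bar> \<le> \<eta>" "\<bar>emp_mean f (\<lambda>t. (\<epsilon> t)\<^sup>2) - 1\<bar> \<le> \<eta>"
    and Z: "norm ?Ze \<le> \<eta>" "norm ?Zf \<le> \<eta>"
    using err by (simp_all add: errors_within_def)
  define \<xi> where "\<xi> = (1 + 2 / c + K / c\<^sup>2) * \<eta>"
  have \<eta>0: "0 \<le> \<eta>" using A(1) by linarith
  have \<eta>2: "\<eta>\<^sup>2 \<le> \<eta>" using \<eta>0 \<eta>(1) by (simp add: power2_eq_square mult_left_le)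
  note oe = ols_error[OF c wc(2), where S = S and \<epsilon> = \<epsilon>]
  have r: "restr S ?\<delta> = ?\<delta>" by (rule ols_restr[OF well_conditioned_regular[OF c wc(2)]])
  have d: "norm ?\<delta> \<le> \<eta> / c"
    using oe(1) divide_right_mono[OF Z(2), of c] c by linarith
  have d2: "(norm ?\<delta>)\<^sup>2 \<le> \<eta> / c\<^sup>2"
  proof -
    have "(norm ?\<delta>)\<^sup>2 \<le> (\<eta> / c)\<^sup>2" using d by (intro power_mono) auto
    also have "\<dots> \<le> \<eta> / c\<^sup>2" using \<eta>2 by (simp add: power_divide divide_right_mono)
    finally show ?thesis .
  qed
  have N: "?N = emp_mean e (\<lambda>t. (\<epsilon> t)\<^sup>2) - 2 * (?Ze \<bullet> ?\<delta>) + emp_mean e (\<lambda>t. (x t \<bullet> ?\<delta>)\<^sup>2)"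
    using emp_mean_quadratic[of e \<epsilon> "\<lambda>t. restr S (x t)" "- ?\<delta>"] emp_mean_restr[OF r, of e x] by simp
  have z: "\<bar>?Ze \<bullet> ?\<delta>\<bar> \<le> \<eta> / c"
  proof -
    have "\<bar>?Ze \<bullet> ?\<delta>\<bar> \<le> norm ?Ze * norm ?\<delta>" by (rule Cauchy_Schwarz_ineq2)
    also have "\<dots> \<le> \<eta> * (\<eta> / c)" using Z(1) d \<eta>0 by (intro mult_mono) auto
    also have "\<dots> \<le> \<eta> / c" using \<eta>2 c by (simp add: power2_eq_square divide_right_mono)
    finally show ?thesis .
  qed
  have q: "0 \<le> emp_mean e (\<lambda>t. (x t \<bullet> ?\<delta>)\<^sup>2)" "emp_mean e (\<lambda>t. (x t \<bullet> ?\<delta>)\<^sup>2) \<le> K / c\<^sup>2 * \<eta>"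
  proof -
    show "0 \<le> emp_mean e (\<lambda>t. (x t \<bullet> ?\<delta>)\<^sup>2)" by (simp add: emp_mean_def sum_nonneg)
    have "emp_mean e (\<lambda>t. (x t \<bullet> ?\<delta>)\<^sup>2) \<le> K * (norm ?\<delta>)\<^sup>2" using wc(1) by (simp add: well_conditioned_def)
    also have "\<dots> \<le> K * (\<eta> / c\<^sup>2)" using d2 K by (rule mult_left_mono)
    finally show "emp_mean e (\<lambda>t. (x t \<bullet> ?\<delta>)\<^sup>2) \<le> K / c\<^sup>2 * \<eta>" by simp
  qed
  have \<xi>: "\<xi> = \<eta> + 2 * (\<eta> / c) + K / c\<^sup>2 * \<eta>" by (simp add: \<xi>_def algebra_simps)
  have N1: "\<bar>?N - 1\<bar> \<le> \<xi>" using N z q A(1) \<xi> by linarith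
  have pos: "0 \<le> \<eta> / c" "0 \<le> K / c\<^sup>2 * \<eta>" using \<eta>0 c K by auto
  have s1: "\<bar>?s - 1\<bar> \<le> \<xi>"
  proof -
    have "(norm ?Zf)\<^sup>2 \<le> \<eta>\<^sup>2" using Z(2) by (intro power_mono) auto
    then have "(norm ?Zf)\<^sup>2 / c \<le> \<eta> / c" using \<eta>2 c by (intro divide_right_mono) auto
    then show ?thesis using oe(2,3) A(2) \<xi> pos by linarith
  qed
  have \<xi>2: "\<xi> \<le> 1 / 2" using \<eta>(2) by (simp add: \<xi>_def)
  then have s2: "1 / 2 \<le> ?s" using s1 by linarith
  then show "0 < ?s" by linarith
  have "\<bar>T3 S e f x \<epsilon>\<bar> = \<bar>?N - ?s\<bar> / ?s"
    using s2 e by (subst T3_emp_mean) auto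
  also have "\<dots> \<le> (2 * \<xi>) / (1 / 2)"
    using N1 s1 s2 by (intro frac_le) auto
  finally show "\<bar>T3 S e f x \<epsilon>\<bar> \<le> 4 * ((1 + 2 / c + K / c\<^sup>2) * \<eta>)" by (simp add: \<xi>_def)
qed

text \<open>
On e the prediction error is the coefficient difference minus the estimation error on f. Half
of its quadratic form survives via |Delta|^2 \<le> 2 |Delta - delta|^2 + 2 |delta|^2; all other
terms are of order eta.
\<close>

lemma T3_alternative_bound:
  assumes c: "0 < c" and wc: "well_conditioned c K x e" "well_conditioned c K x f" and e: "card e \<noteq> 0"
    and ye: "\<And>t. t \<in> e \<Longrightarrow> y t = restr S (x t) \<bullet> \<beta>e + \<epsilon>e t"
    and yf: "\<And>t. t \<in> f \<Longrightarrow> y t = restr S (x t) \<bullet> \<beta>f + \<epsilon>f t"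
    and \<beta>: "restr S \<beta>e = \<beta>e" "restr S \<beta>f = \<beta>f"
    and err: "errors_within \<eta> ve \<epsilon>e (\<lambda>t. restr S (x t)) e" "errors_within \<eta> vf \<epsilon>f (\<lambda>t. restr S (x t)) f"
    and \<eta>: "\<eta> \<le> 1" "(1 + 1 / c) * \<eta> < vf"
    and D: "norm (\<beta>e - \<beta>f) \<le> D"
    and gain: "0 \<le> ve - vf + c / 2 * (norm (\<beta>e - \<beta>f))\<^sup>2 - (2 + 2 * D + 3 / c) * \<eta>"
  shows "0 < s_hat_sq S x y f"
    "(ve - vf + c / 2 * (norm (\<beta>e - \<beta>f))\<^sup>2 - (2 + 2 * D + 3 / c) * \<eta>) / (vf + 1) \<le> T3 S e f x y"
proof -
  let ?\<delta> = "ols S x f \<epsilon>f" and ?Ze = "emp_mean e (\<lambda>t. \<epsilon>e t *\<^sub>R restr S (x t))"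
    and ?Zf = "emp_mean f (\<lambda>t. \<epsilon>f t *\<^sub>R restr S (x t))" and ?\<Delta> = "\<beta>e - \<beta>f"
  let ?N = "emp_mean e (\<lambda>t. (y t - restr S (x t) \<bullet> ols S x f y)\<^sup>2)" and ?s = "s_hat_sq S x y f"
  have A: "\<bar>emp_mean e (\<lambda>t. (\<epsilon>e t)\<^sup>2) - ve\<bar> \<le> \<eta>" "\<bar>emp_mean f (\<lambda>t. (\<epsilon>f t)\<^sup>2) - vf\<bar> \<le> \<eta>"
    and Z: "norm ?Ze \<le> \<eta>" "norm ?Zf \<le> \<eta>"
    using err by (simp_all add: errors_within_def)
  note reg = well_conditioned_regular[OF c wc(2)]
  note oe = ols_error[OF c wc(2), where S = S and \<epsilon> = \<epsilon>f]
  have \<eta>0: "0 \<le> \<eta>" using A(1) by linarith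
  have \<eta>2: "\<eta>\<^sup>2 \<le> \<eta>" using \<eta>0 \<eta>(1) by (simp add: power2_eq_square mult_left_le)
  have \<epsilon>f: "1 * (y t - restr S (x t) \<bullet> \<beta>f) = \<epsilon>f t" if "t \<in> f" for t using yf[OF that] by simp
  have "?\<delta> = ols S x f (\<lambda>t. 1 * (y t - restr S (x t) \<bullet> \<beta>f))"
    by (rule ols_cong) (simp only: \<epsilon>f)
  then have \<delta>: "ols S x f y = \<beta>f + ?\<delta>" by (simp only: ols_affine[OF reg]) (simp add: \<beta>)
  have "s_hat_sq S x \<epsilon>f f = s_hat_sq S x (\<lambda>t. 1 * (y t - restr S (x t) \<bullet> \<beta>f)) f"
    by (rule s_hat_sq_cong) (simp only: \<epsilon>f)
  then have s: "?s = s_hat_sq S x \<epsilon>f f" by (simp only: s_hat_sq_affine[OF reg]) simp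
  have r: "restr S (?\<Delta> - ?\<delta>) = ?\<Delta> - ?\<delta>"
    by (simp add: linear_diff[OF restr_linear] \<beta> ols_restr[OF reg])
  have "?N = emp_mean e (\<lambda>t. (\<epsilon>e t + restr S (x t) \<bullet> (?\<Delta> - ?\<delta>))\<^sup>2)"
    unfolding emp_mean_def by (auto simp: ye \<delta> algebra_simps intro!: sum.cong)
  also have "\<dots> = emp_mean e (\<lambda>t. (\<epsilon>e t)\<^sup>2) + 2 * (?Ze \<bullet> (?\<Delta> - ?\<delta>)) + emp_mean e (\<lambda>t. (x t \<bullet> (?\<Delta> - ?\<delta>))\<^sup>2)"
    by (simp add: emp_mean_quadratic emp_mean_restr[OF r])
  finally have N: "?N = \<dots>" .
  have d: "norm ?\<delta> \<le> \<eta> / c"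
    using oe(1) divide_right_mono[OF Z(2), of c] c by linarith
  have q: "c / 2 * (norm ?\<Delta>)\<^sup>2 - \<eta> / c \<le> emp_mean e (\<lambda>t. (x t \<bullet> (?\<Delta> - ?\<delta>))\<^sup>2)"
  proof -
    have "(norm ?\<Delta>)\<^sup>2 \<le> (norm (?\<Delta> - ?\<delta>) + norm ?\<delta>)\<^sup>2"
      using norm_triangle_ineq[of "?\<Delta> - ?\<delta>" ?\<delta>] by (intro power_mono) auto
    also have "\<dots> \<le> 2 * (norm (?\<Delta> - ?\<delta>))\<^sup>2 + 2 * (norm ?\<delta>)\<^sup>2"
      using sum_squares_bound[of "norm (?\<Delta> - ?\<delta>)" "norm ?\<delta>"] by (simp add: power2_sum)
    finally have 1: "(norm ?\<Delta>)\<^sup>2 / 2 - (norm ?\<delta>)\<^sup>2 \<le> (norm (?\<Delta> - ?\<delta>))\<^sup>2" by simp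
    have "(norm ?\<delta>)\<^sup>2 \<le> (\<eta> / c)\<^sup>2" using d by (intro power_mono) auto
    also have "\<dots> \<le> \<eta> / c\<^sup>2" using \<eta>2 by (simp add: power_divide divide_right_mono)
    finally have 2: "c * (norm ?\<delta>)\<^sup>2 \<le> \<eta> / c" using c by (simp add: field_simps power2_eq_square)
    have "c / 2 * (norm ?\<Delta>)\<^sup>2 - \<eta> / c \<le> c * ((norm ?\<Delta>)\<^sup>2 / 2 - (norm ?\<delta>)\<^sup>2)"
      using 2 by (simp add: right_diff_distrib)
    also have "\<dots> \<le> c * (norm (?\<Delta> - ?\<delta>))\<^sup>2" using 1 c by simp
    also have "\<dots> \<le> emp_mean e (\<lambda>t. (x t \<bullet> (?\<Delta> - ?\<delta>))\<^sup>2)" using wc(1) by (simp add: well_conditioned_def)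
    finally show ?thesis .
  qed
  have z: "\<bar>?Ze \<bullet> (?\<Delta> - ?\<delta>)\<bar> \<le> D * \<eta> + \<eta> / c"
  proof -
    have "\<bar>?Ze \<bullet> (?\<Delta> - ?\<delta>)\<bar> \<le> norm ?Ze * norm (?\<Delta> - ?\<delta>)" by (rule Cauchy_Schwarz_ineq2)
    also have "\<dots> \<le> \<eta> * (D + \<eta> / c)"
      using Z(1) d D \<eta>0 norm_triangle_ineq4[of ?\<Delta> ?\<delta>] by (intro mult_mono) auto
    also have "\<dots> \<le> D * \<eta> + \<eta> / c" using \<eta>2 c by (simp add: algebra_simps power2_eq_square divide_right_mono)
    finally show ?thesis .
  qed
  have "(norm ?Zf)\<^sup>2 \<le> \<eta>\<^sup>2" using Z(2) by (intro power_mono) auto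
  then have "(norm ?Zf)\<^sup>2 / c \<le> \<eta> / c" using \<eta>2 c by (intro divide_right_mono) auto
  then have slow: "vf - (1 + 1 / c) * \<eta> \<le> ?s" and sup: "?s \<le> vf + \<eta>"
    using oe(2,3) A(2) unfolding s by (auto simp: algebra_simps)
  then show pos: "0 < ?s" using \<eta>(2) by linarith
  have diff: "ve - vf + c / 2 * (norm ?\<Delta>)\<^sup>2 - (2 + 2 * D + 3 / c) * \<eta> \<le> ?N - ?s"
    using N q z sup A(1) by (simp add: algebra_simps)
  have "(ve - vf + c / 2 * (norm ?\<Delta>)\<^sup>2 - (2 + 2 * D + 3 / c) * \<eta>) / (vf + 1) \<le> (?N - ?s) / ?s"
    using diff gain pos sup \<eta>(1) by (intro frac_le) auto
  also have "\<dots> = T3 S e f x y" using pos e by (subst T3_emp_mean) auto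
  finally show "(ve - vf + c / 2 * (norm ?\<Delta>)\<^sup>2 - (2 + 2 * D + 3 / c) * \<eta>) / (vf + 1) \<le> T3 S e f x y" .
qed

section \<open>The limit of many resamples\<close>

text \<open>
An order statistic lies below u iff enough entries do; this turns the critical value into a
count of hits.
\<close>

lemma nth_sort_less_iff:
  fixes xs :: "'a::linorder list"
  assumes "1 \<le> m" "m \<le> length xs"
  shows "sort xs ! (m - 1) < u \<longleftrightarrow> m \<le> length (filter (\<lambda>z. z < u) xs)"
proof -
  let ?ys = "sort xs"
  have len: "length (filter (\<lambda>z. z < u) xs) = card {i. i < length ?ys \<and> ?ys ! i < u}"
  proof -
    have "length (filter (\<lambda>z. z < u) xs) = length (filter (\<lambda>z. z < u) ?ys)" by (simp add: filter_sort)
    also have "\<dots> = card {i. i < length ?ys \<and> ?ys ! i < u}" by (rule length_filter_conv_card)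
    finally show ?thesis .
  qed
  show ?thesis
  proof
    assume *: "?ys ! (m - 1) < u"
    have "{..<m} \<subseteq> {i. i < length ?ys \<and> ?ys ! i < u}"
    proof
      fix i assume "i \<in> {..<m}"
      then have "?ys ! i \<le> ?ys ! (m - 1)" "i < length ?ys"
        using assms by (auto intro!: sorted_nth_mono)
      with * show "i \<in> {i. i < length ?ys \<and> ?ys ! i < u}" by auto
    qed
    from card_mono[OF _ this] show "m \<le> length (filter (\<lambda>z. z < u) xs)" unfolding len by simp
  next
    assume *: "m \<le> length (filter (\<lambda>z. z < u) xs)"
    show "?ys ! (m - 1) < u"
    proof (rule ccontr)
      assume "\<not> ?ys ! (m - 1) < u"
      then have "{i. i < length ?ys \<and> ?ys ! i < u} \<subseteq> {..<m - 1}"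
        using sorted_nth_mono[OF sorted_sort, of "m - 1" _ xs] by (intro subsetI) (auto simp: not_less, meson leD leI order.strict_trans1)
      from card_mono[OF _ this] * show False unfolding len using assms by simp
    qed
  qed
qed

lemma resampling_test_iff:
  assumes "0 < \<alpha>" "\<alpha> < 1" "1 \<le> B"
  shows "resampling_test T n S \<alpha> B y x \<epsilon> = 1 \<longleftrightarrow>
    real B * (1 - \<alpha>) \<le> real (card {b\<in>{1..B}. \<bar>T x (scaled_resid n S x (\<epsilon> b))\<bar> < \<bar>T x (scaled_resid n S x y)\<bar>})"
proof -
  let ?m = "nat \<lceil>real B * (1 - \<alpha>)\<rceil>"
  let ?g = "\<lambda>b. \<bar>T x (scaled_resid n S x (\<epsilon> b))\<bar>" and ?u = "\<bar>T x (scaled_resid n S x y)\<bar>"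
  have m: "1 \<le> ?m" "?m \<le> B"
  proof -
    have "0 < real B * (1 - \<alpha>)" using assms by simp
    then show "1 \<le> ?m" by linarith
    have "real B * (1 - \<alpha>) \<le> real B" using assms by (simp add: mult_left_le)
    then show "?m \<le> B" by (simp add: nat_le_iff ceiling_le_iff)
  qed
  have "length (filter (\<lambda>z. z < ?u) (map ?g [1..<B + 1])) = length (filter (\<lambda>b. ?g b < ?u) [1..<B+1])"
    by (simp add: filter_map comp_def del: upt_Suc)
  also have "\<dots> = card (set (filter (\<lambda>b. ?g b < ?u) [1..<B+1]))"
    by (rule distinct_card[symmetric]) simp
  also have "set (filter (\<lambda>b. ?g b < ?u) [1..<B+1]) = {b\<in>{1..B}. ?g b < ?u}" by auto
  finally have len: "length (filter (\<lambda>z. z < ?u) (map ?g [1..<B + 1])) = card {b\<in>{1..B}. ?g b < ?u}" .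
  have "resampling_test T n S \<alpha> B y x \<epsilon> = 1 \<longleftrightarrow> critical_value T n S \<alpha> B x \<epsilon> < ?u"
    by (simp add: resampling_test_def)
  also have "\<dots> \<longleftrightarrow> ?m \<le> card {b\<in>{1..B}. ?g b < ?u}"
    unfolding critical_value_def
    by (subst nth_sort_less_iff[OF m(1)]) (use m(2) len in simp_all)
  also have "\<dots> \<longleftrightarrow> real B * (1 - \<alpha>) \<le> real (card {b\<in>{1..B}. ?g b < ?u})"
    by (simp add: nat_le_iff ceiling_le_iff)
  finally show ?thesis .
qed

lemma indep_vars_PiM_coordinates:
  assumes N: "\<And>i. i \<in> I \<Longrightarrow> prob_space (N i)" and "I \<noteq> {}"
  shows "prob_space.indep_vars (PiM I N) N (\<lambda>i \<omega>. \<omega> i) I"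
proof -
  interpret prob_space "PiM I N" by (rule prob_space_PiM) (fact N)
  have "distr (PiM I N) (PiM I N) (\<lambda>x. \<lambda>i\<in>I. x i) = distr (PiM I N) (PiM I N) (\<lambda>x. x)"
    by (rule distr_cong) (auto simp: space_PiM PiE_restrict)
  also have "\<dots> = (\<Pi>\<^sub>M i\<in>I. distr (PiM I N) (N i) (\<lambda>\<omega>. \<omega> i))"
    unfolding distr_id by (intro PiM_cong refl distr_PiM_component[symmetric] N)
  finally show ?thesis
    by (subst indep_vars_iff_distr_eq_PiM') (use \<open>I \<noteq> {}\<close> in auto)
qed

text \<open>
At p = q the limit is 1/2. Writing it as a value of the normal distribution function keeps it
in the form that the central limit theorem delivers.
\<close>

definition freq_limit :: "real \<Rightarrow> real \<Rightarrow> real" where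
  "freq_limit q p = (if q < p then 1 else if p < q then 0 else cdf std_normal_distribution 0)"

text \<open>
The number of hits among B independent draws exceeds B q with a probability that tends to 1 or
0 when p and q differ (Hoeffding's inequality). When they are equal, the centred count is
asymptotically normal, so the limit still exists.
\<close>

lemma hit_frequency_limit:
  fixes \<nu> :: "'a measure"
  assumes "prob_space \<nu>" and A: "A \<in> sets \<nu>" and q: "0 < q" "q < 1"
  shows "(\<lambda>B. measure (PiM {1..B} (\<lambda>_. \<nu>))
      {\<omega> \<in> space (PiM {1..B} (\<lambda>_. \<nu>)). real B * q \<le> real (card {b\<in>{1..B}. \<omega> b \<in> A})})
    \<longlonglongrightarrow> freq_limit q (measure \<nu> A)"
proof -
  interpret \<nu>: prob_space \<nu> by fact
  let ?\<Omega> = "PiM (UNIV :: nat set) (\<lambda>_. \<nu>)"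
  interpret product_prob_space "\<lambda>_::nat. \<nu>" UNIV by unfold_locales
  define p where "p = measure \<nu> A"
  \<comment> \<open>Centred misses rather than hits: the event then bounds the sum from above, as a distribution function does.\<close>
  define X :: "nat \<Rightarrow> (nat \<Rightarrow> 'a) \<Rightarrow> real" where "X i \<omega> = p - indicator A (\<omega> i)" for i \<omega>
  have A'[measurable]: "A \<in> sets \<nu>" by fact
  have Xm[measurable]: "X i \<in> borel_measurable ?\<Omega>" for i unfolding X_def[abs_def] by measurable
  have indep: "indep_vars (\<lambda>_. borel) X UNIV"
  proof -
    have "indep_vars (\<lambda>_. \<nu>) (\<lambda>i \<omega>. \<omega> i) (UNIV :: nat set)"
      by (rule indep_vars_PiM_coordinates) (auto intro: \<open>prob_space \<nu>\<close>)
    then have 1: "indep_vars (\<lambda>_. borel) (\<lambda>i \<omega>. p - indicator A (\<omega> i)) (UNIV :: nat set)"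
      by (rule indep_vars_compose2[where Y = "\<lambda>_ u. p - indicator A u"]) measurable
    then show ?thesis by (simp add: X_def[abs_def])
  qed
  have comp: "distr ?\<Omega> \<nu> (\<lambda>\<omega>. \<omega> i) = \<nu>" for i
    by (rule distr_PiM_component) (auto intro: \<open>prob_space \<nu>\<close>)
  have dX: "distr ?\<Omega> borel (X i) = distr \<nu> borel (\<lambda>u. p - indicator A u)" for i
  proof -
    have "distr \<nu> borel (\<lambda>u. p - indicator A u) = distr (distr ?\<Omega> \<nu> (\<lambda>\<omega>. \<omega> i)) borel (\<lambda>u. p - indicator A u)"
      by (simp only: comp)
    also have "\<dots> = distr ?\<Omega> borel (X i)"
      by (subst distr_distr) (auto simp: comp_def X_def[abs_def])
    finally show ?thesis by simp
  qed
  have dY: "distr ?\<Omega> borel (X i) = distr ?\<Omega> borel (X 0)" for i unfolding dX ..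
  have EXgen: "(\<integral>\<omega>. g (X i \<omega>) \<partial>?\<Omega>) = (\<integral>u. g (p - indicator A u) \<partial>\<nu>)"
    if [measurable]: "g \<in> borel_measurable borel" for g :: "real \<Rightarrow> real" and i
  proof -
    have "(\<integral>\<omega>. g (X i \<omega>) \<partial>?\<Omega>) = integral\<^sup>L (distr ?\<Omega> borel (X i)) g" by (simp add: integral_distr)
    also have "\<dots> = (\<integral>u. g (p - indicator A u) \<partial>\<nu>)" unfolding dX by (simp add: integral_distr)
    finally show ?thesis .
  qed
  have EX: "expectation (X i) = 0" for i
  proof -
    have "expectation (X i) = (\<integral>u. p - indicator A u \<partial>\<nu>)" using EXgen[of "\<lambda>u. u"] by simp
    also have "\<dots> = 0"
      by (subst Bochner_Integration.integral_diff) (auto simp: p_def \<nu>.prob_space \<nu>.emeasure_eq_measure)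
    finally show ?thesis .
  qed
  let ?S = "\<lambda>B \<omega>. \<Sum>i<B. X i \<omega>"
  \<comment> \<open>The resamples are numbered from 1, the limit theorems from 0.\<close>
  let ?rB = "\<lambda>B \<omega>. \<lambda>b\<in>{1..B::nat}. \<omega> (b - 1)"
  have eq: "measure (PiM {1..B} (\<lambda>_. \<nu>))
      {\<omega> \<in> space (PiM {1..B} (\<lambda>_. \<nu>)). real B * q \<le> real (card {b\<in>{1..B}. \<omega> b \<in> A})}
     = prob {\<omega> \<in> space ?\<Omega>. ?S B \<omega> \<le> real B * (p - q)}" (is "measure ?P ?E = _") for B
  proof -
    have card: "real (card {b\<in>{1..B}. \<omega> b \<in> A}) = (\<Sum>b\<in>{1..B}. indicator A (\<omega> b))" for \<omega> :: "nat \<Rightarrow> 'a"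
      by (simp add: indicator_def sum.If_cases Int_def)
    have E: "?E \<in> sets ?P" unfolding card by measurable
    have "measure ?P ?E = measure (distr ?\<Omega> ?P (?rB B)) ?E"
      by (subst distr_PiM_reindex[of UNIV "\<lambda>_. \<nu>" "\<lambda>b. b - 1" "{1..B}"])
        (auto simp: inj_on_def intro: \<open>prob_space \<nu>\<close>)
    also have "\<dots> = prob ((?rB B) -` ?E \<inter> space ?\<Omega>)"
      using E by (intro measure_distr) auto
    also have "(?rB B) -` ?E \<inter> space ?\<Omega> = {\<omega> \<in> space ?\<Omega>. ?S B \<omega> \<le> real B * (p - q)}"
    proof -
      have "real B * q \<le> real (card {b\<in>{1..B}. (?rB B) \<omega> b \<in> A}) \<longleftrightarrow> ?S B \<omega> \<le> real B * (p - q)" for \<omega>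
      proof -
        have "(\<Sum>b\<in>{1..B}. indicator A ((?rB B) \<omega> b) :: real) = (\<Sum>i<B. indicator A (\<omega> i))"
          by (rule sum.reindex_bij_witness[of _ Suc "\<lambda>b. b - 1"]) auto
        then show ?thesis unfolding card
          by (simp add: X_def sum_subtractf algebra_simps)
      qed
      then show ?thesis by (auto simp: space_PiM)
    qed
    finally show ?thesis .
  qed
  have "(\<lambda>B. prob {\<omega> \<in> space ?\<Omega>. ?S B \<omega> \<le> real B * (p - q)}) \<longlonglongrightarrow> freq_limit q p"
  proof (cases "p = q")
    case True
    define \<sigma> where "\<sigma> = sqrt (p * (1 - p))"
    have pq: "0 < p * (1 - p)" using True q by simp
    then have \<sigma>: "0 < \<sigma>" "\<sigma>\<^sup>2 = p * (1 - p)" by (simp_all add: \<sigma>_def)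
    have bd: "\<bar>X i \<omega>\<bar> \<le> 1" for i \<omega>
      using True q by (auto simp: X_def indicator_def)
    have sq: "integrable ?\<Omega> (\<lambda>\<omega>. (X i \<omega>)\<^sup>2)" for i
      using bd by (intro integrable_const_bound[of _ 1]) (auto simp: power_le_one abs_square_le_1)
    have var: "variance (X i) = \<sigma>\<^sup>2" for i
    proof -
      have "variance (X i) = expectation (\<lambda>\<omega>. (X i \<omega>)\<^sup>2)" by (simp add: EX)
      also have "\<dots> = (\<integral>u. (p - indicator A u)\<^sup>2 \<partial>\<nu>)" by (rule EXgen) measurable
      also have "\<dots> = (\<integral>u. p\<^sup>2 + (1 - 2 * p) * indicator A u \<partial>\<nu>)"
        by (intro Bochner_Integration.integral_cong) (auto simp: indicator_def power2_eq_square algebra_simps)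
      also have "\<dots> = p\<^sup>2 + (1 - 2 * p) * p"
        by (subst Bochner_Integration.integral_add) (auto simp: p_def \<nu>.prob_space \<nu>.emeasure_eq_measure)
      also have "\<dots> = \<sigma>\<^sup>2" unfolding \<sigma>(2) by (simp add: power2_eq_square algebra_simps)
      finally show ?thesis .
    qed
    have "weak_conv_m (\<lambda>n. distr ?\<Omega> borel (\<lambda>x. (\<Sum>i<n. X i x) / sqrt (real n * \<sigma>\<^sup>2))) std_normal_distribution"
      by (rule central_limit_theorem_zero_mean[OF indep EX \<sigma>(1) sq var dY])
    moreover have "isCont (cdf std_normal_distribution) 0"
    proof -
      interpret s: real_distribution std_normal_distribution by (rule real_dist_normal_dist)
      have "emeasure std_normal_distribution {0} = 0"
        by (subst emeasure_density) (auto intro!: nn_integral_null_set[of "{0}" lborel, simplified])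
      then show ?thesis by (simp add: s.isCont_cdf measure_def)
    qed
    ultimately have lim: "(\<lambda>n. cdf (distr ?\<Omega> borel (\<lambda>x. (\<Sum>i<n. X i x) / sqrt (real n * \<sigma>\<^sup>2))) 0)
        \<longlonglongrightarrow> cdf std_normal_distribution 0"
      by (simp add: weak_conv_m_def weak_conv_def)
    have "cdf (distr ?\<Omega> borel (\<lambda>x. (\<Sum>i<n. X i x) / sqrt (real n * \<sigma>\<^sup>2))) 0
        = prob {\<omega> \<in> space ?\<Omega>. ?S n \<omega> \<le> real n * (p - q)}" for n
    proof -
      have "(\<Sum>i<n. X i x) / sqrt (real n * \<sigma>\<^sup>2) \<le> 0 \<longleftrightarrow> (\<Sum>i<n. X i x) \<le> 0" for x
      proof (cases "n = 0")
        case False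
        then have "0 < sqrt (real n * \<sigma>\<^sup>2)" using \<sigma>(1) by simp
        then show ?thesis by (meson divide_le_0_iff less_le_not_le order.strict_implies_order)
      qed simp
      then have "(\<lambda>x. (\<Sum>i<n. X i x) / sqrt (real n * \<sigma>\<^sup>2)) -` {..0} \<inter> space ?\<Omega> =
         {\<omega> \<in> space ?\<Omega>. ?S n \<omega> \<le> real n * (p - q)}" using True by auto
      then show ?thesis by (simp add: cdf_def measure_distr)
    qed
    with lim show ?thesis by (simp add: freq_limit_def True)
  next
    case False
    have hoeff: "prob {\<omega> \<in> space ?\<Omega>. real B * \<bar>p - q\<bar> \<le> \<bar>?S B \<omega>\<bar>} \<le> 2 * exp (- 2 * real B * (p - q)\<^sup>2)"
      if "0 < B" for B
    proof -
      interpret H: Hoeffding_ineq_iid ?\<Omega> "{..<B}" X "X 0" "p - 1" p "expectation (X 0)"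
      proof unfold_locales
        show "indep_vars (\<lambda>_. borel) X {..<B}" by (rule indep_vars_subset[OF indep]) simp
        show "distr ?\<Omega> borel (X i) = distr ?\<Omega> borel (X 0)" for i by (rule dY)
        show "AE x in ?\<Omega>. X 0 x \<in> {p - 1..p}" by (auto simp: X_def indicator_def)
      qed simp_all
      have "{..<B} \<noteq> {}" using that by auto
      from H.Hoeffding_ineq_abs_ge[of "real B * \<bar>p - q\<bar>", OF _ _ this]
      moreover have "- 2 * (real B * \<bar>p - q\<bar>)\<^sup>2 / (real (card {..<B}) * (p - (p - 1))\<^sup>2) = - 2 * real B * (p - q)\<^sup>2"
      proof -
        have "(real B * \<bar>p - q\<bar>)\<^sup>2 = real B * (real B * (p - q)\<^sup>2)"
          by (simp only: power_mult_distrib power2_abs power2_eq_square[of "real B"] mult.assoc)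
        then show ?thesis using that by simp
      qed
      moreover have "0 \<le> real B * \<bar>p - q\<bar>" "p - 1 < p" by simp_all
      ultimately show ?thesis by (simp only: EX mult_zero_right add_0 diff_0_right)
    qed
    have small: "(\<lambda>B. 2 * exp (- 2 * real B * (p - q)\<^sup>2)) \<longlonglongrightarrow> 0"
    proof -
      have "filterlim (\<lambda>B. - (2 * (p - q)\<^sup>2) * real B) at_bot sequentially"
        using False by (intro filterlim_tendsto_neg_mult_at_bot[OF tendsto_const _ filterlim_real_sequentially]) simp
      then have "(\<lambda>B. exp (- (2 * (p - q)\<^sup>2) * real B)) \<longlonglongrightarrow> 0"
        by (rule filterlim_compose[OF exp_at_bot])
      from tendsto_mult_left[OF this, of 2] show ?thesis by (simp add: mult_ac)
    qed
    show ?thesis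
    proof (cases "p < q")
      case True
      have "(\<lambda>B. prob {\<omega> \<in> space ?\<Omega>. ?S B \<omega> \<le> real B * (p - q)}) \<longlonglongrightarrow> 0"
      proof (rule tendsto_sandwich[OF _ _ tendsto_const small])
        show "\<forall>\<^sub>F B in sequentially. prob {\<omega> \<in> space ?\<Omega>. ?S B \<omega> \<le> real B * (p - q)} \<le> 2 * exp (- 2 * real B * (p - q)\<^sup>2)"
          using eventually_gt_at_top[of 0]
        proof eventually_elim
          case (elim B)
          have "prob {\<omega> \<in> space ?\<Omega>. ?S B \<omega> \<le> real B * (p - q)} \<le> prob {\<omega> \<in> space ?\<Omega>. real B * \<bar>p - q\<bar> \<le> \<bar>?S B \<omega>\<bar>}"
            using True by (intro finite_measure_mono) (auto simp: abs_if algebra_simps)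
          with hoeff[OF elim] show ?case by linarith
        qed
      qed simp
      with True show ?thesis by (simp add: freq_limit_def)
    next
      case F: False
      then have pq: "q < p" using False by simp
      have "(\<lambda>B. prob {\<omega> \<in> space ?\<Omega>. ?S B \<omega> \<le> real B * (p - q)}) \<longlonglongrightarrow> 1"
      proof (rule tendsto_sandwich[OF _ _ _ tendsto_const])
        show "(\<lambda>B. 1 - 2 * exp (- 2 * real B * (p - q)\<^sup>2)) \<longlonglongrightarrow> 1"
          using tendsto_diff[OF tendsto_const[of 1] small] by simp
        show "\<forall>\<^sub>F B in sequentially. 1 - 2 * exp (- 2 * real B * (p - q)\<^sup>2) \<le> prob {\<omega> \<in> space ?\<Omega>. ?S B \<omega> \<le> real B * (p - q)}"
          using eventually_gt_at_top[of 0]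
        proof eventually_elim
          case (elim B)
          have "prob (space ?\<Omega> - {\<omega> \<in> space ?\<Omega>. ?S B \<omega> \<le> real B * (p - q)}) \<le> prob {\<omega> \<in> space ?\<Omega>. real B * \<bar>p - q\<bar> \<le> \<bar>?S B \<omega>\<bar>}"
            using pq by (intro finite_measure_mono) auto
          moreover have "prob (space ?\<Omega> - {\<omega> \<in> space ?\<Omega>. ?S B \<omega> \<le> real B * (p - q)}) = 1 - prob {\<omega> \<in> space ?\<Omega>. ?S B \<omega> \<le> real B * (p - q)}"
            by (rule prob_compl) measurable
          ultimately show ?case using hoeff[OF elim] by linarith
        qed
      qed simp
      with pq show ?thesis by (simp add: freq_limit_def)
    qed
  qed
  then show ?thesis unfolding eq p_def .
qed

lemma freq_limit_bounds: "0 \<le> freq_limit q p" "freq_limit q p \<le> 1"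
proof -
  interpret s: real_distribution std_normal_distribution by (rule real_dist_normal_dist)
  show "0 \<le> freq_limit q p" "freq_limit q p \<le> 1"
    by (auto simp: freq_limit_def cdf_def)
qed

definition std_normal_vector :: "nat \<Rightarrow> (nat \<Rightarrow> real) measure" where
  "std_normal_vector n = Pi\<^sub>M {1..n} (\<lambda>_. density lborel (\<lambda>u. ennreal (std_normal_density u)))"

lemma prob_space_std_normal_vector: "prob_space (std_normal_vector n)"
  unfolding std_normal_vector_def by (intro prob_space_PiM prob_space_normal_density) simp

lemma sets_std_normal_vector [measurable_cong]: "sets (std_normal_vector n) = sets (PiM {1..n} (\<lambda>_. borel))"
  unfolding std_normal_vector_def by (intro sets_PiM_cong) auto

text \<open>
Conditionally on the data the hits are independent, so the previous lemma gives a pointwise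
limit of the conditional rejection probability, and dominated convergence integrates it. The
pointwise limit is 1 on G.
\<close>

lemma rejection_prob_limit:
  fixes P :: "(nat \<Rightarrow> real \<times> (real ^ 'd::finite)) measure" and S :: "'d set"
  assumes law: "data_law n P" and \<alpha>: "0 < \<alpha>" "\<alpha> < 1"
    and null_meas: "(\<lambda>(w, e). T (\<lambda>t. snd (w t)) (scaled_resid n S (\<lambda>t. snd (w t)) e))
        \<in> borel_measurable (P \<Otimes>\<^sub>M std_normal_vector n)"
    and obs_meas: "(\<lambda>w. T (\<lambda>t. snd (w t)) (scaled_resid n S (\<lambda>t. snd (w t)) (\<lambda>t. fst (w t)))) \<in> borel_measurable P"
    and G: "G \<in> sets P"
    and power: "\<And>w. w \<in> G \<Longrightarrow> 1 - \<alpha> < measure (std_normal_vector n) {e \<in> space (std_normal_vector n).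
        \<bar>T (\<lambda>t. snd (w t)) (scaled_resid n S (\<lambda>t. snd (w t)) e)\<bar>
        < \<bar>T (\<lambda>t. snd (w t)) (scaled_resid n S (\<lambda>t. snd (w t)) (\<lambda>t. fst (w t)))\<bar>}"
  obtains p where "(\<lambda>B. rejection_prob T n S \<alpha> B P) \<longlonglongrightarrow> p" "measure P G \<le> p" "p \<le> 1"
proof -
  interpret P: prob_space P using law by (simp add: data_law_def)
  let ?\<nu> = "std_normal_vector n"
  interpret \<nu>: prob_space ?\<nu> by (rule prob_space_std_normal_vector)
  define N where "N w e = \<bar>T (\<lambda>t. snd (w t)) (scaled_resid n S (\<lambda>t. snd (w t)) e)\<bar>" for w :: "nat \<Rightarrow> real \<times> (real ^ 'd)" and e
  define Ob where "Ob w = \<bar>T (\<lambda>t. snd (w t)) (scaled_resid n S (\<lambda>t. snd (w t)) (\<lambda>t. fst (w t)))\<bar>" for w :: "nat \<Rightarrow> real \<times> (real ^ 'd)"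
  have N[measurable]: "(\<lambda>(w, e). N w e) \<in> borel_measurable (P \<Otimes>\<^sub>M ?\<nu>)"
    unfolding N_def using borel_measurable_abs[OF null_meas] by (simp add: case_prod_beta')
  have Ob[measurable]: "Ob \<in> borel_measurable P"
    unfolding Ob_def using borel_measurable_abs[OF obs_meas] .
  define A where "A w = {e \<in> space ?\<nu>. N w e < Ob w}" for w
  have A: "A w \<in> sets ?\<nu>" if "w \<in> space P" for w
  proof -
    have "(\<lambda>e. N w e) \<in> borel_measurable ?\<nu>"
      using measurable_compose[OF measurable_Pair1'[OF that] N] by simp
    then show ?thesis unfolding A_def by measurable
  qed
  define R where "R B w = measure (PiM {1..B} (\<lambda>_. ?\<nu>)) {\<omega> \<in> space (PiM {1..B} (\<lambda>_. ?\<nu>)).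
      real B * (1 - \<alpha>) \<le> real (card {b\<in>{1..B}. \<omega> b \<in> A w})}" for B w
  have R: "rejection_prob T n S \<alpha> B P = (\<integral>w. R B w \<partial>P)" "R B \<in> borel_measurable P" if "1 \<le> B" for B
  proof -
    let ?Q = "PiM {1..B} (\<lambda>_. ?\<nu>)"
    interpret Q: prob_space ?Q by (intro prob_space_PiM prob_space_std_normal_vector)
    interpret PQ: pair_prob_space P ?Q ..
    let ?E = "{z \<in> space (P \<Otimes>\<^sub>M ?Q). real B * (1 - \<alpha>) \<le> (\<Sum>b\<in>{1..B}. if N (fst z) (snd z b) < Ob (fst z) then 1 else 0)}"
    have Nb: "(\<lambda>z. N (fst z) (snd z b)) \<in> borel_measurable (P \<Otimes>\<^sub>M ?Q)" if "b \<in> {1..B}" for b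
    proof -
      have "(\<lambda>z. (fst z, snd z b)) \<in> measurable (P \<Otimes>\<^sub>M ?Q) (P \<Otimes>\<^sub>M ?\<nu>)"
        using that by measurable
      from measurable_compose[OF this N] show ?thesis by simp
    qed
    have E: "?E \<in> sets (P \<Otimes>\<^sub>M ?Q)"
      using Nb by measurable
    have card: "(\<Sum>b\<in>{1..B}. if N w (\<omega> b) < Ob w then 1 else 0 :: real) = real (card {b\<in>{1..B}. \<omega> b \<in> A w})"
      if "\<omega> \<in> space ?Q" for w \<omega>
    proof -
      have "{b\<in>{1..B}. \<omega> b \<in> A w} = {b\<in>{1..B}. N w (\<omega> b) < Ob w}"
        using that by (auto simp: A_def space_PiM PiE_def Pi_def)
      then show ?thesis by (simp add: sum.If_cases Int_def)
    qed
    have "{(w, \<epsilon>) \<in> space (P \<Otimes>\<^sub>M ?Q). resampling_test T n S \<alpha> B (\<lambda>t. fst (w t)) (\<lambda>t. snd (w t)) \<epsilon> = 1} = ?E"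
    proof -
      have "resampling_test T n S \<alpha> B (\<lambda>t. fst (w t)) (\<lambda>t. snd (w t)) \<epsilon> = 1
          \<longleftrightarrow> real B * (1 - \<alpha>) \<le> (\<Sum>b\<in>{1..B}. if N w (\<epsilon> b) < Ob w then 1 else 0)" for w \<epsilon>
        unfolding resampling_test_iff[OF \<alpha> that] N_def Ob_def by (simp add: sum.If_cases Int_def)
      then show ?thesis by auto
    qed
    then have "rejection_prob T n S \<alpha> B P = measure (P \<Otimes>\<^sub>M ?Q) ?E"
      by (simp add: rejection_prob_def resampling_law_def std_normal_vector_def)
    also have "\<dots> = (\<integral>z. indicator ?E z \<partial>(P \<Otimes>\<^sub>M ?Q))"
      using E by simp
    also have "\<dots> = (\<integral>w. \<integral>\<omega>. indicator ?E (w, \<omega>) \<partial>?Q \<partial>P)"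
      using E by (intro PQ.integral_fst'[symmetric] PQ.P.integrable_const_bound[of _ 1]) auto
    also have "\<dots> = (\<integral>w. R B w \<partial>P)"
    proof (intro Bochner_Integration.integral_cong refl)
      fix w assume w: "w \<in> space P"
      have "(\<integral>\<omega>. (indicator ?E (w, \<omega>) :: real) \<partial>?Q) = (\<integral>\<omega>. indicator {\<omega> \<in> space ?Q.
        real B * (1 - \<alpha>) \<le> real (card {b\<in>{1..B}. \<omega> b \<in> A w})} \<omega> \<partial>?Q)"
        by (intro Bochner_Integration.integral_cong refl) (auto simp: indicator_def card space_pair_measure w simp del: One_nat_def)
      also have "\<dots> = measure ?Q ({\<omega> \<in> space ?Q.
        real B * (1 - \<alpha>) \<le> real (card {b\<in>{1..B}. \<omega> b \<in> A w})} \<inter> space ?Q)"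
        by (rule Bochner_Integration.integral_indicator)
      also have "\<dots> = R B w"
        unfolding R_def by (rule arg_cong[where f = "measure ?Q"]) blast
      finally show "(\<integral>\<omega>. indicator ?E (w, \<omega>) \<partial>?Q :: real) = R B w" .
    qed
    finally show "rejection_prob T n S \<alpha> B P = (\<integral>w. R B w \<partial>P)" .
    have "(\<lambda>w. measure ?Q (Pair w -` ?E)) \<in> borel_measurable P"
      using Q.measurable_emeasure_Pair[OF E] by (simp add: measure_def)
    moreover have "measure ?Q (Pair w -` ?E) = R B w" if "w \<in> space P" for w
      unfolding R_def using that by (intro arg_cong[where f = "measure ?Q"]) (auto simp: space_pair_measure card simp del: One_nat_def)
    ultimately show "R B \<in> borel_measurable P" by (simp cong: measurable_cong)
  qed
  have lim: "(\<lambda>B. R B w) \<longlonglongrightarrow> freq_limit (1 - \<alpha>) (measure ?\<nu> (A w))" if "w \<in> space P" for w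
    unfolding R_def by (rule hit_frequency_limit[OF prob_space_std_normal_vector A[OF that]]) (use \<alpha> in auto)
  define g where "g w = freq_limit (1 - \<alpha>) (measure ?\<nu> (A w))" for w
  have gm: "g \<in> borel_measurable P"
    by (rule borel_measurable_LIMSEQ_real[of _ "\<lambda>B. R (Suc B)"])
      (use R(2) LIMSEQ_Suc[OF lim] in \<open>auto simp: g_def\<close>)
  have Rb: "0 \<le> R B w" "R B w \<le> 1" for B w
  proof -
    interpret Q: prob_space "PiM {1..B} (\<lambda>_. ?\<nu>)" by (intro prob_space_PiM prob_space_std_normal_vector)
    show "0 \<le> R B w" unfolding R_def by (rule measure_nonneg)
    show "R B w \<le> 1" unfolding R_def by (rule Q.prob_le_1)
  qed
  have gint: "integrable P g"
    using gm by (intro P.integrable_const_bound[of _ 1]) (auto simp: g_def freq_limit_bounds)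
  have "(\<lambda>B. \<integral>w. R (Suc B) w \<partial>P) \<longlonglongrightarrow> (\<integral>w. g w \<partial>P)"
    by (rule integral_dominated_convergence[where w = "\<lambda>_. 1"])
      (use gm R(2) LIMSEQ_Suc[OF lim] Rb in \<open>auto simp: g_def[symmetric]\<close>)
  then have "(\<lambda>B. rejection_prob T n S \<alpha> (Suc B) P) \<longlonglongrightarrow> (\<integral>w. g w \<partial>P)"
    by (simp add: R(1))
  then have 1: "(\<lambda>B. rejection_prob T n S \<alpha> B P) \<longlonglongrightarrow> (\<integral>w. g w \<partial>P)"
    by (rule LIMSEQ_imp_Suc)
  have 2: "(\<integral>w. g w \<partial>P) \<le> 1"
  proof -
    have "(\<integral>w. g w \<partial>P) \<le> (\<integral>w. 1 \<partial>P)"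
      by (rule integral_mono[OF gint]) (auto simp: g_def freq_limit_bounds)
    then show ?thesis by (simp add: P.prob_space)
  qed
  have gG: "indicator G w \<le> g w" for w
  proof (cases "w \<in> G")
    case True
    then have "g w = 1" using power[of w] by (simp add: g_def freq_limit_def A_def N_def Ob_def)
    then show ?thesis by (simp add: indicator_def)
  qed (simp add: g_def freq_limit_bounds)
  have 3: "measure P G \<le> (\<integral>w. g w \<partial>P)"
    using integral_mono[of P "indicator G" g] G gint gG by (simp add: P.emeasure_eq_measure)
  show ?thesis using that[OF 1 3 2] .
qed


section \<open>Measurability of the statistic\<close>

lemma borel_measurable_vec_iff:
  fixes f :: "'a \<Rightarrow> real ^ 'd::finite"
  shows "f \<in> borel_measurable M \<longleftrightarrow> (\<forall>i. (\<lambda>w. f w $ i) \<in> borel_measurable M)"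
proof
  assume "f \<in> borel_measurable M"
  then show "\<forall>i. (\<lambda>w. f w $ i) \<in> borel_measurable M"
    unfolding cart_eq_inner_axis by (intro allI borel_measurable_inner) auto
next
  assume "\<forall>i. (\<lambda>w. f w $ i) \<in> borel_measurable M"
  then show "f \<in> borel_measurable M"
    by (subst borel_measurable_euclidean_space) (auto simp: Basis_vec_def inner_axis)
qed

lemma borel_measurable_restr:
  fixes f :: "'a \<Rightarrow> real ^ 'd::finite"
  assumes "f \<in> borel_measurable M"
  shows "(\<lambda>w. restr S (f w)) \<in> borel_measurable M"
  unfolding borel_measurable_vec_iff
proof
  fix i show "(\<lambda>w. restr S (f w) $ i) \<in> borel_measurable M"
    using assms unfolding borel_measurable_vec_iff by (cases "i \<in> S") (simp_all add: restr_def)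
qed

lemma borel_measurable_det:
  fixes A :: "'a \<Rightarrow> real ^ 'd::finite ^ 'd"
  assumes "\<And>i j. (\<lambda>w. A w $ i $ j) \<in> borel_measurable M"
  shows "(\<lambda>w. det (A w)) \<in> borel_measurable M"
  unfolding det_def using assms by (intro borel_measurable_sum borel_measurable_times borel_measurable_prod) auto

text \<open>
Cramer's rule expresses the solution of a linear system by determinants, which are polynomials
in the entries.
\<close>

lemma borel_measurable_matrix_inv_mult:
  fixes A :: "'a \<Rightarrow> real ^ 'd::finite ^ 'd"
  assumes A: "\<And>i j. (\<lambda>w. A w $ i $ j) \<in> borel_measurable M" and v: "\<And>i. (\<lambda>w. v w $ i) \<in> borel_measurable M"
  shows "(\<lambda>w. if det (A w) = 0 then 0 else (matrix_inv (A w) *v v w) $ k) \<in> borel_measurable M"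
proof -
  have "(matrix_inv (A w) *v v w) $ k = det (\<chi> i j. if j = k then v w $ i else A w $ i $ j) / det (A w)"
    if "det (A w) \<noteq> 0" for w
  proof -
    have "A w *v (matrix_inv (A w) *v v w) = v w"
      using that matrix_inv_right_left(1)[of "A w"]
      by (simp add: invertible_det_nz matrix_vector_mul_assoc)
    then show ?thesis using cramer[OF that] by simp
  qed
  then have "(\<lambda>w. if det (A w) = 0 then 0 else (matrix_inv (A w) *v v w) $ k)
    = (\<lambda>w. if det (A w) = 0 then 0 else det (\<chi> i j. if j = k then v w $ i else A w $ i $ j) / det (A w))"
    by auto
  moreover have "(\<lambda>w. det (\<chi> i j. if j = k then v w $ i else A w $ i $ j)) \<in> borel_measurable M"
    using A v by (intro borel_measurable_det) simp
  moreover note borel_measurable_det[OF A]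
  ultimately show ?thesis by simp
qed

lemma borel_measurable_ols:
  fixes x :: "'a \<Rightarrow> nat \<Rightarrow> real ^ 'd::finite"
  assumes x: "\<And>t. t \<in> h \<Longrightarrow> (\<lambda>w. x w t) \<in> borel_measurable M"
    and y: "\<And>t. t \<in> h \<Longrightarrow> (\<lambda>w. y w t) \<in> borel_measurable M"
  shows "(\<lambda>w. ols S (x w) h (y w)) \<in> borel_measurable M"
proof -
  have z: "(\<lambda>w. restr S (x w t) $ i) \<in> borel_measurable M" if "t \<in> h" for t i
    using borel_measurable_restr[OF x[OF that]] unfolding borel_measurable_vec_iff by blast
  have g: "(\<lambda>w. gram S (x w) h $ i $ j) \<in> borel_measurable M" for i j
    unfolding gram_def using z by (simp add: borel_measurable_sum)
  let ?A = "\<lambda>w. gram S (x w) h + id_on (- S)"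
  have A: "(\<lambda>w. ?A w $ i $ j) \<in> borel_measurable M" for i j
    using g by simp
  let ?c = "\<lambda>w. \<Sum>t\<in>h. y w t *\<^sub>R restr S (x w t)"
  have c: "(\<lambda>w. ?c w $ i) \<in> borel_measurable M" for i
    using z y by (simp add: sum_component)
  let ?J = "(SOME B. False) :: real ^ 'd ^ 'd"
  have Dc: "id_on (- S) *v ?c w = 0" for w
  proof -
    have "restr (- S) (restr S v) = 0" for v :: "real ^ 'd" by (auto simp: restr_def vec_eq_iff)
    then show ?thesis
      by (simp add: id_on_mult_vector linear_sum[OF restr_linear] linear_cmul[OF restr_linear])
  qed
  have eq: "ols S (x w) h (y w) $ k = (if det (?A w) = 0 then (\<Sum>j\<in>UNIV. ?J $ k $ j * ?c w $ j) else 0)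
      + (if det (?A w) = 0 then 0 else (matrix_inv (?A w) *v ?c w) $ k)" for w k
  proof (cases "det (?A w) = 0")
    case True
    then have "inv_on S (gram S (x w) h) = ?J" using inv_on_gram(1)[of S "x w" h] by simp
    then show ?thesis using True by (simp add: ols_def matrix_vector_mult_def)
  next
    case False
    have "ols S (x w) h (y w) = (matrix_inv (?A w) - id_on (- S)) *v ?c w"
      using inv_on_gram(1)[of S "x w" h] False by (simp add: ols_def)
    then show ?thesis using False Dc by (simp add: matrix_vector_mult_diff_rdistrib)
  qed
  note [measurable] = borel_measurable_det[of ?A, OF A]
  have "(\<lambda>w. if det (?A w) = 0 then (\<Sum>j\<in>UNIV. ?J $ k $ j * ?c w $ j) else 0) \<in> borel_measurable M" for k
  proof (rule measurable_If)
    show "(\<lambda>w. \<Sum>j\<in>UNIV. ?J $ k $ j * ?c w $ j) \<in> borel_measurable M"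
      by (intro borel_measurable_sum borel_measurable_times borel_measurable_const c)
  qed measurable
  then show ?thesis
    unfolding borel_measurable_vec_iff eq
    by (intro allI borel_measurable_add borel_measurable_matrix_inv_mult A c)
qed

lemma borel_measurable_T3_max:
  fixes x :: "'a \<Rightarrow> nat \<Rightarrow> real ^ 'd::finite"
  assumes \<E>: "\<E> \<subseteq> Pow {1..n}"
    and x: "\<And>t. t \<in> {1..n} \<Longrightarrow> (\<lambda>w. x w t) \<in> borel_measurable M"
    and y: "\<And>t. t \<in> {1..n} \<Longrightarrow> (\<lambda>w. y w t) \<in> borel_measurable M"
  shows "(\<lambda>w. T3_max S \<E> (x w) (scaled_resid n S (x w) (y w))) \<in> borel_measurable M"
proof -
  have z: "(\<lambda>w. restr S (x w t)) \<in> borel_measurable M" if "t \<in> {1..n}" for t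
    by (rule borel_measurable_restr[OF x[OF that]])
  have r: "(\<lambda>w. resid n S (x w) (y w) t) \<in> borel_measurable M" if "t \<in> {1..n}" for t
    unfolding resid_def
    by (intro borel_measurable_diff borel_measurable_inner borel_measurable_ols x y z that)
  have R: "(\<lambda>w. scaled_resid n S (x w) (y w) t) \<in> borel_measurable M" if "t \<in> {1..n}" for t
    unfolding scaled_resid_def using r that
    by (intro borel_measurable_divide borel_measurable_sqrt borel_measurable_sum borel_measurable_power) auto
  define u where "u w = scaled_resid n S (x w) (y w)" for w
  have u: "(\<lambda>w. u w t) \<in> borel_measurable M" if "t \<in> {1..n}" for t unfolding u_def by (rule R[OF that])
  have Q: "(\<lambda>w. \<Sum>t\<in>e. (u w t - restr S (x w t) \<bullet> ols S (x w) f (u w))\<^sup>2) \<in> borel_measurable M"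
    if "e \<subseteq> {1..n}" "f \<subseteq> {1..n}" for e f
    using that by (intro borel_measurable_sum borel_measurable_power borel_measurable_diff
        borel_measurable_inner borel_measurable_ols x u z) auto
  have T: "(\<lambda>w. T3 S e f (x w) (u w)) \<in> borel_measurable M" if "e \<in> \<E>" "f \<in> \<E>" for e f
  proof -
    have "e \<subseteq> {1..n}" "f \<subseteq> {1..n}" using that \<E> by auto
    then show ?thesis unfolding T3_def s_hat_sq_def
      by (intro borel_measurable_diff borel_measurable_divide borel_measurable_times Q) auto
  qed
  have fin: "finite (F1 \<E>)"
  proof (rule finite_subset)
    show "F1 \<E> \<subseteq> Pow {1..n} \<times> Pow {1..n}" using \<E> by (auto simp: F1_def)
  qed simp
  have "(\<lambda>w. Max ((\<lambda>ef. (case ef of (e, f) \<Rightarrow> \<bar>T3 S e f (x w) (u w)\<bar>)) ` F1 \<E>)) \<in> borel_measurable M"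
    by (rule borel_measurable_Max[OF fin]) (use T in \<open>auto simp: F1_def\<close>)
  then show ?thesis by (simp add: T3_max_def u_def)
qed

section \<open>Exponential moments and moments of normal variables\<close>

lemma (in prob_space) chernoff_bound:
  fixes X :: "'i \<Rightarrow> 'a \<Rightarrow> real"
  assumes I: "finite I" "indep_vars (\<lambda>_. borel) X I"
    and mgf: "\<And>i. i \<in> I \<Longrightarrow> (\<integral>\<^sup>+\<omega>. ennreal (exp (X i \<omega>)) \<partial>M) \<le> ennreal (exp (c i))"
  shows "prob {\<omega>\<in>space M. s \<le> (\<Sum>i\<in>I. X i \<omega>)} \<le> exp ((\<Sum>i\<in>I. c i) - s)"
proof -
  have X: "X i \<in> borel_measurable M" if "i \<in> I" for i
    using I(2) that by (simp add: indep_vars_def)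
  have S: "(\<lambda>\<omega>. \<Sum>i\<in>I. X i \<omega>) \<in> borel_measurable M" using X by (rule borel_measurable_sum)
  have P: "(\<integral>\<^sup>+\<omega>. (\<Prod>i\<in>I. ennreal (exp (X i \<omega>))) \<partial>M) = (\<Prod>i\<in>I. \<integral>\<^sup>+\<omega>. ennreal (exp (X i \<omega>)) \<partial>M)"
    by (rule indep_vars_nn_integral[OF I(1)]) (auto intro!: indep_vars_compose2[OF I(2)])
  have "ennreal (prob {\<omega>\<in>space M. s \<le> (\<Sum>i\<in>I. X i \<omega>)})
      = (\<integral>\<^sup>+\<omega>. indicator {\<omega>\<in>space M. s \<le> (\<Sum>i\<in>I. X i \<omega>)} \<omega> \<partial>M)"
    using S by (subst nn_integral_indicator) (auto simp: emeasure_eq_measure)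
  also have "\<dots> \<le> (\<integral>\<^sup>+\<omega>. ennreal (exp (- s)) * (\<Prod>i\<in>I. ennreal (exp (X i \<omega>))) \<partial>M)"
    by (intro nn_integral_mono)
      (auto simp: indicator_def prod_ennreal exp_sum[OF I(1), symmetric] ennreal_mult[symmetric] exp_add[symmetric])
  also have "\<dots> = ennreal (exp (- s)) * (\<Prod>i\<in>I. \<integral>\<^sup>+\<omega>. ennreal (exp (X i \<omega>)) \<partial>M)"
    unfolding P[symmetric] using X by (subst nn_integral_cmult) auto
  also have "\<dots> \<le> ennreal (exp (- s)) * (\<Prod>i\<in>I. ennreal (exp (c i)))"
    by (intro mult_left_mono prod_mono_ennreal mgf) auto
  also have "\<dots> = ennreal (exp ((\<Sum>i\<in>I. c i) - s))"
    by (simp add: prod_ennreal exp_sum[OF I(1), symmetric] ennreal_mult[symmetric] exp_add[symmetric])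
  finally show ?thesis by simp
qed

lemma nn_integral_normal_density [simp]:
  "0 < s \<Longrightarrow> (\<integral>\<^sup>+u. ennreal (normal_density m s u) \<partial>lborel) = 1"
  using prob_space.emeasure_space_1[OF prob_space_normal_density[of s m]] by (simp add: emeasure_density)

text \<open>
Multiplying the standard normal density by exp (theta u^2) gives, up to a factor, the density
of a normal variable with variance 1 / (1 - 2 theta).
\<close>

lemma std_normal_mgf_square:
  assumes "\<theta> < 1 / 2"
  shows "(\<integral>\<^sup>+u. ennreal (exp (\<theta> * u\<^sup>2)) \<partial>std_normal_distribution) = ennreal (1 / sqrt (1 - 2 * \<theta>))"
proof -
  let ?a = "sqrt (1 - 2 * \<theta>)"
  have a: "0 < ?a" "?a\<^sup>2 = 1 - 2 * \<theta>" using assms by simp_all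
  have "std_normal_density u * exp (\<theta> * u\<^sup>2) = 1 / ?a * normal_density 0 (1 / ?a) u" for u
  proof -
    have "sqrt (2 * pi / ?a\<^sup>2) = sqrt (2 * pi) / ?a" using a(1) by (simp add: real_sqrt_divide)
    moreover have "- u\<^sup>2 / 2 + \<theta> * u\<^sup>2 = - u\<^sup>2 * ?a\<^sup>2 / 2" unfolding a(2) by (simp add: algebra_simps)
    ultimately show ?thesis using a
      by (simp add: normal_density_def power_divide exp_add[symmetric])
  qed
  then have "(\<integral>\<^sup>+u. ennreal (exp (\<theta> * u\<^sup>2)) \<partial>std_normal_distribution)
    = (\<integral>\<^sup>+u. ennreal (1 / ?a) * ennreal (normal_density 0 (1 / ?a) u) \<partial>lborel)"
    using a(1) by (subst nn_integral_density) (auto simp: ennreal_mult[symmetric])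
  also have "\<dots> = ennreal (1 / ?a)" using a(1) by (subst nn_integral_cmult) auto
  finally show ?thesis .
qed

lemma std_normal_mgf_square_le:
  assumes "\<bar>\<theta>\<bar> \<le> 1 / 4"
  shows "(\<integral>\<^sup>+u. ennreal (exp (\<theta> * u\<^sup>2)) \<partial>std_normal_distribution) \<le> ennreal (exp (\<theta> + 4 * \<theta>\<^sup>2))"
proof -
  have p: "0 < 1 - 2 * \<theta>" using assms by linarith
  have "\<bar>ln (1 + (- 2 * \<theta>)) - (- 2 * \<theta>)\<bar> \<le> 2 * (- 2 * \<theta>)\<^sup>2"
    using assms by (intro abs_ln_one_plus_x_minus_x_bound) auto
  then have "- ln (1 - 2 * \<theta>) / 2 \<le> \<theta> + 4 * \<theta>\<^sup>2" by (simp add: power_mult_distrib)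
  moreover have "1 / sqrt (1 - 2 * \<theta>) = exp (- ln (1 - 2 * \<theta>) / 2)"
    using p by (simp add: exp_minus inverse_eq_divide ln_sqrt[symmetric])
  ultimately have "1 / sqrt (1 - 2 * \<theta>) \<le> exp (\<theta> + 4 * \<theta>\<^sup>2)" by simp
  then show ?thesis
    using assms by (subst std_normal_mgf_square) (auto intro!: ennreal_leI)
qed

lemma std_normal_mgf_linear:
  "(\<integral>\<^sup>+u. ennreal (exp (a * u)) \<partial>std_normal_distribution) = ennreal (exp (a\<^sup>2 / 2))"
proof -
  have "std_normal_density u * exp (a * u) = exp (a\<^sup>2 / 2) * normal_density a 1 u" for u
  proof -
    have "- u\<^sup>2 / 2 + a * u = a\<^sup>2 / 2 + - (u - a)\<^sup>2 / 2" by (simp add: power2_eq_square field_simps)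
    then show ?thesis by (simp add: normal_density_def exp_add[symmetric])
  qed
  then have "(\<integral>\<^sup>+u. ennreal (exp (a * u)) \<partial>std_normal_distribution)
    = (\<integral>\<^sup>+u. ennreal (exp (a\<^sup>2 / 2)) * ennreal (normal_density a 1 u) \<partial>lborel)"
    by (subst nn_integral_density) (auto simp: ennreal_mult[symmetric])
  also have "\<dots> = ennreal (exp (a\<^sup>2 / 2))" by (subst nn_integral_cmult) auto
  finally show ?thesis .
qed

text \<open>
One formula for degenerate and nondegenerate normal laws, so that constant columns need no
separate treatment later on.
\<close>

lemma normal_law_eq_distr:
  assumes "0 \<le> s"
  shows "normal_law m s = distr std_normal_distribution borel (\<lambda>u. m + s * u)"
proof -
  interpret real_distribution std_normal_distribution by (rule real_dist_normal_dist)
  show ?thesis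
  proof (cases "s = 0")
    case True
    have "distr std_normal_distribution borel (\<lambda>u. m) = return borel m" by (rule distr_const) simp
    then show ?thesis using True by (simp add: normal_law_def)
  next
    case False
    have "distributed std_normal_distribution lborel (\<lambda>u. u) std_normal_density"
      by (auto simp: distributed_def distr_id2)
    from normal_density_affine[OF this, of s m] False assms
    have "distributed std_normal_distribution lborel (\<lambda>u. m + s * u) (normal_density m s)"
      by simp
    then have "distr std_normal_distribution lborel (\<lambda>u. m + s * u) = density lborel (normal_density m s)"
      by (rule distributed_distr_eq_density)
    moreover have "distr std_normal_distribution lborel (\<lambda>u. m + s * u) = distr std_normal_distribution borel (\<lambda>u. m + s * u)"
      by (rule distr_cong) auto
    ultimately show ?thesis using False by (simp add: normal_law_def)
  qed
qed

lemma std_normal_moments: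
  "(\<integral>u. u \<partial>std_normal_distribution) = 0" "(\<integral>u. u\<^sup>2 \<partial>std_normal_distribution) = 1"
  "(\<integral>u. u ^ 3 \<partial>std_normal_distribution) = 0" "(\<integral>u. u ^ 4 \<partial>std_normal_distribution) = 3"
  using integral_std_normal_distribution_moment_odd[of 1]
    std_normal_distribution_even_moments[of 1] std_normal_distribution_even_moments[of 2]
    integral_std_normal_distribution_moment_odd[of 3, simplified]
  by (simp_all add: fact_numeral)

locale normal_variable = prob_space +
  fixes Z :: "'a \<Rightarrow> real" and m s :: real
  assumes Z [measurable]: "Z \<in> borel_measurable M" and s: "0 \<le> s" and law: "distr M borel Z = normal_law m s"
begin

lemma nn_integral_Z:
  assumes [measurable]: "g \<in> borel_measurable borel"
  shows "(\<integral>\<^sup>+\<omega>. g (Z \<omega>) \<partial>M) = (\<integral>\<^sup>+u. g (m + s * u) \<partial>std_normal_distribution)"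
proof -
  have "(\<integral>\<^sup>+\<omega>. g (Z \<omega>) \<partial>M) = integral\<^sup>N (distr M borel Z) g" by (simp add: nn_integral_distr)
  also have "\<dots> = (\<integral>\<^sup>+u. g (m + s * u) \<partial>std_normal_distribution)"
    unfolding law normal_law_eq_distr[OF s] by (simp add: nn_integral_distr)
  finally show ?thesis .
qed

lemma integral_Z:
  fixes g :: "real \<Rightarrow> real"
  assumes [measurable]: "g \<in> borel_measurable borel"
  shows "(\<integral>\<omega>. g (Z \<omega>) \<partial>M) = (\<integral>u. g (m + s * u) \<partial>std_normal_distribution)"
    and "integrable M (\<lambda>\<omega>. g (Z \<omega>)) \<longleftrightarrow> integrable std_normal_distribution (\<lambda>u. g (m + s * u))"
proof -
  have "(\<integral>\<omega>. g (Z \<omega>) \<partial>M) = integral\<^sup>L (distr M borel Z) g" by (simp add: integral_distr)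
  also have "\<dots> = (\<integral>u. g (m + s * u) \<partial>std_normal_distribution)"
    unfolding law normal_law_eq_distr[OF s] by (simp add: integral_distr)
  finally show "(\<integral>\<omega>. g (Z \<omega>) \<partial>M) = (\<integral>u. g (m + s * u) \<partial>std_normal_distribution)" .
  have "integrable M (\<lambda>\<omega>. g (Z \<omega>)) \<longleftrightarrow> integrable (distr M borel Z) g" by (simp add: integrable_distr_eq)
  also have "\<dots> \<longleftrightarrow> integrable std_normal_distribution (\<lambda>u. g (m + s * u))"
    unfolding law normal_law_eq_distr[OF s] by (simp add: integrable_distr_eq)
  finally show "integrable M (\<lambda>\<omega>. g (Z \<omega>)) \<longleftrightarrow> integrable std_normal_distribution (\<lambda>u. g (m + s * u))" .
qed

lemma power_integrable: "integrable M (\<lambda>\<omega>. Z \<omega> ^ j)"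
  unfolding integral_Z(2)[of "\<lambda>z. z ^ j", simplified] binomial_ring
  by (intro Bochner_Integration.integrable_sum)
     (auto simp: power_mult_distrib intro!: integrable_mult_right integrable_std_normal_distribution_moment)

lemma first_moment: "(\<integral>\<omega>. Z \<omega> \<partial>M) = m"
proof -
  interpret N: real_distribution std_normal_distribution by (rule real_dist_normal_dist)
  have "(\<integral>\<omega>. Z \<omega> \<partial>M) = (\<integral>u. m + s * u ^ 1 \<partial>std_normal_distribution)"
    using integral_Z(1)[of "\<lambda>z. z"] by simp
  also have "\<dots> = m + s * (\<integral>u. u ^ 1 \<partial>std_normal_distribution)"
    using integrable_std_normal_distribution_moment[of 1] N.prob_space by (subst Bochner_Integration.integral_add) auto
  finally show ?thesis by (simp add: std_normal_moments)
qed

lemma second_moment: "(\<integral>\<omega>. (Z \<omega>)\<^sup>2 \<partial>M) = m\<^sup>2 + s\<^sup>2"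
proof -
  interpret N: real_distribution std_normal_distribution by (rule real_dist_normal_dist)
  have "(\<integral>\<omega>. (Z \<omega>)\<^sup>2 \<partial>M) = (\<integral>u. (m\<^sup>2 + 2 * m * s * u) + s\<^sup>2 * u\<^sup>2 \<partial>std_normal_distribution)"
    unfolding integral_Z(1)[of "\<lambda>z. z\<^sup>2", simplified] by (simp add: power2_sum power_mult_distrib algebra_simps)
  also have "\<dots> = m\<^sup>2 + s\<^sup>2"
    using integrable_std_normal_distribution_moment[of 1] integrable_std_normal_distribution_moment[of 2] N.prob_space
    by (simp add: std_normal_moments)
  finally show ?thesis .
qed

lemma fourth_moment_le: "(\<integral>\<omega>. (Z \<omega>) ^ 4 \<partial>M) \<le> 3 * (m\<^sup>2 + s\<^sup>2)\<^sup>2"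
proof -
  interpret N: real_distribution std_normal_distribution by (rule real_dist_normal_dist)
  have "(\<integral>\<omega>. (Z \<omega>) ^ 4 \<partial>M)
    = (\<integral>u. m ^ 4 + (4 * m ^ 3 * s) * u + (6 * m\<^sup>2 * s\<^sup>2) * u\<^sup>2 + (4 * m * s ^ 3) * u ^ 3 + s ^ 4 * u ^ 4 \<partial>std_normal_distribution)"
    unfolding integral_Z(1)[of "\<lambda>z. z ^ 4", simplified]
    by (rule arg_cong[where f = "integral\<^sup>L std_normal_distribution"]) (auto simp: algebra_simps power2_eq_square power3_eq_cube power4_eq_xxxx)
  also have "\<dots> = m ^ 4 + (6 * m\<^sup>2 * s\<^sup>2) + 3 * s ^ 4"
    using integrable_std_normal_distribution_moment[of 1] integrable_std_normal_distribution_moment[of 2]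
      integrable_std_normal_distribution_moment[of 3] integrable_std_normal_distribution_moment[of 4] N.prob_space
    by (simp add: std_normal_moments)
  also have "\<dots> \<le> 3 * (m\<^sup>2 + s\<^sup>2)\<^sup>2"
  proof -
    have "3 * (m\<^sup>2 + s\<^sup>2)\<^sup>2 = 3 * m ^ 4 + 6 * m\<^sup>2 * s\<^sup>2 + 3 * s ^ 4"
      by (simp add: power2_eq_square power4_eq_xxxx algebra_simps)
    moreover have "0 \<le> m ^ 4" by simp
    ultimately show ?thesis by simp
  qed
  finally show ?thesis .
qed

text \<open>
Reverse Jensen inequality of Gaussian variables: high moments are controlled by the second
moment alone, with a constant that depends on neither m nor s.
\<close>

lemma even_moment_le:
  "(\<integral>\<omega>. Z \<omega> ^ (4 * k) \<partial>M) \<le> 2 ^ (4 * k) * (1 + (\<integral>u. u ^ (4 * k) \<partial>std_normal_distribution)) * (m\<^sup>2 + s\<^sup>2) ^ (2 * k)"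
proof -
  interpret N: real_distribution std_normal_distribution by (rule real_dist_normal_dist)
  let ?q = "m\<^sup>2 + s\<^sup>2" and ?G = "\<integral>u. u ^ (4 * k) \<partial>std_normal_distribution"
  have p4: "z ^ (4 * k) = (z\<^sup>2) ^ (2 * k)" for z :: real by (simp add: power_mult[symmetric])
  have pw: "(m + s * u) ^ (4 * k) \<le> 2 ^ (4 * k) * (?q ^ (2 * k) + ?q ^ (2 * k) * u ^ (4 * k))" for u
  proof -
    have e: "even (4 * k)" by simp
    have "(m + s * u) ^ (4 * k) = \<bar>m + s * u\<bar> ^ (4 * k)" using e by (simp add: power_even_abs)
    also have "\<dots> \<le> (2 * max \<bar>m\<bar> \<bar>s * u\<bar>) ^ (4 * k)"
      by (intro power_mono) linarith+
    also have "\<dots> = 2 ^ (4 * k) * (max \<bar>m\<bar> \<bar>s * u\<bar>) ^ (4 * k)" by (simp add: power_mult_distrib)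
    also have "(max \<bar>m\<bar> \<bar>s * u\<bar>) ^ (4 * k) \<le> \<bar>m\<bar> ^ (4 * k) + \<bar>s * u\<bar> ^ (4 * k)"
      by (simp add: max_def)
    also have "\<dots> = (m\<^sup>2) ^ (2 * k) + (s\<^sup>2) ^ (2 * k) * u ^ (4 * k)"
      by (simp add: power_even_abs power_mult_distrib p4[symmetric])
    also have "\<dots> \<le> ?q ^ (2 * k) + ?q ^ (2 * k) * u ^ (4 * k)"
      by (intro add_mono mult_right_mono power_mono) (auto simp: zero_le_even_power)
    finally show ?thesis by simp
  qed
  have "(\<integral>\<omega>. Z \<omega> ^ (4 * k) \<partial>M) = (\<integral>u. (m + s * u) ^ (4 * k) \<partial>std_normal_distribution)"
    by (rule integral_Z(1)) measurable
  also have "\<dots> \<le> (\<integral>u. 2 ^ (4 * k) * (?q ^ (2 * k) + ?q ^ (2 * k) * u ^ (4 * k)) \<partial>std_normal_distribution)"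
    using integral_Z(2)[of "\<lambda>z. z ^ (4 * k)"] power_integrable[of "4 * k"] integrable_std_normal_distribution_moment[of "4 * k"]
      integrable_std_normal_distribution_moment[of 0] pw
    by (intro integral_mono) auto
  also have "\<dots> = 2 ^ (4 * k) * (?q ^ (2 * k) + ?q ^ (2 * k) * ?G)"
    using integrable_std_normal_distribution_moment[of "4 * k"] N.prob_space by simp
  finally show ?thesis by (simp add: algebra_simps)
qed

lemma exp_square_le:
  assumes "m\<^sup>2 + s\<^sup>2 \<le> q" "0 < q"
  shows "(\<integral>\<^sup>+\<omega>. ennreal (exp ((Z \<omega>)\<^sup>2 / (8 * q))) \<partial>M) \<le> ennreal (exp 1)"
proof -
  let ?\<theta> = "s\<^sup>2 / (4 * q)"
  have "s\<^sup>2 \<le> q" "m\<^sup>2 \<le> q" using assms(1) zero_le_power2[of m] zero_le_power2[of s] by linarith+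
  then have \<theta>: "\<bar>?\<theta>\<bar> \<le> 1 / 4" and mq: "m\<^sup>2 / (4 * q) \<le> 1 / 4" using assms(2) by (auto simp: field_simps)
  have "(m + s * u)\<^sup>2 / (8 * q) \<le> m\<^sup>2 / (4 * q) + ?\<theta> * u\<^sup>2" for u
  proof -
    have "(m + s * u)\<^sup>2 \<le> 2 * m\<^sup>2 + 2 * (s\<^sup>2 * u\<^sup>2)"
      using zero_le_power2[of "m - s * u"] by (simp add: power2_sum power2_diff power_mult_distrib)
    then have "(m + s * u)\<^sup>2 / (8 * q) \<le> (2 * m\<^sup>2 + 2 * (s\<^sup>2 * u\<^sup>2)) / (8 * q)"
      using assms(2) by (intro divide_right_mono) auto
    then show ?thesis using assms(2) by (simp add: field_simps)
  qed
  then have "exp ((m + s * u)\<^sup>2 / (8 * q)) \<le> exp (m\<^sup>2 / (4 * q)) * exp (?\<theta> * u\<^sup>2)" for u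
    by (simp add: exp_add[symmetric])
  then have "(\<integral>\<^sup>+\<omega>. ennreal (exp ((Z \<omega>)\<^sup>2 / (8 * q))) \<partial>M)
     \<le> (\<integral>\<^sup>+u. ennreal (exp (m\<^sup>2 / (4 * q))) * ennreal (exp (?\<theta> * u\<^sup>2)) \<partial>std_normal_distribution)"
    by (subst nn_integral_Z) (auto intro!: nn_integral_mono simp: ennreal_mult[symmetric] ennreal_leI simp del: ennreal_le_iff)
  also have "\<dots> = ennreal (exp (m\<^sup>2 / (4 * q))) * (\<integral>\<^sup>+u. ennreal (exp (?\<theta> * u\<^sup>2)) \<partial>std_normal_distribution)"
    by (rule nn_integral_cmult) measurable
  also have "\<dots> \<le> ennreal (exp (m\<^sup>2 / (4 * q))) * ennreal (exp (?\<theta> + 4 * ?\<theta>\<^sup>2))"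
    by (intro mult_left_mono std_normal_mgf_square_le \<theta>) auto
  also have "\<dots> = ennreal (exp (m\<^sup>2 / (4 * q) + (?\<theta> + 4 * ?\<theta>\<^sup>2)))"
    by (simp add: ennreal_mult[symmetric] exp_add)
  also have "\<dots> \<le> ennreal (exp 1)"
  proof -
    have "?\<theta>\<^sup>2 \<le> (1 / 4)\<^sup>2" using \<theta> by (intro power2_le_iff_abs_le[THEN iffD2]) auto
    then have "4 * ?\<theta>\<^sup>2 \<le> 1 / 4" by (simp only: power_divide) simp
    then have "m\<^sup>2 / (4 * q) + (?\<theta> + 4 * ?\<theta>\<^sup>2) \<le> 1" using mq \<theta> by linarith
    then show ?thesis by (intro ennreal_leI) simp
  qed
  finally show ?thesis .
qed

text \<open>
For y \<ge> 0, exp (- y) \<le> 1 - y + y^2 / 2. With y = Z^2 / (3 q) the first term gains 1/3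
and, as the fourth moment is at most 3 q^2, the second one loses at most 1/6.
\<close>

lemma exp_neg_square_le:
  assumes q: "m\<^sup>2 + s\<^sup>2 = q" "0 < q"
  shows "(\<integral>\<^sup>+\<omega>. ennreal (exp (- ((Z \<omega>)\<^sup>2 / (3 * q)))) \<partial>M) \<le> ennreal (exp (- 1 / 6))"
proof -
  have e: "exp (- y) \<le> 1 - y + y\<^sup>2 / 2" if "0 \<le> y" for y :: real
  proof -
    have "exp y * (1 - y + y\<^sup>2 / 2) \<ge> 1"
    proof -
      have "1 + y + y\<^sup>2 / 2 \<le> exp y" using exp_lower_Taylor_quadratic[OF that] by simp
      moreover have "0 \<le> 1 - y + y\<^sup>2 / 2"
        using zero_le_power2[of "y - 1"] by (simp add: power2_diff field_simps)
      ultimately have "(1 + y + y\<^sup>2 / 2) * (1 - y + y\<^sup>2 / 2) \<le> exp y * (1 - y + y\<^sup>2 / 2)"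
        by (rule mult_right_mono)
      moreover have "(1 + y + y\<^sup>2 / 2) * (1 - y + y\<^sup>2 / 2) = 1 + (y\<^sup>2)\<^sup>2 / 4"
        by (simp add: power2_eq_square field_simps)
      ultimately show ?thesis using zero_le_power2[of "y\<^sup>2"] by linarith
    qed
    then show ?thesis by (simp add: exp_minus field_simps)
  qed
  have i2: "integrable M (\<lambda>\<omega>. (Z \<omega>)\<^sup>2)" and i4: "integrable M (\<lambda>\<omega>. (Z \<omega>) ^ 4)"
    by (rule power_integrable)+
  have int: "integrable M (\<lambda>\<omega>. exp (- ((Z \<omega>)\<^sup>2 / (3 * q))))"
    using q(2) by (intro integrable_const_bound[of _ 1]) auto
  have "expectation (\<lambda>\<omega>. exp (- ((Z \<omega>)\<^sup>2 / (3 * q))))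
      \<le> expectation (\<lambda>\<omega>. 1 - (1 / (3 * q)) * (Z \<omega>)\<^sup>2 + (1 / (18 * q\<^sup>2)) * (Z \<omega>) ^ 4)"
  proof (rule integral_mono[OF int])
    show "integrable M (\<lambda>\<omega>. 1 - (1 / (3 * q)) * (Z \<omega>)\<^sup>2 + (1 / (18 * q\<^sup>2)) * (Z \<omega>) ^ 4)"
      using i2 i4 by simp
    fix \<omega>
    have "exp (- ((Z \<omega>)\<^sup>2 / (3 * q))) \<le> 1 - (Z \<omega>)\<^sup>2 / (3 * q) + ((Z \<omega>)\<^sup>2 / (3 * q))\<^sup>2 / 2"
      using q(2) by (intro e) auto
    also have "((Z \<omega>)\<^sup>2 / (3 * q))\<^sup>2 / 2 = (1 / (18 * q\<^sup>2)) * (Z \<omega>) ^ 4"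
      by (simp add: power_divide power_mult_distrib power_mult[symmetric])
    finally show "exp (- ((Z \<omega>)\<^sup>2 / (3 * q))) \<le> 1 - (1 / (3 * q)) * (Z \<omega>)\<^sup>2 + (1 / (18 * q\<^sup>2)) * (Z \<omega>) ^ 4" by simp
  qed
  also have "\<dots> = 1 - (1 / (3 * q)) * q + (1 / (18 * q\<^sup>2)) * expectation (\<lambda>\<omega>. (Z \<omega>) ^ 4)"
    using i2 i4 second_moment q(1) by (simp add: prob_space)
  also have "\<dots> \<le> 1 - (1 / (3 * q)) * q + (1 / (18 * q\<^sup>2)) * (3 * q\<^sup>2)"
    using fourth_moment_le q by (intro add_mono mult_left_mono) auto
  also have "\<dots> = 1 + (- 1 / 6)" using q(2) by (simp add: field_simps)
  also have "\<dots> \<le> exp (- 1 / 6)" by (rule exp_ge_add_one_self)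
  finally have "expectation (\<lambda>\<omega>. exp (- ((Z \<omega>)\<^sup>2 / (3 * q)))) \<le> exp (- 1 / 6)" .
  then show ?thesis
    by (subst nn_integral_eq_integral[OF int]) (auto intro!: ennreal_leI)
qed

end

section \<open>Extreme eigenvalues and second moments of the design\<close>

lemma symmetric_matrix_inner:
  fixes A :: "real ^ 'd::finite ^ 'd"
  assumes "transpose A = A"
  shows "u \<bullet> (A *v v) = (A *v u) \<bullet> v"
  by (metis assms dot_lmul_matrix vector_transpose_matrix)

text \<open>
Eigenvectors of a symmetric matrix for different eigenvalues are orthogonal, hence independent.
\<close>

lemma finite_eigenvalues:
  fixes A :: "real ^ 'd::finite ^ 'd"
  assumes A: "transpose A = A"
  shows "finite (eigenvalues A)"
proof -
  have "\<forall>l\<in>eigenvalues A. \<exists>v. v \<noteq> 0 \<and> A *v v = l *\<^sub>R v" by (auto simp: eigenvalues_def)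
  then obtain v where v: "\<And>l. l \<in> eigenvalues A \<Longrightarrow> v l \<noteq> 0 \<and> A *v v l = l *\<^sub>R v l" by metis
  have inj: "inj_on v (eigenvalues A)"
  proof (rule inj_onI)
    fix l l' assume "l \<in> eigenvalues A" "l' \<in> eigenvalues A" "v l = v l'"
    with v[of l] v[of l'] show "l = l'" by (metis scaleR_right_imp_eq)
  qed
  have "pairwise orthogonal (v ` eigenvalues A)"
  proof (rule pairwise_imageI)
    fix l l' assume l: "l \<in> eigenvalues A" "l' \<in> eigenvalues A" "l \<noteq> l'"
    have "l' * (v l \<bullet> v l') = v l \<bullet> (A *v v l')" using v[OF l(2)] by simp
    also have "\<dots> = l * (v l \<bullet> v l')" using v[OF l(1)] symmetric_matrix_inner[OF A] by simp
    finally show "orthogonal (v l) (v l')" using l(3) by (simp add: orthogonal_def)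
  qed
  moreover have "0 \<notin> v ` eigenvalues A" using v by force
  ultimately have "finite (v ` eigenvalues A)"
    using pairwise_orthogonal_independent independent_imp_finite by blast
  then show ?thesis using inj by (rule finite_imageD)
qed

text \<open>
The minimiser u of the quadratic form on the unit sphere is an eigenvector: if r = A u - l u
were not 0, a small step from u against r would bring the form below l times the squared norm.
\<close>

lemma rayleigh_minimum:
  fixes A :: "real ^ 'd::finite ^ 'd"
  assumes A: "transpose A = A"
  obtains l where "l \<in> eigenvalues A" "\<And>v. l * (norm v)\<^sup>2 \<le> v \<bullet> (A *v v)"
proof -
  let ?q = "\<lambda>v :: real ^ 'd. v \<bullet> (A *v v)"
  have "continuous_on (sphere 0 1) ?q"
    by (intro continuous_intros linear_continuous_on matrix_vector_mul_bounded_linear)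
  moreover have "sphere (0 :: real ^ 'd) 1 \<noteq> {}"
    using norm_axis_1 by (metis dist_0_norm empty_iff mem_sphere)
  ultimately obtain u where u: "norm u = 1" and min: "\<And>v. norm v = 1 \<Longrightarrow> ?q u \<le> ?q v"
    using continuous_attains_inf[OF compact_sphere, of 0 1 ?q] by (auto simp: mem_sphere)
  define l where "l = ?q u"
  have ge: "l * (norm v)\<^sup>2 \<le> ?q v" for v
  proof (cases "v = 0")
    case False
    have "l \<le> ?q ((1 / norm v) *\<^sub>R v)" unfolding l_def by (rule min) (use False in simp)
    also have "\<dots> = ?q v / (norm v)\<^sup>2"
      by (simp add: matrix_vector_mult_scaleR power2_eq_square)
    finally show ?thesis using False by (simp add: field_simps)
  qed simp
  define r where "r = A *v u - l *\<^sub>R u"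
  define g where "g v = ?q v - l * (norm v)\<^sup>2" for v
  have g0: "0 \<le> g v" for v using ge[of v] by (simp add: g_def)
  have exp: "g (u + t *\<^sub>R r) = 2 * t * (norm r)\<^sup>2 + t\<^sup>2 * g r" for t
  proof -
    have e1: "?q (u + t *\<^sub>R r) = ?q u + 2 * t * (r \<bullet> (A *v u)) + t\<^sup>2 * ?q r"
      using symmetric_matrix_inner[OF A, of u r]
      by (simp add: matrix_vector_right_distrib matrix_vector_mult_scaleR inner_add_left inner_add_right power2_eq_square
          inner_commute algebra_simps)
    have e2: "(norm (u + t *\<^sub>R r))\<^sup>2 = 1 + 2 * t * (r \<bullet> u) + t\<^sup>2 * (norm r)\<^sup>2"
      unfolding power2_norm_eq_inner using u
      by (simp add: inner_add_left inner_add_right inner_commute[of u r] power2_eq_square norm_eq_1 algebra_simps)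
    have e3: "(norm r)\<^sup>2 = r \<bullet> (A *v u) - l * (r \<bullet> u)"
      by (simp add: power2_norm_eq_inner r_def inner_diff_right)
    show ?thesis unfolding g_def e1 e2 l_def[symmetric] by (simp add: e3 algebra_simps)
  qed
  have "r = 0"
  proof (rule ccontr)
    assume "r \<noteq> 0"
    define t where "t = - ((norm r)\<^sup>2 / (g r + 1))"
    have p: "0 < g r + 1" using g0[of r] by simp
    have "t\<^sup>2 * g r \<le> t\<^sup>2 * (g r + 1)" by (simp add: mult_left_mono)
    also have "\<dots> = - t * (norm r)\<^sup>2" using p by (simp add: t_def power2_eq_square)
    finally have "0 \<le> t * (norm r)\<^sup>2" using g0[of "u + t *\<^sub>R r"] unfolding exp by linarith
    moreover have "t < 0" using p \<open>r \<noteq> 0\<close> by (simp add: t_def)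
    ultimately show False using \<open>r \<noteq> 0\<close> by (simp add: zero_le_mult_iff)
  qed
  then have "l \<in> eigenvalues A" using u by (auto simp: r_def eigenvalues_def intro!: exI[of _ u])
  with ge show ?thesis using that by blast
qed

lemma eigenvalue_bounds:
  fixes A :: "real ^ 'd::finite ^ 'd"
  assumes A: "transpose A = A" and psd: "\<And>v. 0 \<le> v \<bullet> (A *v v)"
  shows "0 \<le> Min (eigenvalues A)" "Min (eigenvalues A) * (norm v)\<^sup>2 \<le> v \<bullet> (A *v v)"
    "v \<bullet> (A *v v) \<le> Max (eigenvalues A) * (norm v)\<^sup>2"
proof -
  note fin = finite_eigenvalues[OF A]
  obtain l where l: "l \<in> eigenvalues A" "\<And>v. l * (norm v)\<^sup>2 \<le> v \<bullet> (A *v v)"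
    using rayleigh_minimum[OF A] by blast
  have "transpose (- A) = - A" using A by (simp add: transpose_def vec_eq_iff)
  then obtain u where u: "u \<in> eigenvalues (- A)" "\<And>v. u * (norm v)\<^sup>2 \<le> v \<bullet> ((- A) *v v)"
    using rayleigh_minimum[of "- A"] by blast
  have neg: "(- A) *v v = - (A *v v)" for v by (simp add: matrix_vector_mult_def vec_eq_iff sum_negf)
  have u': "- u \<in> eigenvalues A"
  proof -
    obtain v where v: "v \<noteq> 0" "- (A *v v) = u *\<^sub>R v" using u(1) by (auto simp: eigenvalues_def neg)
    then have "A *v v = (- u) *\<^sub>R v" by (metis minus_minus scaleR_minus_left)
    with v(1) show ?thesis by (auto simp: eigenvalues_def)
  qed
  have "Min (eigenvalues A) \<in> eigenvalues A" using fin l(1) by (intro Min_in) auto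
  then obtain w where w: "w \<noteq> 0" "A *v w = Min (eigenvalues A) *\<^sub>R w" by (auto simp: eigenvalues_def)
  have "0 \<le> Min (eigenvalues A) * (w \<bullet> w)" using psd[of w] by (simp add: w(2))
  then show "0 \<le> Min (eigenvalues A)" using w(1) by (metis inner_gt_zero_iff not_le zero_le_mult_iff)
  have "Min (eigenvalues A) * (norm v)\<^sup>2 \<le> l * (norm v)\<^sup>2" using fin l(1) by (intro mult_right_mono) auto
  then show "Min (eigenvalues A) * (norm v)\<^sup>2 \<le> v \<bullet> (A *v v)" using l(2)[of v] by linarith
  have "- u * (norm v)\<^sup>2 \<le> Max (eigenvalues A) * (norm v)\<^sup>2" using fin u' by (intro mult_right_mono) auto
  then show "v \<bullet> (A *v v) \<le> Max (eigenvalues A) * (norm v)\<^sup>2" using u(2)[of v] by (simp add: neg)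
qed

lemma restr_UNIV [simp]: "restr UNIV v = v"
  by (simp add: restr_def)

lemma cov_matrix_quadratic_form:
  "v \<bullet> (cov_matrix x e *v v) = emp_mean e (\<lambda>t. (x t \<bullet> v)\<^sup>2)"
proof -
  have "cov_matrix x e *v v = (1 / real (card e)) *\<^sub>R (gram UNIV x e *v v)"
    by (simp add: cov_matrix_def scaleR_matrix_vector_assoc)
  also have "v \<bullet> \<dots> = emp_mean e (\<lambda>t. (x t \<bullet> v)\<^sup>2)"
    by (simp add: gram_mult_vector inner_sum_right emp_mean_def power2_eq_square inner_commute)
  finally show ?thesis .
qed

lemma cov_matrix_eigenvalue_bounds:
  shows "0 \<le> Min (eigenvalues (cov_matrix x e))"
    "Min (eigenvalues (cov_matrix x e)) * (norm v)\<^sup>2 \<le> emp_mean e (\<lambda>t. (x t \<bullet> v)\<^sup>2)"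
    "emp_mean e (\<lambda>t. (x t \<bullet> v)\<^sup>2) \<le> Max (eigenvalues (cov_matrix x e)) * (norm v)\<^sup>2"
proof -
  have "transpose (cov_matrix x e) = cov_matrix x e"
    by (simp add: transpose_def cov_matrix_def gram_def vec_eq_iff mult.commute)
  moreover have "0 \<le> v \<bullet> (cov_matrix x e *v v)" for v
    unfolding cov_matrix_quadratic_form by (simp add: emp_mean_def sum_nonneg)
  ultimately show "0 \<le> Min (eigenvalues (cov_matrix x e))"
    "Min (eigenvalues (cov_matrix x e)) * (norm v)\<^sup>2 \<le> emp_mean e (\<lambda>t. (x t \<bullet> v)\<^sup>2)"
    "emp_mean e (\<lambda>t. (x t \<bullet> v)\<^sup>2) \<le> Max (eigenvalues (cov_matrix x e)) * (norm v)\<^sup>2"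
    using eigenvalue_bounds[of "cov_matrix x e"] by (simp_all add: cov_matrix_quadratic_form[symmetric])
qed

lemma emp_mean_power_le:
  assumes "finite e" "e \<noteq> {}" "even j"
  shows "emp_mean e g ^ j \<le> emp_mean e (\<lambda>t. g t ^ j :: real)"
  using convex_on_sum[OF assms(1,2) convex_power_even[OF assms(3)], of "\<lambda>_. 1 / real (card e)" g] assms(1,2)
  by (simp add: emp_mean_def sum_divide_distrib)

text \<open>
A small second moment q in direction v forces a small moment of the smallest eigenvalue, since
that eigenvalue is at most the mean of (x_t . v)^2 and moments of order 4k of normal variables
are bounded by q^(2k). The upper bound uses y \<le> 1 + y^(2k).
\<close>

lemma (in prob_space) second_moment_bounds_of_eigenvalue_moments:
  fixes x :: "nat \<Rightarrow> 'a \<Rightarrow> real ^ 'd::finite"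
  assumes e: "finite e" "e \<noteq> {}" and k: "1 \<le> k" and c: "0 < c"
    and Z: "\<And>t. t \<in> e \<Longrightarrow> normal_variable M (\<lambda>w. x t w \<bullet> v) m s" and v: "norm v = 1"
    and lower: "integrable M (\<lambda>w. Min (eigenvalues (cov_matrix (\<lambda>t. x t w) e)) ^ (2 * k))"
      "c \<le> expectation (\<lambda>w. Min (eigenvalues (cov_matrix (\<lambda>t. x t w) e)) ^ (2 * k))"
    and upper: "integrable M (\<lambda>w. Max (eigenvalues (cov_matrix (\<lambda>t. x t w) e)) ^ (2 * k))"
      "expectation (\<lambda>w. Max (eigenvalues (cov_matrix (\<lambda>t. x t w) e)) ^ (2 * k)) \<le> C"
  defines "Ck \<equiv> 2 ^ (4 * k) * (1 + (\<integral>u. u ^ (4 * k) \<partial>std_normal_distribution))"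
  shows "min 1 (c / Ck) \<le> m\<^sup>2 + s\<^sup>2" "m\<^sup>2 + s\<^sup>2 \<le> 1 + C"
proof -
  let ?A = "\<lambda>w. emp_mean e (\<lambda>t. (x t w \<bullet> v)\<^sup>2)" and ?q = "m\<^sup>2 + s\<^sup>2"
  let ?mn = "\<lambda>w. Min (eigenvalues (cov_matrix (\<lambda>t. x t w) e))" and ?mx = "\<lambda>w. Max (eigenvalues (cov_matrix (\<lambda>t. x t w) e))"
  have n: "0 < real (card e)" using e by (simp add: card_gt_0_iff)
  have Ck: "0 < Ck"
    unfolding Ck_def by (intro mult_pos_pos add_pos_nonneg integral_nonneg) (auto simp: zero_le_even_power)
  have i2: "integrable M (\<lambda>w. (x t w \<bullet> v)\<^sup>2)" and E2: "expectation (\<lambda>w. (x t w \<bullet> v)\<^sup>2) = ?q"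
    and i4: "integrable M (\<lambda>w. (x t w \<bullet> v) ^ (4 * k))" and E4: "expectation (\<lambda>w. (x t w \<bullet> v) ^ (4 * k)) \<le> Ck * ?q ^ (2 * k)"
    if "t \<in> e" for t
  proof -
    interpret normal_variable M "\<lambda>w. x t w \<bullet> v" m s by (rule Z[OF that])
    show "integrable M (\<lambda>w. (x t w \<bullet> v)\<^sup>2)" "integrable M (\<lambda>w. (x t w \<bullet> v) ^ (4 * k))" by (rule power_integrable)+
    show "expectation (\<lambda>w. (x t w \<bullet> v)\<^sup>2) = ?q" by (rule second_moment)
    show "expectation (\<lambda>w. (x t w \<bullet> v) ^ (4 * k)) \<le> Ck * ?q ^ (2 * k)" unfolding Ck_def by (rule even_moment_le)
  qed
  have p4: "((z :: real)\<^sup>2) ^ (2 * k) = z ^ (4 * k)" for z by (simp add: power_mult[symmetric])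
  have A0: "0 \<le> ?A w" for w by (simp add: emp_mean_def sum_nonneg)
  have mnA: "0 \<le> ?mn w" "?mn w \<le> ?A w" "?A w \<le> ?mx w" for w
    using cov_matrix_eigenvalue_bounds(1)[where x = "\<lambda>t. x t w" and e = e]
      cov_matrix_eigenvalue_bounds(2,3)[where x = "\<lambda>t. x t w" and e = e and v = v] v
    by auto
  show "min 1 (c / Ck) \<le> ?q"
  proof (rule ccontr)
    assume "\<not> min 1 (c / Ck) \<le> ?q"
    then have q: "?q < 1" "?q < c / Ck" by auto
    have int: "integrable M (\<lambda>w. emp_mean e (\<lambda>t. (x t w \<bullet> v) ^ (4 * k)))"
      unfolding emp_mean_def by (intro integrable_scaleR_right Bochner_Integration.integrable_sum i4)
    have "c \<le> expectation (\<lambda>w. ?mn w ^ (2 * k))" by (rule lower(2))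
    also have "\<dots> \<le> expectation (\<lambda>w. emp_mean e (\<lambda>t. (x t w \<bullet> v) ^ (4 * k)))"
    proof (rule integral_mono[OF lower(1) int])
      fix w
      have "?mn w ^ (2 * k) \<le> ?A w ^ (2 * k)" using mnA by (intro power_mono) auto
      also have "\<dots> \<le> emp_mean e (\<lambda>t. ((x t w \<bullet> v)\<^sup>2) ^ (2 * k))" by (rule emp_mean_power_le[OF e]) simp
      finally show "?mn w ^ (2 * k) \<le> emp_mean e (\<lambda>t. (x t w \<bullet> v) ^ (4 * k))" by (simp only: p4)
    qed
    also have "\<dots> = emp_mean e (\<lambda>t. expectation (\<lambda>w. (x t w \<bullet> v) ^ (4 * k)))"
      using i4 by (simp add: emp_mean_def)
    also have "\<dots> \<le> emp_mean e (\<lambda>t. Ck * ?q ^ (2 * k))"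
      unfolding emp_mean_def using E4 by (intro scaleR_left_mono sum_mono) auto
    also have "\<dots> = Ck * ?q ^ (2 * k)" using n by (simp add: emp_mean_def)
    also have "?q ^ (2 * k) \<le> ?q ^ 1" using q(1) k by (intro power_decreasing) auto
    finally have "c \<le> Ck * ?q" using Ck by simp
    then show False using q(2) Ck by (simp add: field_simps)
  qed
  have "?q = expectation ?A"
    using i2 E2 n by (simp add: emp_mean_def)
  also have "\<dots> \<le> expectation (\<lambda>w. 1 + ?mx w ^ (2 * k))"
  proof (rule integral_mono)
    show "integrable M ?A"
      unfolding emp_mean_def by (intro integrable_scaleR_right Bochner_Integration.integrable_sum i2)
    show "integrable M (\<lambda>w. 1 + ?mx w ^ (2 * k))" using upper(1) by simp
    fix w
    have "?A w \<le> 1 + ?A w ^ (2 * k)"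
    proof (cases "?A w \<le> 1")
      case True
      then show ?thesis using A0[of w] by (smt (verit) zero_le_power)
    next
      case False
      then have "?A w ^ 1 \<le> ?A w ^ (2 * k)" using k by (intro power_increasing) auto
      then show ?thesis by simp
    qed
    also have "?A w ^ (2 * k) \<le> ?mx w ^ (2 * k)" using mnA A0 by (intro power_mono) auto
    finally show "?A w \<le> 1 + ?mx w ^ (2 * k)" by simp
  qed
  also have "\<dots> \<le> 1 + C" using upper by (simp add: prob_space)
  finally show "?q \<le> 1 + C" .
qed

section \<open>Well conditioned designs with high probability\<close>

text \<open>
Here m^2 + s^2 is the second moment of the row in direction v, so that c0 and C0 bound the
eigenvalues of the second moment matrix.
\<close>

definition gaussian_rows ::
  "'w measure \<Rightarrow> (nat \<Rightarrow> 'w \<Rightarrow> real ^ 'd) \<Rightarrow> nat set \<Rightarrow> real \<Rightarrow> real \<Rightarrow> bool" where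
  "gaussian_rows M x g c0 C0 \<longleftrightarrow> finite g \<and> prob_space.indep_vars M (\<lambda>_. borel) x g \<and>
     (\<forall>t\<in>g. \<forall>v. \<exists>m s. normal_variable M (\<lambda>w. x t w \<bullet> v) m s
        \<and> c0 * (norm v)\<^sup>2 \<le> m\<^sup>2 + s\<^sup>2 \<and> m\<^sup>2 + s\<^sup>2 \<le> C0 * (norm v)\<^sup>2)"

lemma (in prob_space) gaussian_rows_mono:
  "gaussian_rows M x g c0 C0 \<Longrightarrow> h \<subseteq> g \<Longrightarrow> gaussian_rows M x h c0 C0"
  unfolding gaussian_rows_def by (meson finite_subset indep_vars_subset subset_iff)

lemma (in prob_space) gaussian_rows_lower_tail:
  assumes g: "gaussian_rows M x g c0 C0" and c0: "0 < c0" and v: "norm v = 1"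
  shows "prob {w \<in> space M. (\<Sum>t\<in>g. (x t w \<bullet> v)\<^sup>2) \<le> c0 / 12 * real (card g)} \<le> exp (- real (card g) / 9)"
proof -
  have fin: "finite g" and ind: "indep_vars (\<lambda>_. borel) x g" using g by (auto simp: gaussian_rows_def)
  have "\<forall>t\<in>g. \<exists>m s. normal_variable M (\<lambda>w. x t w \<bullet> v) m s \<and> c0 \<le> m\<^sup>2 + s\<^sup>2"
    using g v by (fastforce simp: gaussian_rows_def)
  then obtain m s where ms: "\<And>t. t \<in> g \<Longrightarrow> normal_variable M (\<lambda>w. x t w \<bullet> v) (m t) (s t)" "\<And>t. t \<in> g \<Longrightarrow> c0 \<le> (m t)\<^sup>2 + (s t)\<^sup>2"
    by metis
  define q where "q t = (m t)\<^sup>2 + (s t)\<^sup>2" for t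
  have q: "c0 \<le> q t" if "t \<in> g" for t using ms(2)[OF that] by (simp add: q_def)
  let ?X = "\<lambda>t w. - ((x t w \<bullet> v)\<^sup>2 / (3 * q t))"
  have "prob {w \<in> space M. - real (card g) / 36 \<le> (\<Sum>t\<in>g. ?X t w)} \<le> exp ((\<Sum>t\<in>g. - 1 / 6) - (- real (card g) / 36))"
  proof (rule chernoff_bound[OF fin])
    show "indep_vars (\<lambda>_. borel) ?X g"
      by (rule indep_vars_compose2[OF ind, where Y = "\<lambda>t u. - ((u \<bullet> v)\<^sup>2 / (3 * q t))"]) measurable
    fix t assume t: "t \<in> g"
    interpret normal_variable M "\<lambda>w. x t w \<bullet> v" "m t" "s t" by (rule ms(1)[OF t])
    show "(\<integral>\<^sup>+w. ennreal (exp (?X t w)) \<partial>M) \<le> ennreal (exp (- 1 / 6))"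
      by (rule exp_neg_square_le) (use q[OF t] c0 in \<open>auto simp: q_def\<close>)
  qed
  also have "\<dots> \<le> exp (- real (card g) / 9)" by simp
  finally have 1: "prob {w \<in> space M. - real (card g) / 36 \<le> (\<Sum>t\<in>g. ?X t w)} \<le> exp (- real (card g) / 9)" .
  have xm: "(\<lambda>w. x t w \<bullet> v) \<in> borel_measurable M" if "t \<in> g" for t
  proof -
    interpret normal_variable M "\<lambda>w. x t w \<bullet> v" "m t" "s t" by (rule ms(1)[OF that])
    show ?thesis by (rule Z)
  qed
  have "prob {w \<in> space M. (\<Sum>t\<in>g. (x t w \<bullet> v)\<^sup>2) \<le> c0 / 12 * real (card g)}
      \<le> prob {w \<in> space M. - real (card g) / 36 \<le> (\<Sum>t\<in>g. ?X t w)}"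
  proof (rule finite_measure_mono)
    have "(\<lambda>w. \<Sum>t\<in>g. ?X t w) \<in> borel_measurable M"
      using xm by (intro borel_measurable_sum borel_measurable_uminus borel_measurable_divide borel_measurable_power) auto
    then show "{w \<in> space M. - real (card g) / 36 \<le> (\<Sum>t\<in>g. ?X t w)} \<in> events" by measurable
    show "{w \<in> space M. (\<Sum>t\<in>g. (x t w \<bullet> v)\<^sup>2) \<le> c0 / 12 * real (card g)} \<subseteq> {w \<in> space M. - real (card g) / 36 \<le> (\<Sum>t\<in>g. ?X t w)}"
    proof clarify
      fix w assume *: "(\<Sum>t\<in>g. (x t w \<bullet> v)\<^sup>2) \<le> c0 / 12 * real (card g)"
      have "(\<Sum>t\<in>g. (x t w \<bullet> v)\<^sup>2 / (3 * q t)) \<le> (\<Sum>t\<in>g. (x t w \<bullet> v)\<^sup>2 / (3 * c0))"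
        using q c0 by (intro sum_mono divide_left_mono mult_pos_pos) (auto intro: less_le_trans)
      also have "\<dots> = (\<Sum>t\<in>g. (x t w \<bullet> v)\<^sup>2) / (3 * c0)" by (simp add: sum_divide_distrib)
      also have "\<dots> \<le> c0 / 12 * real (card g) / (3 * c0)" using * c0 by (intro divide_right_mono) auto
      also have "\<dots> = real (card g) / 36" using c0 by simp
      finally show "- real (card g) / 36 \<le> (\<Sum>t\<in>g. ?X t w)" by (simp add: sum_negf)
    qed
  qed
  with 1 show ?thesis by linarith
qed

lemma (in prob_space) gaussian_rows_upper_tail:
  assumes g: "gaussian_rows M x g c0 C0" and C0: "0 < C0" and v: "norm v = 1"
  shows "prob {w \<in> space M. K \<le> (\<Sum>t\<in>g. (x t w \<bullet> v)\<^sup>2)} \<le> exp (real (card g) - K / (8 * C0))"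
proof -
  have fin: "finite g" and ind: "indep_vars (\<lambda>_. borel) x g" using g by (auto simp: gaussian_rows_def)
  have "\<forall>t\<in>g. \<exists>m s. normal_variable M (\<lambda>w. x t w \<bullet> v) m s \<and> m\<^sup>2 + s\<^sup>2 \<le> C0"
    using g v by (fastforce simp: gaussian_rows_def)
  then obtain m s where ms: "\<And>t. t \<in> g \<Longrightarrow> normal_variable M (\<lambda>w. x t w \<bullet> v) (m t) (s t)" "\<And>t. t \<in> g \<Longrightarrow> (m t)\<^sup>2 + (s t)\<^sup>2 \<le> C0"
    by metis
  let ?X = "\<lambda>t w. (x t w \<bullet> v)\<^sup>2 / (8 * C0)"
  have "prob {w \<in> space M. K / (8 * C0) \<le> (\<Sum>t\<in>g. ?X t w)} \<le> exp ((\<Sum>t\<in>g. 1) - K / (8 * C0))"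
  proof (rule chernoff_bound[OF fin])
    show "indep_vars (\<lambda>_. borel) ?X g"
      by (rule indep_vars_compose2[OF ind, where Y = "\<lambda>t u. (u \<bullet> v)\<^sup>2 / (8 * C0)"]) measurable
    fix t assume t: "t \<in> g"
    interpret normal_variable M "\<lambda>w. x t w \<bullet> v" "m t" "s t" by (rule ms(1)[OF t])
    show "(\<integral>\<^sup>+w. ennreal (exp (?X t w)) \<partial>M) \<le> ennreal (exp 1)"
      by (rule exp_square_le[OF ms(2)[OF t] C0])
  qed
  moreover have "K / (8 * C0) \<le> (\<Sum>t\<in>g. ?X t w) \<longleftrightarrow> K \<le> (\<Sum>t\<in>g. (x t w \<bullet> v)\<^sup>2)" for w
    using C0 by (simp add: sum_divide_distrib[symmetric] divide_le_cancel)
  ultimately show ?thesis by simp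
qed


lemma unit_sphere_net:
  assumes "0 < \<rho>"
  obtains N :: "(real ^ 'd::finite) set" where "finite N" "\<And>u. u \<in> N \<Longrightarrow> norm u = 1"
    "\<And>v. norm v = 1 \<Longrightarrow> \<exists>u\<in>N. norm (u - v) < \<rho>"
proof -
  have "seq_compact (sphere (0 :: real ^ 'd) 1)" by (simp add: compact_imp_seq_compact)
  from seq_compact_imp_totally_bounded[OF this] assms
  obtain N where N: "finite N" "N \<subseteq> sphere (0 :: real ^ 'd) 1" "sphere 0 1 \<subseteq> (\<Union>x\<in>N. ball x \<rho>)"
    by meson
  show ?thesis
  proof (rule that[OF N(1)])
    show "norm u = 1" if "u \<in> N" for u using that N(2) by auto
    show "\<exists>u\<in>N. norm (u - v) < \<rho>" if "norm v = 1" for v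
    proof -
      have "v \<in> sphere 0 1" using that by simp
      then obtain u where "u \<in> N" "v \<in> ball u \<rho>" using N(3) by blast
      then show ?thesis by (auto simp: dist_norm)
    qed
  qed
qed

lemma sum_cover_le:
  fixes f :: "'a \<Rightarrow> real"
  assumes "finite e" "finite I" "e \<subseteq> (\<Union>i\<in>I. g i)" "\<And>t. 0 \<le> f t"
  shows "(\<Sum>t\<in>e. f t) \<le> (\<Sum>i\<in>I. \<Sum>t\<in>e \<inter> g i. f t)"
proof -
  have "(\<Sum>t\<in>e. f t) \<le> (\<Sum>t\<in>e. \<Sum>i\<in>I. if t \<in> g i then f t else 0)"
  proof (rule sum_mono)
    fix t assume "t \<in> e"
    then obtain i where i: "i \<in> I" "t \<in> g i" using assms(3) by auto
    have "f t = (if t \<in> g i then f t else 0)" using i by simp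
    also have "\<dots> \<le> (\<Sum>i\<in>I. if t \<in> g i then f t else 0)"
      using assms(2,4) i(1) by (intro member_le_sum) auto
    finally show "f t \<le> (\<Sum>i\<in>I. if t \<in> g i then f t else 0)" .
  qed
  also have "\<dots> = (\<Sum>i\<in>I. \<Sum>t\<in>e. if t \<in> g i then f t else 0)" by (rule sum.swap)
  also have "\<dots> = (\<Sum>i\<in>I. \<Sum>t\<in>e \<inter> g i. f t)"
    by (simp only: sum.inter_restrict[OF assms(1)])
  finally show ?thesis .
qed

lemma emp_mean_mono: "(\<And>t. t \<in> e \<Longrightarrow> f t \<le> g t) \<Longrightarrow> emp_mean e f \<le> (emp_mean e g :: real)"
  by (simp add: emp_mean_def divide_right_mono sum_mono)

text \<open>
The piece of e in one of the L + 1 groups has at least |e| / (L + 1) rows. On this piece the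
lower tail bound holds simultaneously for the finitely many directions of a net of the unit
sphere. The upper tail bound for the coordinates bounds the trace, which extends the lower
bound from the net to all directions. The other pieces only increase the quadratic form,
however they depend on the chosen one.
\<close>

lemma well_conditioned_exponential:
  fixes c0 C0 :: real and L :: nat
  assumes c0: "0 < c0" and C0: "0 < C0"
  obtains c1 K D \<kappa> where "0 < c1" "0 < K" "0 \<le> D" "0 < \<kappa>"
    "\<And>(M :: 'w measure) (x :: nat \<Rightarrow> 'w \<Rightarrow> real ^ 'd::finite) g e.
       \<lbrakk>prob_space M; finite e; e \<noteq> {}; \<forall>i\<in>{1..L + 1}. gaussian_rows M x (g i) c0 C0; e \<subseteq> (\<Union>i\<in>{1..L + 1}. g i)\<rbrakk> \<Longrightarrow>
       \<exists>B\<in>sets M. measure M B \<le> D * exp (- \<kappa> * real (card e))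
         \<and> (\<forall>w\<in>space M - B. well_conditioned c1 K (\<lambda>t. x t w) e)"
proof -
  define R where "R = real (L + 1)"
  \<comment> \<open>The tail bound gives c0 / 12 on the large piece, hence c0 / (12 R) = 4 c1 on e for directions of the net;
    2 c1 of this is lost to the distance from the net, and half of the rest to squaring a sum.\<close>
  define c1 where "c1 = c0 / (48 * R)"
  define K where "K = 16 * C0 * R * real CARD('d)"
  define \<kappa> where "\<kappa> = 1 / (9 * R)"
  have R: "1 \<le> R" by (simp add: R_def)
  have pos: "0 < c1" "0 < K" "0 < \<kappa>" "\<kappa> \<le> 1" using R c0 C0 by (auto simp: c1_def K_def \<kappa>_def)
  obtain N :: "(real ^ 'd) set" where N: "finite N" "\<And>u. u \<in> N \<Longrightarrow> norm u = 1"
    and net: "\<And>v. norm v = 1 \<Longrightarrow> \<exists>u\<in>N. norm (u - v) < sqrt (c1 / K)"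
    using unit_sphere_net[of "sqrt (c1 / K)"] pos by auto
  define D where "D = real (card N) + R * real CARD('d)"
  have D: "0 \<le> D" using R by (simp add: D_def)
  have main: "\<exists>B\<in>sets M. measure M B \<le> D * exp (- \<kappa> * real (card e))
         \<and> (\<forall>w\<in>space M - B. well_conditioned c1 K (\<lambda>t. x t w) e)"
    if M: "prob_space M" and e: "finite e" "e \<noteq> {}" and g: "\<forall>i\<in>{1..L + 1}. gaussian_rows M x (g i) c0 C0"
      and cover: "e \<subseteq> (\<Union>i\<in>{1..L + 1}. g i)"
    for M :: "'w measure" and x :: "nat \<Rightarrow> 'w \<Rightarrow> real ^ 'd" and g e
  proof -
    interpret prob_space M by (rule M)
    define n where "n = real (card e)"
    have n: "0 < n" using e by (simp add: n_def card_gt_0_iff)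
    let ?I = "{1..L + 1}"
    have gi: "gaussian_rows M x (e \<inter> g i) c0 C0" if "i \<in> ?I" for i
      using g that gaussian_rows_mono by blast
    have "\<exists>i\<in>?I. n \<le> R * real (card (e \<inter> g i))"
    proof (rule ccontr)
      assume "\<not> ?thesis"
      then have *: "R * real (card (e \<inter> g i)) < n" if "i \<in> ?I" for i using that by (meson not_le)
      have "n \<le> (\<Sum>i\<in>?I. real (card (e \<inter> g i)))"
        using sum_cover_le[OF e(1) _ cover, of "\<lambda>_. 1"] by (simp add: n_def)
      also have "\<dots> < (\<Sum>i\<in>?I. n / R)"
        using * R by (intro sum_strict_mono) (auto simp: field_simps)
      also have "\<dots> = n" using R by (simp add: R_def)
      finally show False by simp
    qed
    then obtain i0 where i0: "i0 \<in> ?I" "n \<le> R * real (card (e \<inter> g i0))" by blast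
    let ?h = "e \<inter> g i0"
    define B1 where "B1 u = {w \<in> space M. (\<Sum>t\<in>?h. (x t w \<bullet> u)\<^sup>2) \<le> c0 / 12 * real (card ?h)}" for u
    define B2 where "B2 ij = {w \<in> space M. 16 * C0 * n \<le> (\<Sum>t\<in>e \<inter> g (fst ij). (x t w \<bullet> axis (snd ij) 1)\<^sup>2)}" for ij :: "nat \<times> 'd"
    define B where "B = (\<Union>u\<in>N. B1 u) \<union> (\<Union>ij\<in>?I \<times> UNIV. B2 ij)"
    have xm: "(\<lambda>w. \<Sum>t\<in>e \<inter> g i. (x t w \<bullet> u)\<^sup>2) \<in> borel_measurable M" if "i \<in> ?I" for i u
    proof -
      have "x t \<in> borel_measurable M" if "t \<in> e \<inter> g i" for t
        using gi[OF \<open>i \<in> ?I\<close>] that by (auto simp: gaussian_rows_def indep_vars_def)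
      then show ?thesis by (intro borel_measurable_sum borel_measurable_power borel_measurable_inner) auto
    qed
    have B1m: "B1 u \<in> events" for u unfolding B1_def using xm[OF i0(1), of u] by measurable
    have B2m: "B2 ij \<in> events" if "ij \<in> ?I \<times> UNIV" for ij
    proof -
      have "fst ij \<in> ?I" using that by auto
      from xm[OF this, of "axis (snd ij) 1"] show ?thesis unfolding B2_def by measurable
    qed
    have Bm: "B \<in> events" unfolding B_def using N(1) B1m B2m by (intro sets.Un sets.finite_UN) auto
    have e1: "exp (- real (card ?h) / 9) \<le> exp (- \<kappa> * n)"
      using i0(2) R by (simp add: \<kappa>_def field_simps)
    have p1: "prob (B1 u) \<le> exp (- \<kappa> * n)" if "u \<in> N" for u
      using gaussian_rows_lower_tail[OF gi[OF i0(1)] c0 N(2)[OF that]] e1 unfolding B1_def by linarith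
    have p2: "prob (B2 ij) \<le> exp (- \<kappa> * n)" if "ij \<in> ?I \<times> UNIV" for ij
    proof -
      have i: "fst ij \<in> ?I" using that by auto
      have "prob (B2 ij) \<le> exp (real (card (e \<inter> g (fst ij))) - 16 * C0 * n / (8 * C0))"
        unfolding B2_def by (rule gaussian_rows_upper_tail[OF gi[OF i] C0]) (simp add: norm_axis_1)
      also have "\<dots> \<le> exp (- \<kappa> * n)"
      proof -
        have "real (card (e \<inter> g (fst ij))) \<le> n" unfolding n_def using e(1) by (simp add: card_mono)
        moreover have "\<kappa> * n \<le> 1 * n" using pos n by (intro mult_right_mono) auto
        ultimately show ?thesis using C0 by simp
      qed
      finally show ?thesis .
    qed
    have "prob B \<le> prob (\<Union>u\<in>N. B1 u) + prob (\<Union>ij\<in>?I \<times> UNIV. B2 ij)"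
      unfolding B_def using N(1) B1m B2m by (intro measure_Un_le sets.finite_UN) auto
    also have "\<dots> \<le> (\<Sum>u\<in>N. prob (B1 u)) + (\<Sum>ij\<in>?I \<times> UNIV. prob (B2 ij))"
      using N(1) B1m B2m by (intro add_mono finite_measure_subadditive_finite) auto
    also have "\<dots> \<le> (\<Sum>u\<in>N. exp (- \<kappa> * n)) + (\<Sum>ij\<in>?I \<times> (UNIV :: 'd set). exp (- \<kappa> * n))"
      using p1 p2 by (intro add_mono sum_mono) auto
    also have "\<dots> = D * exp (- \<kappa> * n)" by (simp add: D_def R_def algebra_simps)
    finally have PB: "prob B \<le> D * exp (- \<kappa> * n)" .
    have wc: "well_conditioned c1 K (\<lambda>t. x t w) e" if w: "w \<in> space M - B" for w
    proof -
      let ?A = "\<lambda>v. emp_mean e (\<lambda>t. (x t w \<bullet> v)\<^sup>2)"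
      have coord: "(\<Sum>t\<in>e. (x t w \<bullet> axis j 1)\<^sup>2) \<le> R * (16 * C0 * n)" for j
      proof -
        have "(\<Sum>t\<in>e. (x t w \<bullet> axis j 1)\<^sup>2) \<le> (\<Sum>i\<in>?I. \<Sum>t\<in>e \<inter> g i. (x t w \<bullet> axis j 1)\<^sup>2)"
          by (rule sum_cover_le[OF e(1) _ cover]) auto
        also have "\<dots> \<le> (\<Sum>i\<in>?I. 16 * C0 * n)"
        proof (rule sum_mono)
          fix i assume "i \<in> ?I"
          then have "w \<notin> B2 (i, j)" using w by (auto simp: B_def)
          then show "(\<Sum>t\<in>e \<inter> g i. (x t w \<bullet> axis j 1)\<^sup>2) \<le> 16 * C0 * n" using w by (auto simp: B2_def)
        qed
        finally show ?thesis by (simp add: R_def)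
      qed
      have upper: "?A v \<le> K * (norm v)\<^sup>2" for v
      proof -
        have "?A v \<le> emp_mean e (\<lambda>t. (norm v)\<^sup>2 * (\<Sum>j\<in>UNIV. (x t w \<bullet> axis j 1)\<^sup>2))"
        proof (rule emp_mean_mono)
          fix t
          have "(x t w \<bullet> v)\<^sup>2 \<le> (norm (x t w) * norm v)\<^sup>2"
            by (intro power2_le_iff_abs_le[THEN iffD2] Cauchy_Schwarz_ineq2) simp
          also have "(norm (x t w))\<^sup>2 = (\<Sum>j\<in>UNIV. (x t w \<bullet> axis j 1)\<^sup>2)"
            unfolding power2_norm_eq_inner by (simp add: inner_axis power2_eq_square) (simp add: inner_vec_def)
          ultimately show "(x t w \<bullet> v)\<^sup>2 \<le> (norm v)\<^sup>2 * (\<Sum>j\<in>UNIV. (x t w \<bullet> axis j 1)\<^sup>2)"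
            by (simp add: power_mult_distrib mult.commute)
        qed
        also have "\<dots> = (norm v)\<^sup>2 / n * (\<Sum>j\<in>UNIV. \<Sum>t\<in>e. (x t w \<bullet> axis j 1)\<^sup>2)"
          by (subst sum.swap) (simp add: emp_mean_def n_def sum_distrib_left)
        also have "\<dots> \<le> (norm v)\<^sup>2 / n * (\<Sum>j\<in>(UNIV :: 'd set). R * (16 * C0 * n))"
          using coord n by (intro mult_left_mono sum_mono) auto
        also have "\<dots> = K * (norm v)\<^sup>2" using n by (simp add: K_def)
        finally show ?thesis .
      qed
      have unit: "c1 \<le> ?A v" if v: "norm v = 1" for v
      proof -
        obtain u where u: "u \<in> N" "norm (u - v) < sqrt (c1 / K)" using net[OF v] by blast
        have "(norm (u - v))\<^sup>2 \<le> (sqrt (c1 / K))\<^sup>2" using u(2) by (intro power_mono) auto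
        then have "K * (norm (u - v))\<^sup>2 \<le> c1" using pos by (simp add: field_simps)
        then have uv: "?A (u - v) \<le> c1" using upper[of "u - v"] by linarith
        have "4 * c1 \<le> ?A u"
        proof -
          have "w \<notin> B1 u" using w u(1) by (auto simp: B_def)
          then have "c0 / 12 * real (card ?h) \<le> (\<Sum>t\<in>?h. (x t w \<bullet> u)\<^sup>2)" using w by (auto simp: B1_def)
          also have "\<dots> \<le> (\<Sum>t\<in>e. (x t w \<bullet> u)\<^sup>2)" using e(1) by (intro sum_mono2) auto
          finally have "c0 / 12 * real (card ?h) \<le> n * ?A u" using n by (simp add: emp_mean_def n_def)
          moreover have "n * (4 * c1) \<le> c0 / 12 * real (card ?h)"
            using i0(2) R c0 by (simp add: c1_def field_simps)
          ultimately have "n * (4 * c1) \<le> n * ?A u" by linarith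
          then show ?thesis using n by simp
        qed
        also have "?A u \<le> emp_mean e (\<lambda>t. 2 * (x t w \<bullet> v)\<^sup>2 + 2 * (x t w \<bullet> (u - v))\<^sup>2)"
        proof (rule emp_mean_mono)
          fix t
          have "0 \<le> (x t w \<bullet> v - x t w \<bullet> (u - v))\<^sup>2" by simp
          then show "(x t w \<bullet> u)\<^sup>2 \<le> 2 * (x t w \<bullet> v)\<^sup>2 + 2 * (x t w \<bullet> (u - v))\<^sup>2"
            by (simp add: inner_diff_right power2_eq_square algebra_simps)
        qed
        also have "\<dots> = 2 * ?A v + 2 * ?A (u - v)"
          by (simp add: emp_mean_def sum.distrib sum_distrib_left[symmetric] add_divide_distrib)
        finally show "c1 \<le> ?A v" using uv by linarith
      qed
      have lower: "c1 * (norm v)\<^sup>2 \<le> ?A v" for v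
      proof (cases "v = 0")
        case True
        then show ?thesis by (simp add: emp_mean_def)
      next
        case False
        have "?A ((1 / norm v) *\<^sub>R v) = ?A v / (norm v)\<^sup>2"
          by (simp add: emp_mean_def power_divide sum_divide_distrib mult.commute)
        then have "c1 \<le> ?A v / (norm v)\<^sup>2" using unit[of "(1 / norm v) *\<^sub>R v"] False by simp
        then show ?thesis using False by (simp add: field_simps)
      qed
      show ?thesis using lower upper by (simp add: well_conditioned_def)
    qed
    show ?thesis using Bm PB wc by (auto simp: n_def)
  qed
  show ?thesis by (rule that[OF pos(1,2) D pos(3) main])
qed

section \<open>Concentration of the errors\<close>

lemma norm_le_of_coordinates:
  fixes v :: "real ^ 'd::finite"
  assumes "\<And>j. \<bar>v $ j\<bar> \<le> \<eta> / real CARD('d)"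
  shows "norm v \<le> \<eta>"
proof -
  have "norm v \<le> (\<Sum>j\<in>UNIV. \<bar>v $ j\<bar>)" by (rule norm_le_l1_cart)
  also have "\<dots> \<le> (\<Sum>j\<in>(UNIV :: 'd set). \<eta> / real CARD('d))" using assms by (rule sum_mono)
  also have "\<dots> = \<eta>" by simp
  finally show ?thesis .
qed

lemma (in prob_space) centred_sum_tail:
  fixes X :: "'i \<Rightarrow> 'a \<Rightarrow> real"
  assumes I: "finite I" "indep_vars (\<lambda>_. borel) X I"
    and sq: "\<And>i. i \<in> I \<Longrightarrow> integrable M (\<lambda>w. (X i w)\<^sup>2)"
    and mean: "\<And>i. i \<in> I \<Longrightarrow> expectation (X i) = 0"
    and var: "\<And>i. i \<in> I \<Longrightarrow> expectation (\<lambda>w. (X i w)\<^sup>2) \<le> V"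
    and h: "0 < h"
  shows "prob {w \<in> space M. h \<le> \<bar>\<Sum>i\<in>I. X i w\<bar>} \<le> real (card I) * V / h\<^sup>2"
proof -
  let ?S = "\<lambda>w. \<Sum>i\<in>I. X i w"
  have X: "X i \<in> borel_measurable M" if "i \<in> I" for i
    using I(2) that by (simp add: indep_vars_def)
  have int: "integrable M (X i)" if "i \<in> I" for i
    by (rule square_integrable_imp_integrable[OF X[OF that] sq[OF that]])
  have prod: "integrable M (\<lambda>w. X i w * X j w) \<and> expectation (\<lambda>w. X i w * X j w) = (if i = j then expectation (\<lambda>w. (X i w)\<^sup>2) else 0)"
    if "i \<in> I" "j \<in> I" for i j
  proof (cases "i = j")
    case True
    then show ?thesis using sq[OF that(1)] by (simp add: power2_eq_square)
  next
    case False
    have ij: "indep_vars (\<lambda>_. borel) X {i, j}" by (rule indep_vars_subset[OF I(2)]) (use that in auto)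
    have "expectation (\<lambda>w. \<Prod>l\<in>{i, j}. X l w) = (\<Prod>l\<in>{i, j}. expectation (X l))"
      by (rule indep_vars_lebesgue_integral[OF _ ij]) (use that int in auto)
    moreover have "integrable M (\<lambda>w. \<Prod>l\<in>{i, j}. X l w)"
      by (rule indep_vars_integrable[OF _ ij]) (use that int in auto)
    ultimately show ?thesis using False mean that by simp
  qed
  have S2: "(?S w)\<^sup>2 = (\<Sum>i\<in>I. \<Sum>j\<in>I. X i w * X j w)" for w
    by (simp add: power2_eq_square sum_product)
  have S2int: "integrable M (\<lambda>w. (?S w)\<^sup>2)"
    unfolding S2 using prod by (intro Bochner_Integration.integrable_sum) auto
  have ES2: "expectation (\<lambda>w. (?S w)\<^sup>2) \<le> real (card I) * V"
  proof -
    have "expectation (\<lambda>w. (?S w)\<^sup>2) = (\<Sum>i\<in>I. \<Sum>j\<in>I. expectation (\<lambda>w. X i w * X j w))"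
      unfolding S2 using prod
      by (subst Bochner_Integration.integral_sum) (auto intro!: sum.cong Bochner_Integration.integral_sum Bochner_Integration.integrable_sum)
    also have "\<dots> = (\<Sum>i\<in>I. \<Sum>j\<in>I. if i = j then expectation (\<lambda>w. (X i w)\<^sup>2) else 0)"
      using prod by (intro sum.cong refl) auto
    also have "\<dots> = (\<Sum>i\<in>I. expectation (\<lambda>w. (X i w)\<^sup>2))" using I(1) by simp
    also have "\<dots> \<le> (\<Sum>i\<in>I. V)" using var by (rule sum_mono)
    finally show ?thesis by simp
  qed
  have ES: "expectation ?S = 0" using int mean by (simp add: Bochner_Integration.integral_sum)
  have "prob {w \<in> space M. h \<le> \<bar>?S w - expectation ?S\<bar>} \<le> variance ?S / h\<^sup>2"
    using X by (intro Chebyshev_inequality S2int h borel_measurable_sum) auto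
  also have "variance ?S / h\<^sup>2 \<le> real (card I) * V / h\<^sup>2"
    using ES2 by (intro divide_right_mono) (simp_all add: ES)
  finally show ?thesis by (simp add: ES)
qed

text \<open>
Errors have mean 0 and are independent of the row, so both quantities are means of independent
centred variables with bounded variances, and Chebyshev's inequality applies.
\<close>

lemma (in prob_space) regression_error_concentration:
  fixes \<epsilon> :: "nat \<Rightarrow> 'a \<Rightarrow> real" and z :: "nat \<Rightarrow> 'a \<Rightarrow> real ^ 'd::finite"
  assumes f: "finite f" "f \<noteq> {}" and \<eta>: "0 < \<eta>"
    and ind: "indep_vars (\<lambda>_. borel) (\<lambda>t w. (\<epsilon> t w, z t w)) f"
    and law: "\<And>t. t \<in> f \<Longrightarrow> normal_variable M (\<epsilon> t) 0 \<sigma>"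
    and orth: "\<And>t j. t \<in> f \<Longrightarrow> indep_var borel (\<epsilon> t) borel (\<lambda>w. z t w $ j)"
    and z: "\<And>t j. t \<in> f \<Longrightarrow> integrable M (\<lambda>w. (z t w $ j)\<^sup>2)" "\<And>t j. t \<in> f \<Longrightarrow> expectation (\<lambda>w. (z t w $ j)\<^sup>2) \<le> C0"
  shows "\<exists>B\<in>events. prob B \<le> (3 * \<sigma> ^ 4 + real CARD('d) ^ 3 * \<sigma>\<^sup>2 * C0) / (\<eta>\<^sup>2 * real (card f))
     \<and> (\<forall>w\<in>space M - B. errors_within \<eta> (\<sigma>\<^sup>2) (\<lambda>t. \<epsilon> t w) (\<lambda>t. z t w) f)"
proof -
  define n where "n = real (card f)"
  define d where "d = real CARD('d)"
  have n: "0 < n" using f by (simp add: n_def card_gt_0_iff)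
  have d: "0 < d" by (simp add: d_def)
  have \<epsilon>m: "\<epsilon> t \<in> borel_measurable M" and \<epsilon>2: "integrable M (\<lambda>w. (\<epsilon> t w)\<^sup>2)" and \<epsilon>4: "integrable M (\<lambda>w. (\<epsilon> t w) ^ 4)"
    and E1: "expectation (\<epsilon> t) = 0" and E2: "expectation (\<lambda>w. (\<epsilon> t w)\<^sup>2) = \<sigma>\<^sup>2" and E4: "expectation (\<lambda>w. (\<epsilon> t w) ^ 4) \<le> 3 * \<sigma> ^ 4"
    and \<epsilon>1: "integrable M (\<epsilon> t)"
    if "t \<in> f" for t
  proof -
    interpret normal_variable M "\<epsilon> t" 0 \<sigma> by (rule law[OF that])
    show "\<epsilon> t \<in> borel_measurable M" by (rule Z)
    show "integrable M (\<lambda>w. (\<epsilon> t w)\<^sup>2)" "integrable M (\<lambda>w. (\<epsilon> t w) ^ 4)" by (rule power_integrable)+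
    show "integrable M (\<epsilon> t)" using power_integrable[of 1] by simp
    show "expectation (\<epsilon> t) = 0" by (rule first_moment)
    show "expectation (\<lambda>w. (\<epsilon> t w)\<^sup>2) = \<sigma>\<^sup>2" using second_moment by simp
    show "expectation (\<lambda>w. (\<epsilon> t w) ^ 4) \<le> 3 * \<sigma> ^ 4" using fourth_moment_le by (simp add: power_mult[symmetric])
  qed
  define X where "X t w = (\<epsilon> t w)\<^sup>2 - \<sigma>\<^sup>2" for t w
  define Y where "Y j t w = \<epsilon> t w * z t w $ j" for j t w
  have indX: "indep_vars (\<lambda>_. borel) X f"
  proof -
    have "indep_vars (\<lambda>_. borel) (\<lambda>t w. (fst (\<epsilon> t w, z t w))\<^sup>2 - \<sigma>\<^sup>2) f"
      by (rule indep_vars_compose2[OF ind, where Y = "\<lambda>_ p. (fst p)\<^sup>2 - \<sigma>\<^sup>2"]) (simp add: borel_prod[symmetric])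
    then show ?thesis by (simp add: X_def[abs_def])
  qed
  have indY: "indep_vars (\<lambda>_. borel) (Y j) f" for j
  proof -
    have "(\<lambda>p :: real \<times> (real ^ 'd). fst p * snd p $ j) \<in> borel_measurable borel"
      unfolding cart_eq_inner_axis by (simp add: borel_prod[symmetric])
    then have "indep_vars (\<lambda>_. borel) (\<lambda>t w. fst (\<epsilon> t w, z t w) * snd (\<epsilon> t w, z t w) $ j) f"
      by (intro indep_vars_compose2[OF ind, where Y = "\<lambda>_ p. fst p * snd p $ j"])
    then show ?thesis by (simp add: Y_def[abs_def])
  qed
  have X2: "integrable M (\<lambda>w. (X t w)\<^sup>2)" "expectation (X t) = 0" "expectation (\<lambda>w. (X t w)\<^sup>2) \<le> 3 * \<sigma> ^ 4" if "t \<in> f" for t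
  proof -
    have eq: "(X t w)\<^sup>2 = (\<epsilon> t w) ^ 4 - (2 * \<sigma>\<^sup>2) * (\<epsilon> t w)\<^sup>2 + \<sigma> ^ 4" for w
      by (simp add: X_def power2_diff power_mult[symmetric])
    show "integrable M (\<lambda>w. (X t w)\<^sup>2)" unfolding eq using \<epsilon>2[OF that] \<epsilon>4[OF that] by simp
    show "expectation (X t) = 0" unfolding X_def using \<epsilon>2[OF that] E2[OF that] by (simp add: prob_space)
    have "expectation (\<lambda>w. (X t w)\<^sup>2) = expectation (\<lambda>w. (\<epsilon> t w) ^ 4) - (2 * \<sigma>\<^sup>2) * \<sigma>\<^sup>2 + \<sigma> ^ 4"
      unfolding eq using \<epsilon>2[OF that] \<epsilon>4[OF that] E2[OF that] by (simp add: prob_space)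
    also have "\<dots> \<le> 3 * \<sigma> ^ 4"
    proof -
      have "\<sigma>\<^sup>2 * \<sigma>\<^sup>2 = \<sigma> ^ 4" by (simp add: power2_eq_square power4_eq_xxxx)
      moreover have "0 \<le> \<sigma> ^ 4" by simp
      ultimately show ?thesis using E4[OF that] by (simp only: mult.assoc)
    qed
    finally show "expectation (\<lambda>w. (X t w)\<^sup>2) \<le> 3 * \<sigma> ^ 4" .
  qed
  have Y2: "integrable M (\<lambda>w. (Y j t w)\<^sup>2)" "expectation (Y j t) = 0" "expectation (\<lambda>w. (Y j t w)\<^sup>2) \<le> \<sigma>\<^sup>2 * C0" if "t \<in> f" for t j
  proof -
    have zj: "(\<lambda>w. z t w $ j) \<in> borel_measurable M" by (rule indep_var_rv2[OF orth[OF that]])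
    have z1: "integrable M (\<lambda>w. z t w $ j)" by (rule square_integrable_imp_integrable[OF zj z(1)[OF that]])
    have i1: "indep_var borel (\<epsilon> t) borel (\<lambda>w. z t w $ j)"
      by (rule orth[OF that])
    have i2: "indep_var borel (\<lambda>w. (\<epsilon> t w)\<^sup>2) borel (\<lambda>w. (z t w $ j)\<^sup>2)"
      using indep_var_compose[OF i1, of "\<lambda>u. u\<^sup>2" borel "\<lambda>u. u\<^sup>2" borel] by (simp add: comp_def)
    show "integrable M (\<lambda>w. (Y j t w)\<^sup>2)"
      unfolding Y_def power_mult_distrib by (rule indep_var_integrable[OF i2 \<epsilon>2[OF that] z(1)[OF that]])
    show "expectation (Y j t) = 0"
      unfolding Y_def using indep_var_lebesgue_integral[OF i1 \<epsilon>1[OF that] z1] E1[OF that] by simp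
    have "expectation (\<lambda>w. (Y j t w)\<^sup>2) = \<sigma>\<^sup>2 * expectation (\<lambda>w. (z t w $ j)\<^sup>2)"
      unfolding Y_def power_mult_distrib
      using indep_var_lebesgue_integral[OF i2 \<epsilon>2[OF that] z(1)[OF that]] E2[OF that] by simp
    also have "\<dots> \<le> \<sigma>\<^sup>2 * C0" by (intro mult_left_mono z(2)[OF that]) simp
    finally show "expectation (\<lambda>w. (Y j t w)\<^sup>2) \<le> \<sigma>\<^sup>2 * C0" .
  qed
  define BX where "BX = {w \<in> space M. \<eta> * n \<le> \<bar>\<Sum>t\<in>f. X t w\<bar>}"
  define BY where "BY j = {w \<in> space M. \<eta> / d * n \<le> \<bar>\<Sum>t\<in>f. Y j t w\<bar>}" for j
  have Xm: "X t \<in> borel_measurable M" "Y j t \<in> borel_measurable M" if "t \<in> f" for t j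
    using that indX indY[of j] by (auto simp: indep_vars_def)
  have Bm: "BX \<in> events" "BY j \<in> events" for j
  proof -
    have "(\<lambda>w. \<Sum>t\<in>f. X t w) \<in> borel_measurable M" "(\<lambda>w. \<Sum>t\<in>f. Y j t w) \<in> borel_measurable M"
      using Xm by (auto intro!: borel_measurable_sum)
    then show "BX \<in> events" "BY j \<in> events" unfolding BX_def BY_def by measurable
  qed
  have pX: "prob BX \<le> 3 * \<sigma> ^ 4 / (\<eta>\<^sup>2 * n)"
  proof -
    have "prob BX \<le> n * (3 * \<sigma> ^ 4) / (\<eta> * n)\<^sup>2"
      unfolding BX_def n_def using n \<eta>
      by (intro centred_sum_tail[OF f(1) indX X2]) (auto simp: n_def)
    then show ?thesis using n \<eta> by (simp add: power2_eq_square mult_ac)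
  qed
  have pY: "prob (BY j) \<le> d\<^sup>2 * \<sigma>\<^sup>2 * C0 / (\<eta>\<^sup>2 * n)" for j
  proof -
    have "prob (BY j) \<le> n * (\<sigma>\<^sup>2 * C0) / (\<eta> / d * n)\<^sup>2"
      unfolding BY_def n_def using n \<eta> d
      by (intro centred_sum_tail[OF f(1) indY Y2]) (auto simp: n_def)
    then show ?thesis using n \<eta> d by (simp add: power2_eq_square mult_ac)
  qed
  define B where "B = BX \<union> (\<Union>j\<in>UNIV. BY j)"
  have B: "B \<in> events" unfolding B_def using Bm by (intro sets.Un sets.finite_UN) auto
  have "prob B \<le> prob BX + prob (\<Union>j\<in>UNIV. BY j)"
    unfolding B_def using Bm by (intro measure_Un_le sets.finite_UN) auto
  also have "\<dots> \<le> 3 * \<sigma> ^ 4 / (\<eta>\<^sup>2 * n) + (\<Sum>j\<in>(UNIV :: 'd set). d\<^sup>2 * \<sigma>\<^sup>2 * C0 / (\<eta>\<^sup>2 * n))"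
    using Bm pX pY
    by (intro add_mono order_trans[OF finite_measure_subadditive_finite sum_mono]) auto
  also have "\<dots> = (3 * \<sigma> ^ 4 + d ^ 3 * \<sigma>\<^sup>2 * C0) / (\<eta>\<^sup>2 * n)"
    by (simp add: d_def add_divide_distrib power2_eq_square power3_eq_cube mult_ac)
  finally have PB: "prob B \<le> (3 * \<sigma> ^ 4 + d ^ 3 * \<sigma>\<^sup>2 * C0) / (\<eta>\<^sup>2 * n)" .
  have "errors_within \<eta> (\<sigma>\<^sup>2) (\<lambda>t. \<epsilon> t w) (\<lambda>t. z t w) f" if w: "w \<in> space M - B" for w
    unfolding errors_within_def
  proof
    have "\<bar>\<Sum>t\<in>f. X t w\<bar> \<le> \<eta> * n" using w by (auto simp: B_def BX_def)
    moreover have "(\<Sum>t\<in>f. X t w) = n * (emp_mean f (\<lambda>t. (\<epsilon> t w)\<^sup>2) - \<sigma>\<^sup>2)"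
      using n by (simp add: X_def sum_subtractf emp_mean_def n_def right_diff_distrib)
    ultimately have "n * \<bar>emp_mean f (\<lambda>t. (\<epsilon> t w)\<^sup>2) - \<sigma>\<^sup>2\<bar> \<le> n * \<eta>" using n by (simp add: abs_mult mult.commute)
    then show "\<bar>emp_mean f (\<lambda>t. (\<epsilon> t w)\<^sup>2) - \<sigma>\<^sup>2\<bar> \<le> \<eta>" using n by simp
    show "norm (emp_mean f (\<lambda>t. \<epsilon> t w *\<^sub>R z t w)) \<le> \<eta>"
    proof (rule norm_le_of_coordinates)
      fix j
      have "w \<notin> BY j" using w by (auto simp: B_def)
      then have "\<bar>\<Sum>t\<in>f. Y j t w\<bar> \<le> \<eta> / d * n" using w by (auto simp: BY_def)
      moreover have "(\<Sum>t\<in>f. Y j t w) = n * (emp_mean f (\<lambda>t. \<epsilon> t w *\<^sub>R z t w) $ j)"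
        using n by (simp add: Y_def emp_mean_def n_def sum_component)
      ultimately have "n * \<bar>emp_mean f (\<lambda>t. \<epsilon> t w *\<^sub>R z t w) $ j\<bar> \<le> n * (\<eta> / d)" using n by (simp add: abs_mult mult.commute)
      then show "\<bar>emp_mean f (\<lambda>t. \<epsilon> t w *\<^sub>R z t w) $ j\<bar> \<le> \<eta> / real CARD('d)"
        unfolding d_def using n by (subst (asm) mult_le_cancel_left_pos) auto
    qed
  qed
  with B PB show ?thesis unfolding n_def d_def by blast
qed

lemma std_normal_vector_coordinates:
  assumes "I \<subseteq> {1..n}" "I \<noteq> {}"
  shows "prob_space.indep_vars (std_normal_vector n) (\<lambda>_. borel) (\<lambda>t e. e t) I"
    and "t \<in> {1..n} \<Longrightarrow> g \<in> borel_measurable borel \<Longrightarrow>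
      (\<integral>\<^sup>+e. g (e t) \<partial>std_normal_vector n) = (\<integral>\<^sup>+u. g u \<partial>std_normal_distribution)"
proof -
  interpret prob_space "std_normal_vector n" by (rule prob_space_std_normal_vector)
  have ps: "prob_space std_normal_distribution" by (rule prob_space_normal_density) simp
  have "prob_space.indep_vars (std_normal_vector n) (\<lambda>_. std_normal_distribution) (\<lambda>t e. e t) {1..n}"
    unfolding std_normal_vector_def by (rule indep_vars_PiM_coordinates) (use ps assms in auto)
  then have "indep_vars (\<lambda>_. std_normal_distribution) (\<lambda>t e. e t) I"
    using assms(1) by (rule indep_vars_subset)
  then show "indep_vars (\<lambda>_. borel) (\<lambda>t e. e t) I"
    by (rule indep_vars_compose2[where Y = "\<lambda>_ u. u"]) simp
  show "(\<integral>\<^sup>+e. g (e t) \<partial>std_normal_vector n) = (\<integral>\<^sup>+u. g u \<partial>std_normal_distribution)"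
    if t: "t \<in> {1..n}" and g[measurable]: "g \<in> borel_measurable borel"
  proof -
    have "(\<integral>\<^sup>+u. g u \<partial>std_normal_distribution)
        = (\<integral>\<^sup>+u. g u \<partial>distr (PiM {1..n} (\<lambda>_. std_normal_distribution)) std_normal_distribution (\<lambda>e. e t))"
      by (subst distr_PiM_component) (use ps t in auto)
    also have "\<dots> = (\<integral>\<^sup>+e. g (e t) \<partial>std_normal_vector n)"
      unfolding std_normal_vector_def using t by (subst nn_integral_distr) auto
    finally show ?thesis by simp
  qed
qed

text \<open>
For a fixed design, the mean squared error is a mean of squares of standard normal variables
and every coordinate of the mean of error times row is a linear form in them. Both have
Gaussian tails at scale eta \<le> 1, by the Chernoff bound with both signs.
\<close>

lemma null_concentration:
  fixes x :: "nat \<Rightarrow> real ^ 'd::finite"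
  assumes e: "e \<subseteq> {1..n}" "e \<noteq> {}" and \<eta>: "0 < \<eta>" "\<eta> \<le> 1" and K: "0 < K" and wc: "well_conditioned c K x e"
  defines "\<kappa> \<equiv> min (1 / 16) (1 / (2 * K * (real CARD('d))\<^sup>2))"
  shows "\<exists>B\<in>sets (std_normal_vector n).
     measure (std_normal_vector n) B \<le> 2 * (1 + real CARD('d)) * exp (- \<kappa> * (\<eta>\<^sup>2 * real (card e)))
     \<and> (\<forall>\<epsilon>\<in>space (std_normal_vector n) - B. errors_within \<eta> 1 \<epsilon> (\<lambda>t. restr S (x t)) e)"
proof -
  let ?\<nu> = "std_normal_vector n"
  interpret prob_space ?\<nu> by (rule prob_space_std_normal_vector)
  have fin: "finite e" using e(1) by (rule finite_subset) simp
  define N where "N = real (card e)"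
  define d where "d = real CARD('d)"
  have N: "0 < N" using e fin by (simp add: N_def card_gt_0_iff)
  have d: "0 < d" by (simp add: d_def)
  note ind = std_normal_vector_coordinates(1)[OF e]
  note int = std_normal_vector_coordinates(2)[OF e]
  have te: "t \<in> {1..n}" if "t \<in> e" for t using that e by auto
  have square: "prob {\<epsilon> \<in> space ?\<nu>. (\<eta> / 8) * (\<eta> * N) \<le> (\<Sum>t\<in>e. sg * (\<eta> / 8) * ((\<epsilon> t)\<^sup>2 - 1))} \<le> exp (- \<kappa> * (\<eta>\<^sup>2 * N))"
    if sg: "sg = 1 \<or> sg = -1" for sg :: real
  proof -
    let ?\<theta> = "sg * (\<eta> / 8)"
    have \<theta>: "\<bar>?\<theta>\<bar> \<le> 1 / 4" "?\<theta>\<^sup>2 = \<eta>\<^sup>2 / 64" using sg \<eta> by (auto simp: power_divide)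
    have "prob {\<epsilon> \<in> space ?\<nu>. (\<eta> / 8) * (\<eta> * N) \<le> (\<Sum>t\<in>e. ?\<theta> * ((\<epsilon> t)\<^sup>2 - 1))} \<le> exp ((\<Sum>t\<in>e. \<eta>\<^sup>2 / 16) - (\<eta> / 8) * (\<eta> * N))"
    proof (rule chernoff_bound[OF fin])
      show "indep_vars (\<lambda>_. borel) (\<lambda>t \<epsilon>. ?\<theta> * ((\<epsilon> t)\<^sup>2 - 1)) e"
        by (rule indep_vars_compose2[OF ind, where Y = "\<lambda>_ u. ?\<theta> * (u\<^sup>2 - 1)"]) measurable
      fix t assume t: "t \<in> e"
      have "(\<integral>\<^sup>+\<epsilon>. ennreal (exp (?\<theta> * ((\<epsilon> t)\<^sup>2 - 1))) \<partial>?\<nu>) = (\<integral>\<^sup>+u. ennreal (exp (?\<theta> * (u\<^sup>2 - 1))) \<partial>std_normal_distribution)"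
        by (rule int[OF te[OF t]]) measurable
      also have "\<dots> = (\<integral>\<^sup>+u. ennreal (exp (- ?\<theta>)) * ennreal (exp (?\<theta> * u\<^sup>2)) \<partial>std_normal_distribution)"
      proof -
        have "?\<theta> * (u\<^sup>2 - 1) = - ?\<theta> + ?\<theta> * u\<^sup>2" for u :: real by (simp add: right_diff_distrib)
        then show ?thesis by (simp only: exp_add ennreal_mult exp_ge_zero)
      qed
      also have "\<dots> = ennreal (exp (- ?\<theta>)) * (\<integral>\<^sup>+u. ennreal (exp (?\<theta> * u\<^sup>2)) \<partial>std_normal_distribution)"
        by (rule nn_integral_cmult) measurable
      also have "\<dots> \<le> ennreal (exp (- ?\<theta>)) * ennreal (exp (?\<theta> + 4 * ?\<theta>\<^sup>2))"
        by (intro mult_left_mono std_normal_mgf_square_le \<theta>(1)) simp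
      also have "\<dots> = ennreal (exp (\<eta>\<^sup>2 / 16))"
        unfolding \<theta>(2) by (simp add: ennreal_mult[symmetric] exp_add[symmetric])
      finally show "(\<integral>\<^sup>+\<epsilon>. ennreal (exp (?\<theta> * ((\<epsilon> t)\<^sup>2 - 1))) \<partial>?\<nu>) \<le> ennreal (exp (\<eta>\<^sup>2 / 16))" .
    qed
    also have "(\<Sum>t\<in>e. \<eta>\<^sup>2 / 16) - (\<eta> / 8) * (\<eta> * N) = - (1 / 16) * (\<eta>\<^sup>2 * N)"
      by (simp add: N_def power2_eq_square)
    also have "exp \<dots> \<le> exp (- \<kappa> * (\<eta>\<^sup>2 * N))"
    proof -
      have "\<kappa> * (\<eta>\<^sup>2 * N) \<le> (1 / 16) * (\<eta>\<^sup>2 * N)" using N by (intro mult_right_mono) (auto simp: \<kappa>_def)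
      then show ?thesis by simp
    qed
    finally show ?thesis .
  qed
  have linear: "prob {\<epsilon> \<in> space ?\<nu>. (\<eta> / (d * K)) * (\<eta> / d * N) \<le> (\<Sum>t\<in>e. sg * (\<eta> / (d * K)) * restr S (x t) $ j * \<epsilon> t)} \<le> exp (- \<kappa> * (\<eta>\<^sup>2 * N))"
    if sg: "sg = 1 \<or> sg = -1" for sg :: real and j
  proof -
    let ?l = "\<eta> / (d * K)"
    let ?a = "\<lambda>t. sg * ?l * restr S (x t) $ j"
    have sumz: "(\<Sum>t\<in>e. (restr S (x t) $ j)\<^sup>2) \<le> K * N"
    proof -
      have "(\<Sum>t\<in>e. (restr S (x t) $ j)\<^sup>2) \<le> (\<Sum>t\<in>e. (x t \<bullet> axis j 1)\<^sup>2)"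
        by (intro sum_mono) (auto simp: restr_def inner_axis)
      also have "\<dots> = N * emp_mean e (\<lambda>t. (x t \<bullet> axis j 1)\<^sup>2)" using N by (simp add: emp_mean_def N_def)
      also have "\<dots> \<le> N * (K * (norm (axis j 1 :: real ^ 'd))\<^sup>2)"
        using wc N unfolding well_conditioned_def by (intro mult_left_mono) (blast, simp)
      finally show ?thesis by (simp add: norm_axis_1 mult.commute)
    qed
    have "prob {\<epsilon> \<in> space ?\<nu>. ?l * (\<eta> / d * N) \<le> (\<Sum>t\<in>e. ?a t * \<epsilon> t)} \<le> exp ((\<Sum>t\<in>e. (?a t)\<^sup>2 / 2) - ?l * (\<eta> / d * N))"
    proof (rule chernoff_bound[OF fin])
      show "indep_vars (\<lambda>_. borel) (\<lambda>t \<epsilon>. ?a t * \<epsilon> t) e"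
        by (rule indep_vars_compose2[OF ind, where Y = "\<lambda>t u. ?a t * u"]) measurable
      fix t assume t: "t \<in> e"
      have "(\<integral>\<^sup>+\<epsilon>. ennreal (exp (?a t * \<epsilon> t)) \<partial>?\<nu>) = (\<integral>\<^sup>+u. ennreal (exp (?a t * u)) \<partial>std_normal_distribution)"
        by (rule int[OF te[OF t]]) measurable
      then show "(\<integral>\<^sup>+\<epsilon>. ennreal (exp (?a t * \<epsilon> t)) \<partial>?\<nu>) \<le> ennreal (exp ((?a t)\<^sup>2 / 2))"
        unfolding std_normal_mgf_linear by (rule eq_refl)
    qed
    also have "\<dots> \<le> exp (- \<kappa> * (\<eta>\<^sup>2 * N))"
    proof -
      have "(\<Sum>t\<in>e. (?a t)\<^sup>2 / 2) = ?l\<^sup>2 / 2 * (\<Sum>t\<in>e. (restr S (x t) $ j)\<^sup>2)"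
      proof -
        have "sg\<^sup>2 = 1" using sg by auto
        then have "(?a t)\<^sup>2 / 2 = ?l\<^sup>2 / 2 * (restr S (x t) $ j)\<^sup>2" for t
          by (simp only: power_mult_distrib mult_1)
        then show ?thesis by (simp only: sum_distrib_left)
      qed
      also have "\<dots> \<le> ?l\<^sup>2 / 2 * (K * N)" by (intro mult_left_mono sumz) auto
      finally have "(\<Sum>t\<in>e. (?a t)\<^sup>2 / 2) - ?l * (\<eta> / d * N) \<le> ?l\<^sup>2 / 2 * (K * N) - ?l * (\<eta> / d * N)" by simp
      also have "\<dots> = - (1 / (2 * K * d\<^sup>2)) * (\<eta>\<^sup>2 * N)"
        using K d by (simp add: power2_eq_square field_simps)
      also have "\<dots> \<le> - \<kappa> * (\<eta>\<^sup>2 * N)"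
        using N by (intro mult_right_mono) (auto simp: \<kappa>_def d_def)
      finally show ?thesis by simp
    qed
    finally show ?thesis .
  qed
  define A where "A sg = {\<epsilon> \<in> space ?\<nu>. (\<eta> / 8) * (\<eta> * N) \<le> (\<Sum>t\<in>e. sg * (\<eta> / 8) * ((\<epsilon> t)\<^sup>2 - 1))}" for sg :: real
  define Z where "Z js = {\<epsilon> \<in> space ?\<nu>. (\<eta> / (d * K)) * (\<eta> / d * N) \<le> (\<Sum>t\<in>e. snd js * (\<eta> / (d * K)) * restr S (x t) $ fst js * \<epsilon> t)}" for js :: "'d \<times> real"
  let ?s = "{1, -1 :: real}"
  have coord[measurable]: "(\<lambda>\<epsilon>. \<epsilon> t) \<in> borel_measurable ?\<nu>" if "t \<in> e" for t
    using ind that by (simp add: indep_vars_def)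
  have Am: "A sg \<in> events" for sg unfolding A_def by measurable
  have Zm: "Z js \<in> events" for js unfolding Z_def by measurable
  define B where "B = (\<Union>sg\<in>?s. A sg) \<union> (\<Union>js\<in>UNIV \<times> ?s. Z js)"
  have B: "B \<in> events" unfolding B_def using Am Zm by (intro sets.Un sets.finite_UN) auto
  have "prob B \<le> prob (\<Union>sg\<in>?s. A sg) + prob (\<Union>js\<in>UNIV \<times> ?s. Z js)"
    unfolding B_def using Am Zm by (intro measure_Un_le sets.finite_UN) auto
  also have "\<dots> \<le> (\<Sum>sg\<in>?s. prob (A sg)) + (\<Sum>js\<in>UNIV \<times> ?s. prob (Z js))"
    using Am Zm by (intro add_mono finite_measure_subadditive_finite) auto
  also have "\<dots> \<le> (\<Sum>sg\<in>?s. exp (- \<kappa> * (\<eta>\<^sup>2 * N))) + (\<Sum>js\<in>(UNIV :: 'd set) \<times> ?s. exp (- \<kappa> * (\<eta>\<^sup>2 * N)))"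
  proof (intro add_mono sum_mono)
    fix sg assume "sg \<in> ?s"
    then show "prob (A sg) \<le> exp (- \<kappa> * (\<eta>\<^sup>2 * N))" unfolding A_def by (intro square) auto
  next
    fix js assume "js \<in> (UNIV :: 'd set) \<times> ?s"
    then show "prob (Z js) \<le> exp (- \<kappa> * (\<eta>\<^sup>2 * N))" unfolding Z_def by (intro linear) auto
  qed
  also have "\<dots> = 2 * (1 + d) * exp (- \<kappa> * (\<eta>\<^sup>2 * N))"
    by (simp add: d_def card_cartesian_product algebra_simps)
  finally have PB: "prob B \<le> 2 * (1 + d) * exp (- \<kappa> * (\<eta>\<^sup>2 * N))" .
  have "errors_within \<eta> 1 \<epsilon> (\<lambda>t. restr S (x t)) e" if \<epsilon>: "\<epsilon> \<in> space ?\<nu> - B" for \<epsilon>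
    unfolding errors_within_def
  proof
    have "sg * (emp_mean e (\<lambda>t. (\<epsilon> t)\<^sup>2) - 1) \<le> \<eta>" if sg: "sg \<in> ?s" for sg
    proof -
      have "\<epsilon> \<notin> A sg" using \<epsilon> sg by (auto simp: B_def)
      then have "(\<Sum>t\<in>e. sg * (\<eta> / 8) * ((\<epsilon> t)\<^sup>2 - 1)) \<le> (\<eta> / 8) * (\<eta> * N)" using \<epsilon> by (auto simp: A_def)
      moreover have "(\<Sum>t\<in>e. sg * (\<eta> / 8) * ((\<epsilon> t)\<^sup>2 - 1)) = (\<eta> / 8 * N) * (sg * (emp_mean e (\<lambda>t. (\<epsilon> t)\<^sup>2) - 1))"
      proof -
        have "(\<Sum>t\<in>e. (\<epsilon> t)\<^sup>2 - 1) = N * (emp_mean e (\<lambda>t. (\<epsilon> t)\<^sup>2) - 1)"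
          using N by (simp add: sum_subtractf emp_mean_def N_def right_diff_distrib)
        then show ?thesis by (simp only: sum_distrib_left[symmetric] mult_ac)
      qed
      ultimately have "(\<eta> / 8 * N) * (sg * (emp_mean e (\<lambda>t. (\<epsilon> t)\<^sup>2) - 1)) \<le> (\<eta> / 8 * N) * \<eta>"
        by (simp only: mult_ac)
      then show ?thesis using N \<eta> by (subst (asm) mult_le_cancel_left_pos) auto
    qed
    from this[of 1] this[of "-1"] show "\<bar>emp_mean e (\<lambda>t. (\<epsilon> t)\<^sup>2) - 1\<bar> \<le> \<eta>" by (simp add: abs_le_iff)
    show "norm (emp_mean e (\<lambda>t. \<epsilon> t *\<^sub>R restr S (x t))) \<le> \<eta>"
    proof (rule norm_le_of_coordinates)
      fix j
      let ?z = "emp_mean e (\<lambda>t. \<epsilon> t *\<^sub>R restr S (x t)) $ j"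
      have "sg * ?z \<le> \<eta> / d" if sg: "sg \<in> ?s" for sg
      proof -
        have "\<epsilon> \<notin> Z (j, sg)" using \<epsilon> sg by (auto simp: B_def)
        then have "(\<Sum>t\<in>e. sg * (\<eta> / (d * K)) * restr S (x t) $ j * \<epsilon> t) \<le> (\<eta> / (d * K)) * (\<eta> / d * N)"
          using \<epsilon> by (auto simp: Z_def)
        moreover have "(\<Sum>t\<in>e. sg * (\<eta> / (d * K)) * restr S (x t) $ j * \<epsilon> t) = (\<eta> / (d * K) * N) * (sg * ?z)"
        proof -
          have Nz: "N * ?z = (\<Sum>t\<in>e. \<epsilon> t * restr S (x t) $ j)" using N by (simp add: emp_mean_def N_def sum_component)
          have "(\<eta> / (d * K) * N) * (sg * ?z) = \<eta> / (d * K) * sg * (N * ?z)"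
            by (simp only: mult_ac)
          also have "\<dots> = \<eta> / (d * K) * sg * (\<Sum>t\<in>e. \<epsilon> t * restr S (x t) $ j)"
            by (simp only: Nz)
          also have "\<dots> = (\<Sum>t\<in>e. sg * (\<eta> / (d * K)) * restr S (x t) $ j * \<epsilon> t)"
            by (simp add: sum_distrib_left mult_ac)
          finally show ?thesis by simp
        qed
        ultimately have "(\<eta> / (d * K) * N) * (sg * ?z) \<le> (\<eta> / (d * K) * N) * (\<eta> / d)"
          by (simp only: mult_ac)
        then show ?thesis using N \<eta> d K by (subst (asm) mult_le_cancel_left_pos) auto
      qed
      from this[of 1] this[of "-1"] show "\<bar>?z\<bar> \<le> \<eta> / real CARD('d)" by (simp add: abs_le_iff d_def)
    qed
  qed
  with B PB show ?thesis unfolding N_def d_def by blast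
qed

section \<open>Segments and their regression parameters\<close>

lemma boundaries_mono:
  assumes "change_points n cp" "i \<le> j" "j \<le> length cp + 1"
  shows "(0 # cp @ [n]) ! i \<le> (0 # cp @ [n]) ! j"
proof (rule sorted_nth_mono)
  have "sorted cp" using assms(1) by (simp add: change_points_def strict_sorted_imp_sorted)
  moreover have "\<forall>t\<in>set cp. t \<le> n"
  proof
    fix t assume "t \<in> set cp"
    then have "t \<in> {1..n - 1}" using assms(1) by (auto simp: change_points_def)
    then show "t \<le> n" by auto
  qed
  ultimately show "sorted (0 # cp @ [n])" by (simp add: sorted_append)
qed (use assms in auto)

lemma segments_cover:
  assumes "change_points n cp"
  shows "{1..n} \<subseteq> (\<Union>i\<in>{1..length cp + 1}. segment n cp i)"
proof
  fix t assume t: "t \<in> {1..n}"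
  let ?b = "0 # cp @ [n]"
  define i where "i = (LEAST i. t \<le> ?b ! i)"
  have "t \<le> ?b ! (length cp + 1)" using t by (simp add: nth_append)
  then have i: "t \<le> ?b ! i" "i \<le> length cp + 1" unfolding i_def by (rule LeastI, rule Least_le)
  have "i \<noteq> 0" using i(1) t by (auto intro: ccontr)
  then have "\<not> t \<le> ?b ! (i - 1)" unfolding i_def by (intro not_less_Least) auto
  with i have "t \<in> segment n cp i" by (simp add: segment_def)
  then show "t \<in> (\<Union>i\<in>{1..length cp + 1}. segment n cp i)" using i(2) \<open>i \<noteq> 0\<close> by auto
qed

lemma segments_disjoint:
  assumes "change_points n cp" "i \<in> {1..length cp + 1}" "j \<in> {1..length cp + 1}"
    and "t \<in> segment n cp i" "t \<in> segment n cp j"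
  shows "i = j"
proof -
  have "False" if ij: "i < j" "i \<in> {1..length cp + 1}" "j \<in> {1..length cp + 1}" "t \<in> segment n cp i" "t \<in> segment n cp j" for i j
  proof -
    have "(0 # cp @ [n]) ! i \<le> (0 # cp @ [n]) ! (j - 1)"
      using ij assms(1) by (intro boundaries_mono) auto
    then show False using ij(4,5) unfolding segment_def by simp
  qed
  then show ?thesis using assms by (metis nat_neq_iff)
qed

text \<open>
Segments are disjoint, so a nonempty f lies in only one of them and the definite descriptions
pick the unique parameters of that segment.
\<close>

lemma regression_parameters_on_subset:
  assumes cp: "change_points n cp" and uniq: "\<forall>e\<in>segments n cp. \<exists>!(b, s). regression_on P S e b s"
    and i: "i \<in> {1..length cp + 1}" and f: "f \<noteq> {}" "f \<subseteq> segment n cp i"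
  shows "reg_coef n cp P S f = reg_coef n cp P S (segment n cp i)"
    and "reg_sd n cp P S f = reg_sd n cp P S (segment n cp i)"
    and "regression_on P S (segment n cp i) (reg_coef n cp P S f) (reg_sd n cp P S f)"
proof -
  let ?e = "segment n cp i"
  have e: "?e \<in> segments n cp" using i by (auto simp: segments_def)
  have "\<exists>!x. (case x of (b, s) \<Rightarrow> regression_on P S ?e b s)" using uniq e by simp
  then obtain x where x: "case x of (b, s) \<Rightarrow> regression_on P S ?e b s"
    "\<forall>y. (case y of (b, s) \<Rightarrow> regression_on P S ?e b s) \<longrightarrow> y = x"
    by (elim ex1E) blast
  obtain b s where xbs: "x = (b, s)" by (cases x)
  have bs: "regression_on P S ?e b s" using x(1) unfolding xbs by (simp only: prod.case)
  have un: "b' = b \<and> s' = s" if "regression_on P S ?e b' s'" for b' s'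
  proof -
    have "(b', s') = x" by (rule x(2)[rule_format]) (simp only: prod.case that)
    then show ?thesis by (simp add: xbs)
  qed
  have only: "e' = ?e" if e': "e' \<in> segments n cp" "g \<subseteq> e'" and g: "g \<noteq> {}" "g \<subseteq> ?e" for e' g
  proof -
    obtain j where j: "j \<in> {1..length cp + 1}" "e' = segment n cp j"
      using e'(1) unfolding segments_def by (rule imageE)
    obtain t where "t \<in> g" using g(1) by blast
    then have "t \<in> segment n cp i" "t \<in> segment n cp j" using e'(2) g(2) j(2) by auto
    then have "i = j" by (rule segments_disjoint[OF cp i j(1)])
    then show ?thesis using j(2) by simp
  qed
  have val: "reg_coef n cp P S g = b \<and> reg_sd n cp P S g = s" if g: "g \<noteq> {}" "g \<subseteq> ?e" for g
  proof
    have un': "b' = b \<and> s' = s" if "e' \<in> segments n cp" "g \<subseteq> e'" "regression_on P S e' b' s'" for e' b' s'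
      using only[OF that(1,2) g] un that(3) by blast
    show "reg_coef n cp P S g = b" unfolding reg_coef_def
    proof (rule the_equality)
      show "\<exists>e\<in>segments n cp. g \<subseteq> e \<and> (\<exists>s. regression_on P S e b s)" using bs e g(2) by blast
    qed (use un' in blast)
    show "reg_sd n cp P S g = s" unfolding reg_sd_def
    proof (rule the_equality)
      show "\<exists>e\<in>segments n cp. g \<subseteq> e \<and> (\<exists>b. regression_on P S e b s)" using bs e g(2) by blast
    qed (use un' in blast)
  qed
  have "?e \<noteq> {}" using f by auto
  then show "reg_coef n cp P S f = reg_coef n cp P S ?e" "reg_sd n cp P S f = reg_sd n cp P S ?e"
    "regression_on P S ?e (reg_coef n cp P S f) (reg_sd n cp P S f)"
    using val[OF f] val[of ?e] bs by auto
qed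

section \<open>The rejection probability for fixed n\<close>

lemma finite_F1: "\<E> \<subseteq> Pow {1..n} \<Longrightarrow> finite (F1 \<E>)"
  by (rule finite_subset[of _ "Pow {1..n} \<times> Pow {1..n}"]) (auto simp: F1_def)

text \<open>
All events combined: outside B, Be and Bf the observed statistic exceeds the gap on the
right-hand side of the hypothesis on 4 q eta, while a resampled statistic exceeds 4 q eta with
conditional probability below alpha.
\<close>

lemma rejection_prob_lower_bound:
  fixes P :: "(nat \<Rightarrow> real \<times> (real ^ 'd::finite)) measure" and S :: "'d set" and c K \<eta> D r :: real
  defines "q \<equiv> 1 + 2 / c + K / c\<^sup>2" and "\<kappa> \<equiv> min (1 / 16) (1 / (2 * K * (real CARD('d))\<^sup>2))"
  assumes law: "data_law n P" and \<alpha>: "0 < \<alpha>" "\<alpha> < 1"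
    and \<E>: "\<E> \<subseteq> Pow {1..n}" "{} \<notin> \<E>" and ef: "e \<in> \<E>" "f \<in> \<E>" "e \<inter> f = {}"
    and c: "0 < c" and K: "0 < K" and \<eta>: "0 < \<eta>" "\<eta> \<le> 1" "q * \<eta> \<le> 1 / 2" "(1 + 1 / c) * \<eta> < vf"
    and \<beta>: "restr S \<beta>e = \<beta>e" "restr S \<beta>f = \<beta>f" "norm (\<beta>e - \<beta>f) \<le> D"
    and gain: "4 * (q * \<eta>) < (ve - vf + c / 2 * (norm (\<beta>e - \<beta>f))\<^sup>2 - (2 + 2 * D + 3 / c) * \<eta>) / (vf + 1)"
    and design: "B \<in> sets P" "\<And>w g. w \<in> space P - B \<Longrightarrow> g \<in> \<E> \<Longrightarrow> well_conditioned c K (\<lambda>t. snd (w t)) g"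
    and err_e: "Be \<in> sets P" "\<And>w. w \<in> space P - Be \<Longrightarrow>
        errors_within \<eta> ve (\<lambda>t. fst (w t) - restr S (snd (w t)) \<bullet> \<beta>e) (\<lambda>t. restr S (snd (w t))) e"
    and err_f: "Bf \<in> sets P" "\<And>w. w \<in> space P - Bf \<Longrightarrow>
        errors_within \<eta> vf (\<lambda>t. fst (w t) - restr S (snd (w t)) \<bullet> \<beta>f) (\<lambda>t. restr S (snd (w t))) f"
    and size: "\<And>g. g \<in> \<E> \<Longrightarrow> r \<le> real (card g)"
    and small: "2 * (1 + real CARD('d)) * (real (card \<E>) * exp (- \<kappa> * \<eta>\<^sup>2 * r)) < \<alpha>"
  shows "\<exists>p. (\<lambda>B. rejection_prob (T3_max S \<E>) n S \<alpha> B P) \<longlonglongrightarrow> p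
     \<and> 1 - (measure P B + measure P Be + measure P Bf) \<le> p \<and> p \<le> 1"
proof -
  interpret P: prob_space P using law by (simp add: data_law_def)
  let ?\<nu> = "std_normal_vector n"
  interpret \<nu>: prob_space ?\<nu> by (rule prob_space_std_normal_vector)
  let ?x = "\<lambda>w :: nat \<Rightarrow> real \<times> (real ^ 'd). (\<lambda>t. snd (w t))" and ?y = "\<lambda>w :: nat \<Rightarrow> real \<times> (real ^ 'd). (\<lambda>t. fst (w t))"
  let ?T = "\<lambda>w \<epsilon>. T3_max S \<E> (?x w) (scaled_resid n S (?x w) \<epsilon>)"
  have setsP: "sets P = sets (Pi\<^sub>M {1..n} (\<lambda>_. borel))" using law by (simp add: data_law_def)
  have coord: "(\<lambda>w. w t) \<in> borel_measurable P" if "t \<in> {1..n}" for t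
    using measurable_component_singleton[OF that, of "\<lambda>_. borel"] by (simp add: measurable_cong_sets[OF setsP refl])
  have xm: "(\<lambda>w. snd (w t)) \<in> borel_measurable P" and ym: "(\<lambda>w. fst (w t)) \<in> borel_measurable P" if "t \<in> {1..n}" for t
    using coord[OF that] by (auto intro: measurable_compose[where N = borel] simp: borel_prod[symmetric])
  have em: "(\<lambda>\<epsilon>. \<epsilon> t) \<in> borel_measurable ?\<nu>" if "t \<in> {1..n}" for t
    using measurable_component_singleton[OF that, of "\<lambda>_. borel"] by (simp add: measurable_cong_sets[OF sets_std_normal_vector refl])
  have obs_m: "(\<lambda>w. ?T w (?y w)) \<in> borel_measurable P"
    by (rule borel_measurable_T3_max[OF \<E>(1)]) (fact xm ym)+
  have null_m: "(\<lambda>z. ?T (fst z) (snd z)) \<in> borel_measurable (P \<Otimes>\<^sub>M ?\<nu>)"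
    by (rule borel_measurable_T3_max[OF \<E>(1)])
      (use xm em in \<open>auto intro: measurable_compose[OF measurable_fst] measurable_compose[OF measurable_snd]\<close>)
  have finE: "finite \<E>" using \<E>(1) by (rule finite_subset) simp
  have gE: "g \<subseteq> {1..n}" "g \<noteq> {}" "card g \<noteq> 0" if "g \<in> \<E>" for g
  proof -
    show "g \<subseteq> {1..n}" "g \<noteq> {}" using that \<E> by auto
    then show "card g \<noteq> 0" by (metis card_0_eq finite_atLeastAtMost finite_subset)
  qed
  have F1: "finite (F1 \<E>)" "(e, f) \<in> F1 \<E>" "(f, e) \<in> F1 \<E>"
    using finite_F1[OF \<E>(1)] ef by (auto simp: F1_def)
  define gap where "gap = (ve - vf + c / 2 * (norm (\<beta>e - \<beta>f))\<^sup>2 - (2 + 2 * D + 3 / c) * \<eta>) / (vf + 1)"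
  have vf: "0 < vf + 1"
  proof -
    have "0 \<le> (1 + 1 / c) * \<eta>" using c \<eta>(1) by simp
    then show ?thesis using \<eta>(4) by linarith
  qed
  have q0: "0 \<le> q" using c K by (simp add: q_def)
  define G where "G = space P - (B \<union> Be \<union> Bf)"
  have G: "G \<in> sets P" unfolding G_def using design(1) err_e(1) err_f(1) by auto
  have obs: "gap \<le> \<bar>?T w (?y w)\<bar>" if w: "w \<in> G" for w
  proof -
    have wc: "well_conditioned c K (?x w) e" "well_conditioned c K (?x w) f"
      using w design(2) ef by (auto simp: G_def)
    have gap0: "0 \<le> ve - vf + c / 2 * (norm (\<beta>e - \<beta>f))\<^sup>2 - (2 + 2 * D + 3 / c) * \<eta>"
    proof -
      have "0 < gap" using gain q0 \<eta>(1) unfolding gap_def[symmetric] by (smt (verit) mult_nonneg_nonneg)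
      then show ?thesis using vf by (simp add: gap_def zero_less_divide_iff)
    qed
    have we: "w \<in> space P - Be" and wf: "w \<in> space P - Bf" using w by (auto simp: G_def)
    note E = err_e(2)[OF we] and F = err_f(2)[OF wf]
    note AB = T3_alternative_bound[OF c wc gE(3)[OF ef(1)] _ _ \<beta>(1) \<beta>(2) E F
        \<eta>(2) \<eta>(4) \<beta>(3) gap0, where y = "?y w"]
    have pos: "0 < s_hat_sq S (?x w) (?y w) f" by (rule AB(1)) simp_all
    have T: "gap \<le> T3 S e f (?x w) (?y w)" unfolding gap_def by (rule AB(2)) simp_all
    have "T3 S e f (?x w) (?y w) = T3 S e f (?x w) (scaled_resid n S (?x w) (?y w))"
      by (rule T3_scaled_resid[symmetric, OF gE(1)[OF ef(2)] well_conditioned_regular[OF c wc(2)] pos])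
    also have "\<dots> \<le> \<bar>T3 S e f (?x w) (scaled_resid n S (?x w) (?y w))\<bar>" by simp
    also have "\<dots> \<le> ?T w (?y w)"
      unfolding T3_max_def using F1 by (intro Max_ge) (auto intro!: image_eqI[where x = "(e, f)"])
    finally show ?thesis using T by linarith
  qed
  have power: "1 - \<alpha> < \<nu>.prob {\<epsilon> \<in> space ?\<nu>. \<bar>?T w \<epsilon>\<bar> < \<bar>?T w (?y w)\<bar>}" if w: "w \<in> G" for w
  proof -
    have wcw: "well_conditioned c K (?x w) g" if "g \<in> \<E>" for g using w design(2) that by (auto simp: G_def)
    have "\<forall>g\<in>\<E>. \<exists>A. A \<in> sets ?\<nu> \<and> \<nu>.prob A \<le> 2 * (1 + real CARD('d)) * exp (- \<kappa> * (\<eta>\<^sup>2 * real (card g)))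
     \<and> (\<forall>\<epsilon>\<in>space ?\<nu> - A. errors_within \<eta> 1 \<epsilon> (\<lambda>t. restr S (?x w t)) g)"
      unfolding \<kappa>_def using null_concentration[OF gE(1,2) \<eta>(1,2) K wcw] by blast
    from bchoice[OF this] obtain A where "\<forall>g\<in>\<E>. A g \<in> sets ?\<nu> \<and> \<nu>.prob (A g) \<le> 2 * (1 + real CARD('d)) * exp (- \<kappa> * (\<eta>\<^sup>2 * real (card g)))
     \<and> (\<forall>\<epsilon>\<in>space ?\<nu> - A g. errors_within \<eta> 1 \<epsilon> (\<lambda>t. restr S (?x w t)) g)"
      by blast
    then have A: "\<And>g. g \<in> \<E> \<Longrightarrow> A g \<in> sets ?\<nu>"
      "\<And>g. g \<in> \<E> \<Longrightarrow> \<nu>.prob (A g) \<le> 2 * (1 + real CARD('d)) * exp (- \<kappa> * (\<eta>\<^sup>2 * real (card g)))"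
      "\<And>g \<epsilon>. g \<in> \<E> \<Longrightarrow> \<epsilon> \<in> space ?\<nu> - A g \<Longrightarrow> errors_within \<eta> 1 \<epsilon> (\<lambda>t. restr S (?x w t)) g"
      by blast+
    define U where "U = (\<Union>g\<in>\<E>. A g)"
    have U: "U \<in> sets ?\<nu>" unfolding U_def using A(1) finE by auto
    have \<kappa>0: "0 < \<kappa>" using K by (simp add: \<kappa>_def)
    have "\<nu>.prob U \<le> (\<Sum>g\<in>\<E>. \<nu>.prob (A g))"
      unfolding U_def using A(1) finE by (intro \<nu>.finite_measure_subadditive_finite) auto
    also have "\<dots> \<le> (\<Sum>g\<in>\<E>. 2 * (1 + real CARD('d)) * exp (- \<kappa> * \<eta>\<^sup>2 * r))"
    proof (rule sum_mono)
      fix g assume g: "g \<in> \<E>"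
      have "\<kappa> * \<eta>\<^sup>2 * r \<le> \<kappa> * \<eta>\<^sup>2 * real (card g)"
        using size[OF g] \<kappa>0 by (intro mult_left_mono) auto
      then have "exp (- \<kappa> * (\<eta>\<^sup>2 * real (card g))) \<le> exp (- \<kappa> * \<eta>\<^sup>2 * r)" by (simp add: mult.assoc)
      then have "2 * (1 + real CARD('d)) * exp (- \<kappa> * (\<eta>\<^sup>2 * real (card g))) \<le> 2 * (1 + real CARD('d)) * exp (- \<kappa> * \<eta>\<^sup>2 * r)"
        by (intro mult_left_mono) auto
      then show "\<nu>.prob (A g) \<le> 2 * (1 + real CARD('d)) * exp (- \<kappa> * \<eta>\<^sup>2 * r)" using A(2)[OF g] by linarith
    qed
    also have "\<dots> < \<alpha>" using small by (simp add: mult_ac)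
    finally have "1 - \<alpha> < \<nu>.prob (space ?\<nu> - U)" using \<nu>.prob_compl[OF U] by linarith
    also have "\<dots> \<le> \<nu>.prob {\<epsilon> \<in> space ?\<nu>. \<bar>?T w \<epsilon>\<bar> < \<bar>?T w (?y w)\<bar>}"
    proof (rule \<nu>.finite_measure_mono)
      have wP: "w \<in> space P" using w by (simp add: G_def)
      have "(\<lambda>\<epsilon>. ?T w \<epsilon>) \<in> borel_measurable ?\<nu>"
        using measurable_compose[OF measurable_Pair1'[OF wP] null_m] by simp
      then show "{\<epsilon> \<in> space ?\<nu>. \<bar>?T w \<epsilon>\<bar> < \<bar>?T w (?y w)\<bar>} \<in> \<nu>.events" by measurable
      show "space ?\<nu> - U \<subseteq> {\<epsilon> \<in> space ?\<nu>. \<bar>?T w \<epsilon>\<bar> < \<bar>?T w (?y w)\<bar>}"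
      proof
        fix \<epsilon> assume \<epsilon>: "\<epsilon> \<in> space ?\<nu> - U"
        then have \<epsilon>A: "\<epsilon> \<in> space ?\<nu> - A g" if "g \<in> \<E>" for g using that by (auto simp: U_def)
        have bound: "\<bar>T3 S g h (?x w) (scaled_resid n S (?x w) \<epsilon>)\<bar> \<le> 4 * (q * \<eta>)" if gh: "g \<in> \<E>" "h \<in> \<E>" for g h
        proof -
          note N = T3_null_bound[OF c less_imp_le[OF K] wcw[OF gh(1)] wcw[OF gh(2)] gE(3)[OF gh(1)],
              where \<epsilon> = \<epsilon> and \<eta> = \<eta> and S = S, folded q_def]
          note Ag = A(3)[OF gh(1) \<epsilon>A[OF gh(1)]] and Ah = A(3)[OF gh(2) \<epsilon>A[OF gh(2)]]
          have "0 < s_hat_sq S (?x w) \<epsilon> h" "\<bar>T3 S g h (?x w) \<epsilon>\<bar> \<le> 4 * (q * \<eta>)"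
            using N Ag Ah \<eta> by blast+
          then show ?thesis
            using T3_scaled_resid[OF gE(1)[OF gh(2)] well_conditioned_regular[OF c wcw[OF gh(2)]]] by simp
        qed
        let ?I = "(\<lambda>(g, h). \<bar>T3 S g h (?x w) (scaled_resid n S (?x w) \<epsilon>)\<bar>) ` F1 \<E>"
        have "?T w \<epsilon> \<in> ?I" unfolding T3_max_def using F1 by (intro Max_in) auto
        then obtain g h where "(g, h) \<in> F1 \<E>" "?T w \<epsilon> = \<bar>T3 S g h (?x w) (scaled_resid n S (?x w) \<epsilon>)\<bar>"
          by auto
        then have "\<bar>?T w \<epsilon>\<bar> \<le> 4 * (q * \<eta>)" using bound[of g h] by (simp add: F1_def)
        also have "\<dots> < gap" using gain by (simp add: gap_def)
        also have "\<dots> \<le> \<bar>?T w (?y w)\<bar>" by (rule obs[OF w])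
        finally show "\<epsilon> \<in> {\<epsilon> \<in> space ?\<nu>. \<bar>?T w \<epsilon>\<bar> < \<bar>?T w (?y w)\<bar>}" using \<epsilon> by simp
      qed
    qed
    finally show ?thesis .
  qed
  have null_m': "(\<lambda>(w, \<epsilon>). ?T w \<epsilon>) \<in> borel_measurable (P \<Otimes>\<^sub>M ?\<nu>)"
    using null_m by (simp add: case_prod_beta')
  obtain p where p: "(\<lambda>B. rejection_prob (T3_max S \<E>) n S \<alpha> B P) \<longlonglongrightarrow> p" "P.prob G \<le> p" "p \<le> 1"
    by (rule rejection_prob_limit[OF law \<alpha> null_m' obs_m G power])
  have "P.prob (B \<union> Be \<union> Bf) \<le> P.prob B + P.prob Be + P.prob Bf"
    using measure_Un_le[of "B \<union> Be" P Bf] measure_Un_le[of B P Be] design(1) err_e(1) err_f(1) by auto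
  moreover have "P.prob G = 1 - P.prob (B \<union> Be \<union> Bf)"
    unfolding G_def using design(1) err_e(1) err_f(1) by (intro P.prob_compl) auto
  ultimately have "1 - (P.prob B + P.prob Be + P.prob Bf) \<le> p" using p(2) by linarith
  with p(1,3) show ?thesis by blast
qed

section \<open>Rates\<close>

text \<open>
With h = u^2 r, the rate gives N^2 \<le> (c^2 h)^k for every c > 0. As N \<ge> 1, this forces h
to infinity, and N \<le> h^k is negligible against exp (kappa h).
\<close>

lemma exponential_beats_rate:
  fixes N \<rho> u r :: "nat \<Rightarrow> real" and k :: nat
  assumes k: "1 \<le> k" and N: "\<forall>\<^sub>F n in sequentially. 1 \<le> N n" and r: "\<forall>\<^sub>F n in sequentially. 0 < r n"
    and u: "\<forall>\<^sub>F n in sequentially. 0 \<le> u n"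
    and rate: "\<And>c. 0 < c \<Longrightarrow> \<forall>\<^sub>F n in sequentially. N n powr (1 / real k) / sqrt (r n) \<le> c * u n"
  shows "filterlim (\<lambda>n. (u n)\<^sup>2 * r n) at_top sequentially"
    and "0 < \<kappa> \<Longrightarrow> (\<lambda>n. N n * exp (- \<kappa> * ((u n)\<^sup>2 * r n))) \<longlonglongrightarrow> 0"
proof -
  let ?h = "\<lambda>n. (u n)\<^sup>2 * r n"
  have bound: "\<forall>\<^sub>F n in sequentially. 1 \<le> N n \<and> (N n)\<^sup>2 \<le> (c\<^sup>2 * ?h n) ^ k" if "0 < c" for c
    using rate[OF that] N r u
  proof eventually_elim
    case (elim n)
    have "N n powr (1 / real k) \<le> c * u n * sqrt (r n)"
      using elim by (simp add: field_simps)
    then have "(N n powr (1 / real k)) ^ k \<le> (c * u n * sqrt (r n)) ^ k"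
      by (intro power_mono) auto
    also have "(N n powr (1 / real k)) ^ k = N n"
      using k elim by (simp add: powr_realpow[symmetric] powr_powr)
    finally have "(N n)\<^sup>2 \<le> ((c * u n * sqrt (r n)) ^ k)\<^sup>2"
      using elim by (intro power_mono) auto
    also have "\<dots> = ((c * u n * sqrt (r n))\<^sup>2) ^ k"
      by (simp only: power_mult[symmetric] mult.commute[of k 2])
    also have "(c * u n * sqrt (r n))\<^sup>2 = c\<^sup>2 * ?h n"
      using elim by (simp add: power_mult_distrib)
    finally show ?case using elim by simp
  qed
  show lim: "filterlim ?h at_top sequentially"
    unfolding filterlim_at_top_gt[where c = 0]
  proof (intro allI impI)
    fix Z :: real assume Z: "0 < Z"
    have "0 < 1 / sqrt Z" using Z by simp
    from bound[OF this] show "\<forall>\<^sub>F n in sequentially. Z \<le> ?h n"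
      using r
    proof eventually_elim
      case (elim n)
      have "(1 / sqrt Z)\<^sup>2 = 1 / Z" using Z by (simp add: power_divide)
      moreover have "1 \<le> (N n)\<^sup>2" using elim by (intro one_le_power) auto
      ultimately have "1 ^ k \<le> (1 / Z * ?h n) ^ k"
        using elim unfolding power_one by (metis order_trans)
      then have "1 \<le> 1 / Z * ?h n" using k elim Z by (subst (asm) power_mono_iff) auto
      then show ?case using Z by (simp add: field_simps)
    qed
  qed
  show "(\<lambda>n. N n * exp (- \<kappa> * ?h n)) \<longlonglongrightarrow> 0" if \<kappa>: "0 < \<kappa>"
  proof (rule tendsto_sandwich[OF _ _ tendsto_const])
    show "\<forall>\<^sub>F n in sequentially. 0 \<le> N n * exp (- \<kappa> * ?h n)"
      using N by eventually_elim simp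
    show "\<forall>\<^sub>F n in sequentially. N n * exp (- \<kappa> * ?h n) \<le> 1 / \<kappa> ^ k * ((\<kappa> * ?h n) ^ k / exp (\<kappa> * ?h n))"
      using bound[of 1, simplified]
    proof eventually_elim
      case (elim n)
      have "N n \<le> (N n)\<^sup>2" using elim by (simp add: power2_eq_square)
      then have "N n \<le> ?h n ^ k" using elim by linarith
      then have "N n * exp (- \<kappa> * ?h n) \<le> ?h n ^ k * exp (- \<kappa> * ?h n)" by (intro mult_right_mono) auto
      also have "\<dots> = 1 / \<kappa> ^ k * ((\<kappa> * ?h n) ^ k / exp (\<kappa> * ?h n))"
        using \<kappa> by (simp add: power_mult_distrib exp_minus field_simps)
      finally show ?case .
    qed
    have "filterlim (\<lambda>n. \<kappa> * ?h n) at_top sequentially"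
      by (rule filterlim_tendsto_pos_mult_at_top[OF tendsto_const \<kappa> lim])
    from filterlim_compose[OF tendsto_power_div_exp_0 this]
    have "(\<lambda>n. (\<kappa> * ?h n) ^ k / exp (\<kappa> * ?h n)) \<longlonglongrightarrow> 0" .
    from tendsto_mult_right_zero[OF this, of "1 / \<kappa> ^ k"]
    show "(\<lambda>n. 1 / \<kappa> ^ k * ((\<kappa> * ?h n) ^ k / exp (\<kappa> * ?h n))) \<longlonglongrightarrow> 0" .
  qed
qed

section \<open>Consistency of the test\<close>

text \<open>
Rows of a segment share one law, so the bounds obtained from the rows of a single environment f
inside the segment hold for all of them. Directions of arbitrary length follow by scaling.
\<close>

lemma segment_gaussian_rows:
  fixes P :: "(nat \<Rightarrow> real \<times> (real ^ 'd::finite)) measure" and c C :: real and k :: nat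
  defines "Ck \<equiv> 2 ^ (4 * k) * (1 + (\<integral>u. u ^ (4 * k) \<partial>std_normal_distribution))"
  assumes P: "prob_space P" and g: "finite g"
    and indep: "prob_space.indep_vars P (\<lambda>_. borel) (\<lambda>t w. w t) g"
    and ident: "\<forall>t\<in>g. distr P borel (\<lambda>w. w t) = law"
    and normal: "jointly_normal P g (\<lambda>t w. w t)"
    and f: "f \<subseteq> g" "f \<noteq> {}" and k: "1 \<le> k" and c: "0 < c"
    and lower: "integrable P (\<lambda>w. Min (eigenvalues (cov_matrix (\<lambda>t. snd (w t)) f)) ^ (2 * k))"
      "c \<le> (LINT w|P. Min (eigenvalues (cov_matrix (\<lambda>t. snd (w t)) f)) ^ (2 * k))"
    and upper: "integrable P (\<lambda>w. Max (eigenvalues (cov_matrix (\<lambda>t. snd (w t)) f)) ^ (2 * k))"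
      "(LINT w|P. Max (eigenvalues (cov_matrix (\<lambda>t. snd (w t)) f)) ^ (2 * k)) \<le> C"
  shows "gaussian_rows P (\<lambda>t w. snd (w t)) g (min 1 (c / Ck)) (1 + C)"
proof -
  interpret prob_space P by (rule P)
  have wm: "(\<lambda>w. w t) \<in> borel_measurable P" if "t \<in> g" for t
    using indep that by (simp add: indep_vars_def)
  have sm: "snd \<in> borel_measurable (borel :: (real \<times> (real ^ 'd)) measure)"
    by (simp add: borel_prod[symmetric])
  have vm: "(\<lambda>p :: real \<times> (real ^ 'd). snd p \<bullet> v) \<in> borel_measurable borel" for v
    by (rule borel_measurable_inner[OF sm]) simp
  have nv: "\<exists>m s. normal_variable P (\<lambda>w. snd (w t) \<bullet> v) m s" if t: "t \<in> g" for t v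
  proof -
    let ?u = "\<lambda>i. if i = t then (0 :: real, v) else 0"
    obtain m s where ms: "0 \<le> s" "distr P borel (\<lambda>w. \<Sum>i\<in>g. ?u i \<bullet> w i) = normal_law m s"
      using normal unfolding jointly_normal_def by meson
    have "(\<Sum>i\<in>g. ?u i \<bullet> w i) = snd (w t) \<bullet> v" for w :: "nat \<Rightarrow> real \<times> (real ^ 'd)"
    proof -
      have "(\<Sum>i\<in>g. ?u i \<bullet> w i) = (\<Sum>i\<in>g. if i = t then snd (w t) \<bullet> v else 0)"
        by (intro sum.cong refl) (auto simp: inner_prod_def inner_commute)
      then show ?thesis using g t by simp
    qed
    then have "distr P borel (\<lambda>w. snd (w t) \<bullet> v) = normal_law m s" using ms(2) by simp
    then have "normal_variable P (\<lambda>w. snd (w t) \<bullet> v) m s"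
      using ms(1) measurable_compose[OF wm[OF t] vm] by unfold_locales auto
    then show ?thesis by blast
  qed
  have common: "\<exists>m s. \<forall>t\<in>g. normal_variable P (\<lambda>w. snd (w t) \<bullet> v) m s" for v
  proof -
    obtain t0 where t0: "t0 \<in> g" using f by auto
    then obtain m s where ms: "normal_variable P (\<lambda>w. snd (w t0) \<bullet> v) m s" using nv by blast
    have "normal_variable P (\<lambda>w. snd (w t) \<bullet> v) m s" if t: "t \<in> g" for t
    proof -
      have d: "distr P borel (\<lambda>w. snd (w t) \<bullet> v) = distr law borel (\<lambda>p. snd p \<bullet> v)" if "t \<in> g" for t
      proof -
        have "distr law borel (\<lambda>p. snd p \<bullet> v) = distr (distr P borel (\<lambda>w. w t)) borel (\<lambda>p. snd p \<bullet> v)"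
          using ident that by simp
        also have "\<dots> = distr P borel (\<lambda>w. snd (w t) \<bullet> v)"
          using wm[OF that] vm by (subst distr_distr) (auto simp: comp_def)
        finally show ?thesis by simp
      qed
      have "distr P borel (\<lambda>w. snd (w t) \<bullet> v) = normal_law m s" "0 \<le> s"
        using d[OF t] d[OF t0] ms unfolding normal_variable_def normal_variable_axioms_def by auto
      then show ?thesis using measurable_compose[OF wm[OF t] vm] by unfold_locales auto
    qed
    then show ?thesis by blast
  qed
  have fin: "finite f" using f(1) g by (rule finite_subset)
  have "\<exists>m s. (\<forall>t\<in>g. normal_variable P (\<lambda>w. snd (w t) \<bullet> v) m s) \<and> min 1 (c / Ck) * (norm v)\<^sup>2 \<le> m\<^sup>2 + s\<^sup>2 \<and> m\<^sup>2 + s\<^sup>2 \<le> (1 + C) * (norm v)\<^sup>2" for v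
  proof -
    obtain m s where ms: "\<forall>t\<in>g. normal_variable P (\<lambda>w. snd (w t) \<bullet> v) m s" using common by blast
    obtain t0 where t0: "t0 \<in> g" using f by auto
    have E: "m\<^sup>2 + s\<^sup>2 = expectation (\<lambda>w. (snd (w t0) \<bullet> v)\<^sup>2)"
    proof -
      interpret normal_variable P "\<lambda>w. snd (w t0) \<bullet> v" m s using ms t0 by blast
      show ?thesis by (rule second_moment[symmetric])
    qed
    show ?thesis
    proof (cases "v = 0")
      case True
      then have "m\<^sup>2 + s\<^sup>2 = 0" using E by simp
      then show ?thesis using ms True by (intro exI[of _ m] exI[of _ s]) simp
    next
      case False
      let ?u = "(1 / norm v) *\<^sub>R v"
      obtain m' s' where ms': "\<forall>t\<in>g. normal_variable P (\<lambda>w. snd (w t) \<bullet> ?u) m' s'" using common by blast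
      have b: "min 1 (c / Ck) \<le> m'\<^sup>2 + s'\<^sup>2" "m'\<^sup>2 + s'\<^sup>2 \<le> 1 + C"
        unfolding Ck_def
        by (rule second_moment_bounds_of_eigenvalue_moments[where x = "\<lambda>t w. snd (w t)" and v = ?u, OF fin f(2) k c _ _ lower upper];
            use ms' f(1) False in auto)+
      have E': "m'\<^sup>2 + s'\<^sup>2 = expectation (\<lambda>w. (snd (w t0) \<bullet> ?u)\<^sup>2)"
      proof -
        interpret normal_variable P "\<lambda>w. snd (w t0) \<bullet> ?u" m' s' using ms' t0 by blast
        show ?thesis by (rule second_moment[symmetric])
      qed
      have "m\<^sup>2 + s\<^sup>2 = (norm v)\<^sup>2 * (m'\<^sup>2 + s'\<^sup>2)"
        unfolding E E' using False by (simp add: power_divide)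
      then have "min 1 (c / Ck) * (norm v)\<^sup>2 \<le> m\<^sup>2 + s\<^sup>2" "m\<^sup>2 + s\<^sup>2 \<le> (1 + C) * (norm v)\<^sup>2"
        using mult_left_mono[OF b(1), of "(norm v)\<^sup>2"] mult_left_mono[OF b(2), of "(norm v)\<^sup>2"] by (simp_all add: mult.commute)
      then show ?thesis using ms by blast
    qed
  qed
  moreover have "indep_vars (\<lambda>_. borel) (\<lambda>t w. snd (w t)) g"
    by (rule indep_vars_compose2[OF indep, where Y = "\<lambda>_. snd"]) (rule sm)
  ultimately show ?thesis unfolding gaussian_rows_def using g by blast
qed

lemma (in prob_space) indep_var_coordinate:
  fixes Z :: "'a \<Rightarrow> real ^ 'd::finite" and \<epsilon> :: "'a \<Rightarrow> real"
  assumes m: "\<epsilon> \<in> borel_measurable M" "Z \<in> borel_measurable M"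
    and ind: "indep_set (sets (vimage_algebra (space M) \<epsilon> borel)) (sets (vimage_algebra (space M) Z borel))"
  shows "indep_var borel \<epsilon> borel (\<lambda>w. Z w $ j)"
proof -
  have Zj: "(\<lambda>w. Z w $ j) \<in> borel_measurable M" using m(2) by (simp add: borel_measurable_vec_iff)
  have vm: "(\<lambda>v :: real ^ 'd. v $ j) \<in> borel_measurable borel"
    unfolding cart_eq_inner_axis by measurable
  have "{(\<lambda>w. Z w $ j) -` A \<inter> space M | A. A \<in> sets borel} \<subseteq> {Z -` A \<inter> space M | A. A \<in> sets borel}"
  proof clarify
    fix A :: "real set" assume "A \<in> sets borel"
    then have "(\<lambda>v :: real ^ 'd. v $ j) -` A \<in> sets borel" using measurable_sets[OF vm, of A] by simp
    moreover have "(\<lambda>w. Z w $ j) -` A \<inter> space M = Z -` ((\<lambda>v. v $ j) -` A) \<inter> space M" by auto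
    ultimately show "\<exists>B. (\<lambda>w. Z w $ j) -` A \<inter> space M = Z -` B \<inter> space M \<and> B \<in> sets borel" by blast
  qed
  then have "sigma_sets (space M) {(\<lambda>w. Z w $ j) -` A \<inter> space M | A. A \<in> sets borel}
      \<subseteq> sigma_sets (space M) {Z -` A \<inter> space M | A. A \<in> sets borel}"
    by (rule sigma_sets_mono')
  with ind have "indep_set (sigma_sets (space M) {\<epsilon> -` A \<inter> space M | A. A \<in> sets borel})
      (sigma_sets (space M) {(\<lambda>w. Z w $ j) -` A \<inter> space M | A. A \<in> sets borel})"
    unfolding sets_vimage_algebra indep_sets2_eq by blast
  then show ?thesis unfolding indep_var_eq using m(1) Zj by blast
qed

lemma regression_errors_on_environment:
  fixes P :: "(nat \<Rightarrow> real \<times> (real ^ 'd::finite)) measure" and S :: "'d set"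
  assumes P: "prob_space P" and rows: "gaussian_rows P (\<lambda>t w. snd (w t)) g c0 C0" and C0: "0 \<le> C0"
    and indep: "prob_space.indep_vars P (\<lambda>_. borel) (\<lambda>t w. w t) g"
    and regr: "regression_on P S g \<beta> \<sigma>"
    and f: "f \<subseteq> g" "f \<noteq> {}" and \<eta>: "0 < \<eta>"
  shows "\<exists>B\<in>sets P. measure P B \<le> (3 * \<sigma> ^ 4 + real CARD('d) ^ 3 * \<sigma>\<^sup>2 * C0) / (\<eta>\<^sup>2 * real (card f))
     \<and> (\<forall>w\<in>space P - B. errors_within \<eta> (\<sigma>\<^sup>2)
           (\<lambda>t. fst (w t) - restr S (snd (w t)) \<bullet> \<beta>) (\<lambda>t. restr S (snd (w t))) f)"
proof -
  interpret prob_space P by (rule P)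
  have fin: "finite f" using rows f(1) by (auto simp: gaussian_rows_def intro: finite_subset)
  have wm: "(\<lambda>w. w t) \<in> borel_measurable P" if "t \<in> g" for t
    using indep that by (simp add: indep_vars_def)
  have pm: "fst \<in> borel_measurable (borel :: (real \<times> (real ^ 'd)) measure)"
    "snd \<in> borel_measurable (borel :: (real \<times> (real ^ 'd)) measure)"
    by (simp_all add: borel_prod[symmetric])
  have em: "(\<lambda>p :: real \<times> (real ^ 'd). fst p - restr S (snd p) \<bullet> \<beta>) \<in> borel_measurable borel"
    and zm: "(\<lambda>p :: real \<times> (real ^ 'd). restr S (snd p)) \<in> borel_measurable borel"
    using pm by (auto intro!: borel_measurable_diff borel_measurable_inner borel_measurable_restr)
  show ?thesis
  proof (rule regression_error_concentration[OF fin f(2) \<eta>])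
    have "indep_vars (\<lambda>_. borel) (\<lambda>t w. w t) f" by (rule indep_vars_subset[OF indep f(1)])
    then show "indep_vars (\<lambda>_. borel) (\<lambda>t w. (fst (w t) - restr S (snd (w t)) \<bullet> \<beta>, restr S (snd (w t)))) f"
      by (rule indep_vars_compose2[where Y = "\<lambda>_ p. (fst p - restr S (snd p) \<bullet> \<beta>, restr S (snd p))"])
        (intro borel_measurable_Pair em zm)
    fix t assume "t \<in> f"
    then have t: "t \<in> g" using f(1) by auto
    have e: "(\<lambda>w. fst (w t) - restr S (snd (w t)) \<bullet> \<beta>) \<in> borel_measurable P"
      and z: "(\<lambda>w. restr S (snd (w t))) \<in> borel_measurable P"
      using measurable_compose[OF wm[OF t] em] measurable_compose[OF wm[OF t] zm] by simp_all
    show "normal_variable P (\<lambda>w. fst (w t) - restr S (snd (w t)) \<bullet> \<beta>) 0 \<sigma>"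
      using regr t e by unfold_locales (auto simp: regression_on_def)
    show "indep_var borel (\<lambda>w. fst (w t) - restr S (snd (w t)) \<bullet> \<beta>) borel (\<lambda>w. restr S (snd (w t)) $ j)" for j
      using regr t by (intro indep_var_coordinate e z) (auto simp: regression_on_def)
    have sq: "integrable P (\<lambda>w. (snd (w t) $ j)\<^sup>2)" "expectation (\<lambda>w. (snd (w t) $ j)\<^sup>2) \<le> C0" for j
    proof -
      obtain m s where ms: "normal_variable P (\<lambda>w. snd (w t) \<bullet> axis j 1) m s" "m\<^sup>2 + s\<^sup>2 \<le> C0 * (norm (axis j 1 :: real ^ 'd))\<^sup>2"
        using rows t unfolding gaussian_rows_def by blast
      interpret normal_variable P "\<lambda>w. snd (w t) \<bullet> axis j 1" m s by (rule ms(1))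
      show "integrable P (\<lambda>w. (snd (w t) $ j)\<^sup>2)" "expectation (\<lambda>w. (snd (w t) $ j)\<^sup>2) \<le> C0"
        using power_integrable[of 2] second_moment ms(2) by (simp_all add: inner_axis norm_axis_1)
    qed
    show "integrable P (\<lambda>w. (restr S (snd (w t)) $ j)\<^sup>2)" "expectation (\<lambda>w. (restr S (snd (w t)) $ j)\<^sup>2) \<le> C0" for j
      using sq[of j] C0 by (cases "j \<in> S"; simp add: restr_def)+
  qed
qed

text \<open>
All requirements on theta are open conditions that hold near 0.
\<close>

lemma tuning_constant:
  fixes U vlo q Q m S0 c :: real
  assumes "0 < U" "0 < vlo" "0 < q" "0 < Q" "0 < m" "0 < S0" "0 < c"
  obtains \<theta> where "0 < \<theta>" "\<theta> * U \<le> 1" "q * (\<theta> * U) \<le> 1 / 2" "(1 + 1 / c) * (\<theta> * U) < vlo"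
    "4 * (q * \<theta>) * (S0 + 1) < m - Q * \<theta>"
proof -
  have lim: "((\<lambda>\<theta>. r * \<theta>) \<longlongrightarrow> 0) (at_right 0)" for r :: real
    by (rule tendsto_mult_right_zero) (simp add: tendsto_ident_at)
  have "\<forall>\<^sub>F \<theta> in at_right (0 :: real). U * \<theta> < 1 \<and> (q * U) * \<theta> < 1 / 2 \<and> ((1 + 1 / c) * U) * \<theta> < vlo
      \<and> (4 * q * (S0 + 1) + Q) * \<theta> < m \<and> 0 < \<theta>"
    using assms by (intro eventually_conj order_tendstoD(2)[OF lim] eventually_at_right_less) auto
  then obtain \<theta> where \<theta>: "U * \<theta> < 1" "(q * U) * \<theta> < 1 / 2" "((1 + 1 / c) * U) * \<theta> < vlo"
      "(4 * q * (S0 + 1) + Q) * \<theta> < m" "0 < \<theta>"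
    using eventually_happens[of _ "at_right (0 :: real)"] by (auto simp: trivial_limit_at_right_real)
  have eqs: "U * \<theta> = \<theta> * U" "(q * U) * \<theta> = q * (\<theta> * U)" "((1 + 1 / c) * U) * \<theta> = (1 + 1 / c) * (\<theta> * U)"
    "(4 * q * (S0 + 1) + Q) * \<theta> = 4 * (q * \<theta>) * (S0 + 1) + Q * \<theta>"
    by (simp_all add: algebra_simps)
  show ?thesis
    by (rule that[of \<theta>]) (use \<theta>[unfolded eqs] in simp_all)
qed

theorem theorem4p2:
  fixes P :: "nat \<Rightarrow> (nat \<Rightarrow> real \<times> (real ^ 'd::finite)) measure"
    and CP :: "nat \<Rightarrow> nat list" and \<alpha>s :: "nat \<Rightarrow> real" and L n0 k :: nat
    and S :: "'d set" and \<alpha> :: real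
    and \<E> :: "nat \<Rightarrow> nat set set" and a b :: "nat \<Rightarrow> real"
  assumes model: "asymptotic_cp_model n0 L \<alpha>s CP P"
    and normal: "multivariate_normality n0 CP P"
    and regr: "regression_parameters_exist n0 CP P S"
    and \<alpha>: "0 < \<alpha>" "\<alpha> < 1"
    and k: "1 \<le> k"
    and envs: "\<forall>n\<ge>n0. \<E> n \<subseteq> Pow {1..n} \<and> {} \<notin> \<E> n \<and> disjoint (\<E> n)"
    and C1: "C1 \<E>"
    and C2: "C2 n0 L CP P S \<E>"
    and C3: "C3 n0 P k \<E>"
    and alt: "\<forall>n\<ge>n0. P n \<in> H_A n (CP n) S (a n) (b n)"
    and rate: "(\<lambda>n. real (card (\<E> n)) powr (1 / real k) / sqrt (real (r_min \<E> n))) \<in> o(a) \<or>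
               (\<lambda>n. real (card (\<E> n)) powr (1 / real k) / sqrt (real (r_min \<E> n))) \<in> o(\<lambda>n. (b n)\<^sup>2)"
  shows "\<exists>p :: nat \<Rightarrow> real.
           (\<forall>\<^sub>F n in sequentially.
              (\<lambda>B. rejection_prob (T3_max S (\<E> n)) n S \<alpha> B (P n)) \<longlonglongrightarrow> p n) \<and>
           p \<longlonglongrightarrow> 1"
proof -
  define I where "I = {1..L + 1}"
  have I: "finite I" "I \<noteq> {}" by (auto simp: I_def)
  define seg where "seg n i = segment n (CP n) i" for n i
  have cp: "length (CP n) = L" "change_points n (CP n)" "data_law n (P n)"
    and indep: "\<And>i. i \<in> I \<Longrightarrow> prob_space.indep_vars (P n) (\<lambda>_. borel) (\<lambda>t w. w t) (seg n i)"
    and ident: "\<And>i. i \<in> I \<Longrightarrow> \<exists>law. \<forall>t\<in>seg n i. distr (P n) borel (\<lambda>w. w t) = law"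
    if "n0 \<le> n" for n
    using model that unfolding asymptotic_cp_model_def I_def seg_def by blast+
  have prob: "prob_space (P n)" if "n0 \<le> n" for n using cp(3)[OF that] by (simp add: data_law_def)
  have normal': "jointly_normal (P n) (seg n i) (\<lambda>t w. w t)" if "n0 \<le> n" "i \<in> I" for n i
    using normal that cp(1)[OF that(1)] unfolding multivariate_normality_def segments_def I_def seg_def by auto
  have uniq: "\<forall>e\<in>segments n (CP n). \<exists>!(b, s). regression_on (P n) S e b s" if "n0 \<le> n" for n
    using regr that unfolding regression_parameters_exist_def by blast

  \<comment> \<open>One environment inside each segment, with parameters that stay bounded and variances that stay away from 0.\<close>
  from C2 have "\<forall>i\<in>I. \<exists>f. (\<forall>n\<ge>n0. f n \<in> \<E> n) \<and> (\<exists>N. \<forall>n\<ge>N. f n \<subseteq> seg n i)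
      \<and> convergent (\<lambda>n. reg_coef n (CP n) (P n) S (f n))
      \<and> (\<exists>v>0. (\<lambda>n. (reg_sd n (CP n) (P n) S (f n))\<^sup>2) \<longlonglongrightarrow> v)"
    unfolding C2_def I_def seg_def by blast
  from bchoice[OF this] obtain F where F: "\<forall>i\<in>I. (\<forall>n\<ge>n0. F i n \<in> \<E> n) \<and> (\<exists>N. \<forall>n\<ge>N. F i n \<subseteq> seg n i)
      \<and> convergent (\<lambda>n. reg_coef n (CP n) (P n) S (F i n))
      \<and> (\<exists>v>0. (\<lambda>n. (reg_sd n (CP n) (P n) S (F i n))\<^sup>2) \<longlonglongrightarrow> v)" by blast
  define \<sigma> where "\<sigma> i n = reg_sd n (CP n) (P n) S (F i n)" for i n
  define \<beta> where "\<beta> i n = reg_coef n (CP n) (P n) S (F i n)" for i n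
  have FE: "F i n \<in> \<E> n" if "i \<in> I" "n0 \<le> n" for i n using F that by blast
  have ev_sub: "\<forall>\<^sub>F n in sequentially. \<forall>i\<in>I. F i n \<subseteq> seg n i"
    using F I(1) by (intro eventually_ball_finite) (auto simp: eventually_sequentially)
  have "\<forall>i\<in>I. \<exists>v. 0 < v \<and> (\<lambda>n. (\<sigma> i n)\<^sup>2) \<longlonglongrightarrow> v" using F by (auto simp: \<sigma>_def)
  from bchoice[OF this] obtain v where v: "\<And>i. i \<in> I \<Longrightarrow> 0 < v i" "\<And>i. i \<in> I \<Longrightarrow> (\<lambda>n. (\<sigma> i n)\<^sup>2) \<longlonglongrightarrow> v i"
    by blast
  define vlo where "vlo = Min (v ` I) / 2"
  define S0 where "S0 = 2 * Max (v ` I)"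
  have vlo: "0 < vlo" "vlo < v i" and S0: "v i < S0" if "i \<in> I" for i
  proof -
    have "0 < Min (v ` I)" using I v(1) by (subst Min_gr_iff) auto
    moreover have "Min (v ` I) \<le> v i" "v i \<le> Max (v ` I)" using I(1) that by auto
    ultimately show "0 < vlo" "vlo < v i" "v i < S0" using v(1)[OF that] by (auto simp: vlo_def S0_def)
  qed
  have vlo0: "0 < vlo" and S00: "0 < S0"
    using I(2) vlo S0 v(1) by (metis all_not_in_conv, metis all_not_in_conv order.strict_trans)
  have ev_\<sigma>: "\<forall>\<^sub>F n in sequentially. \<forall>i\<in>I. vlo < (\<sigma> i n)\<^sup>2 \<and> (\<sigma> i n)\<^sup>2 < S0"
  proof (rule eventually_ball_finite[OF I(1)], rule ballI)
    fix i assume i: "i \<in> I"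
    show "\<forall>\<^sub>F n in sequentially. vlo < (\<sigma> i n)\<^sup>2 \<and> (\<sigma> i n)\<^sup>2 < S0"
      using order_tendstoD(1)[OF v(2)[OF i] vlo(2)[OF i]] order_tendstoD(2)[OF v(2)[OF i] S0[OF i]]
      by eventually_elim simp
  qed
  have "\<forall>i\<in>I. \<exists>K. \<forall>n. norm (\<beta> i n) \<le> K"
  proof
    fix i assume "i \<in> I"
    then have "Bseq (\<beta> i)" using F by (auto simp: \<beta>_def[abs_def] intro: convergent_imp_Bseq)
    then show "\<exists>K. \<forall>n. norm (\<beta> i n) \<le> K" by (auto simp: Bseq_def)
  qed
  from bchoice[OF this] obtain Kb where Kb: "\<And>i n. i \<in> I \<Longrightarrow> norm (\<beta> i n) \<le> Kb i" by blast
  define D where "D = 2 * Max (Kb ` I)"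
  have D: "norm (\<beta> i n - \<beta> j n) \<le> D" if "i \<in> I" "j \<in> I" for i j n
  proof -
    have "Kb i \<le> Max (Kb ` I)" "Kb j \<le> Max (Kb ` I)" using I(1) that by auto
    then show ?thesis using Kb[OF that(1), of n] Kb[OF that(2), of n] norm_triangle_ineq4[of "\<beta> i n" "\<beta> j n"]
      by (simp add: D_def)
  qed
  have D0: "0 \<le> D" using I(2) D by (metis all_not_in_conv norm_ge_zero order_trans)

  from C3 obtain c C where c: "0 < c" and C3': "\<And>n e. n0 \<le> n \<Longrightarrow> e \<in> \<E> n \<Longrightarrow>
        integrable (P n) (\<lambda>w. Min (eigenvalues (cov_matrix (\<lambda>t. snd (w t)) e)) ^ (2 * k)) \<and>
        integrable (P n) (\<lambda>w. Max (eigenvalues (cov_matrix (\<lambda>t. snd (w t)) e)) ^ (2 * k)) \<and>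
        c \<le> (LINT w|P n. Min (eigenvalues (cov_matrix (\<lambda>t. snd (w t)) e)) ^ (2 * k)) \<and>
        (LINT w|P n. Max (eigenvalues (cov_matrix (\<lambda>t. snd (w t)) e)) ^ (2 * k)) \<le> C"
    unfolding C3_def by blast
  define c0 where "c0 = min 1 (c / (2 ^ (4 * k) * (1 + (\<integral>u. u ^ (4 * k) \<partial>std_normal_distribution))))"
  define C0 where "C0 = 1 + max 0 C"
  have "0 < 2 ^ (4 * k) * (1 + (\<integral>u. u ^ (4 * k) \<partial>std_normal_distribution))"
    by (intro mult_pos_pos add_pos_nonneg integral_nonneg) (auto simp: zero_le_even_power)
  then have c0: "0 < c0" using c by (simp add: c0_def)
  have C0: "0 < C0" by (simp add: C0_def)
  have rows: "gaussian_rows (P n) (\<lambda>t w. snd (w t)) (seg n i) c0 C0"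
    if n: "n0 \<le> n" and i: "i \<in> I" and sub: "F i n \<subseteq> seg n i" for n i
  proof -
    obtain law where law: "\<forall>t\<in>seg n i. distr (P n) borel (\<lambda>w. w t) = law" using ident[OF n i] by blast
    have ne: "F i n \<noteq> {}" using envs n FE[OF i n] by auto
    note c3 = C3'[OF n FE[OF i n]]
    have fin: "finite (seg n i)" by (simp add: seg_def segment_def)
    show ?thesis unfolding c0_def C0_def
      by (rule segment_gaussian_rows[OF prob[OF n] fin indep[OF n i] law normal'[OF n i] sub ne k c])
        (use c3 in auto)
  qed
  obtain c1 K Dc \<kappa>d where c1: "0 < c1" and K: "0 < K" and Dc: "0 \<le> Dc" and \<kappa>d: "0 < \<kappa>d"
    and wce: "\<And>(M :: (nat \<Rightarrow> real \<times> (real ^ 'd)) measure) (x :: nat \<Rightarrow> (nat \<Rightarrow> real \<times> (real ^ 'd)) \<Rightarrow> real ^ 'd) g e.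
       \<lbrakk>prob_space M; finite e; e \<noteq> {}; \<forall>i\<in>{1..L + 1}. gaussian_rows M x (g i) c0 C0; e \<subseteq> (\<Union>i\<in>{1..L + 1}. g i)\<rbrakk> \<Longrightarrow>
       \<exists>B\<in>sets M. measure M B \<le> Dc * exp (- \<kappa>d * real (card e))
         \<and> (\<forall>w\<in>space M - B. well_conditioned c1 K (\<lambda>t. x t w) e)"
  proof (rule well_conditioned_exponential[OF c0 C0, where ?'w = "nat \<Rightarrow> real \<times> (real ^ 'd)" and ?'d = 'd and L = L], goal_cases)
    case (1 c1 K Dc \<kappa>d)
    show ?case by (rule 1(1)[OF 1(2-6)])
  qed

  \<comment> \<open>The signal u is bounded by U, because the parameters are bounded.\<close>
  define u where "u n = max (a n) ((b n)\<^sup>2)" for n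
  define r where "r n = real (r_min \<E> n)" for n
  define N where "N n = real (card (\<E> n))" for n
  define q where "q = 1 + 2 / c1 + K / c1\<^sup>2"
  define \<kappa> where "\<kappa> = min (1 / 16) (1 / (2 * K * (real CARD('d))\<^sup>2))"
  define m where "m = min 1 (c1 / 2)"
  define Q where "Q = 2 + 2 * D + 3 / c1"
  define U where "U = S0 + D\<^sup>2"
  have q: "0 < q" using c1 K unfolding q_def by (intro add_pos_pos) auto
  have \<kappa>: "0 < \<kappa>" using K by (simp add: \<kappa>_def)
  have m: "0 < m" using c1 by (simp add: m_def)
  have Q: "0 < Q" using c1 D0 unfolding Q_def by (intro add_pos_pos add_pos_nonneg) auto
  have U: "0 < U" using S00 by (simp add: U_def add_pos_nonneg)
  obtain \<theta> where \<theta>: "0 < \<theta>" "\<theta> * U \<le> 1" "q * (\<theta> * U) \<le> 1 / 2" "(1 + 1 / c1) * (\<theta> * U) < vlo"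
    "4 * (q * \<theta>) * (S0 + 1) < m - Q * \<theta>"
    using tuning_constant[OF U vlo0 q Q m S00 c1] by blast
  define V where "V = 3 * S0\<^sup>2 + real CARD('d) ^ 3 * S0 * C0"

  have finE: "finite (\<E> n)" if "n0 \<le> n" for n
    by (rule finite_subset[of _ "Pow {1..n}"]) (use envs that in auto)
  have i1: "1 \<in> I" by (simp add: I_def)
  have N1: "1 \<le> N n" if "n0 \<le> n" for n
  proof -
    have "0 < card (\<E> n)" using finE[OF that] FE[OF i1 that] by (auto simp: card_gt_0_iff)
    then show ?thesis by (simp add: N_def)
  qed
  have r_le: "r n \<le> real (card e)" if "n0 \<le> n" "e \<in> \<E> n" for n e
    unfolding r_def r_min_def using finE[OF that(1)] that(2) by simp
  have ev_n0: "\<forall>\<^sub>F n in sequentially. n0 \<le> n" by (rule eventually_ge_at_top)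
  have ev_N: "\<forall>\<^sub>F n in sequentially. 1 \<le> N n" using ev_n0 by eventually_elim (rule N1)
  have ev_r: "\<forall>\<^sub>F n in sequentially. 0 < r n"
  proof -
    have "\<forall>\<^sub>F n in sequentially. 1 \<le> r_min \<E> n" using C1 unfolding C1_def filterlim_at_top by blast
    then show ?thesis by eventually_elim (simp add: r_def)
  qed
  have alt': "\<exists>i\<in>I. \<exists>j\<in>I.
        a n = \<bar>(reg_sd n (CP n) (P n) S (seg n i))\<^sup>2 - (reg_sd n (CP n) (P n) S (seg n j))\<^sup>2\<bar> \<and> a n > 0 \<and>
        b n = norm (reg_coef n (CP n) (P n) S (seg n i) - reg_coef n (CP n) (P n) S (seg n j)) \<and> b n > 0"
    if "n0 \<le> n" for n
  proof -
    have "P n \<in> H_A n (CP n) S (a n) (b n)" using alt that by blast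
    then show ?thesis unfolding H_A_def mem_Collect_eq cp(1)[OF that] I_def seg_def by (rule conjunct2)
  qed
  have a0: "0 < a n" if "n0 \<le> n" for n using alt'[OF that] by blast
  have ev_u: "\<forall>\<^sub>F n in sequentially. 0 \<le> u n"
    using ev_n0 by eventually_elim (use a0 in \<open>force simp: u_def\<close>)
  have ev_rate: "\<forall>\<^sub>F n in sequentially. N n powr (1 / real k) / sqrt (r n) \<le> x * u n" if "0 < x" for x
    using rate
  proof
    assume "(\<lambda>n. real (card (\<E> n)) powr (1 / real k) / sqrt (real (r_min \<E> n))) \<in> o(a)"
    from landau_o.smallD[OF this \<open>0 < x\<close>] ev_n0 show ?thesis
    proof eventually_elim
      case (elim n)
      have "x * \<bar>a n\<bar> \<le> x * u n" using a0[OF elim(2)] \<open>0 < x\<close> by (intro mult_left_mono) (auto simp: u_def)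
      then show ?case using elim(1) by (simp add: N_def r_def)
    qed
  next
    assume "(\<lambda>n. real (card (\<E> n)) powr (1 / real k) / sqrt (real (r_min \<E> n))) \<in> o(\<lambda>n. (b n)\<^sup>2)"
    from landau_o.smallD[OF this \<open>0 < x\<close>] show ?thesis
    proof eventually_elim
      case (elim n)
      have "x * (b n)\<^sup>2 \<le> x * u n" using \<open>0 < x\<close> by (intro mult_left_mono) (auto simp: u_def)
      then show ?case using elim by (simp add: N_def r_def)
    qed
  qed
  note beats = exponential_beats_rate[OF k ev_N ev_r ev_u ev_rate]

  define err where "err n = Dc * (N n * exp (- (\<kappa>d / U\<^sup>2) * ((u n)\<^sup>2 * r n))) + 2 * (V / \<theta>\<^sup>2 / ((u n)\<^sup>2 * r n))" for n
  have err0: "err \<longlonglongrightarrow> 0"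
  proof -
    have "(\<lambda>n. Dc * (N n * exp (- (\<kappa>d / U\<^sup>2) * ((u n)\<^sup>2 * r n)))) \<longlonglongrightarrow> 0"
      by (intro tendsto_mult_right_zero beats(2)) (use \<kappa>d U in auto)
    moreover have "(\<lambda>n. 2 * (V / \<theta>\<^sup>2 / ((u n)\<^sup>2 * r n))) \<longlonglongrightarrow> 0"
      by (intro tendsto_mult_right_zero tendsto_divide_0[OF tendsto_const] filterlim_at_top_imp_at_infinity beats(1))
    ultimately show ?thesis unfolding err_def by (rule tendsto_add_zero)
  qed
  have ev_small: "\<forall>\<^sub>F n in sequentially. 2 * (1 + real CARD('d)) * (N n * exp (- (\<kappa> * \<theta>\<^sup>2) * ((u n)\<^sup>2 * r n))) < \<alpha>"
    by (intro order_tendstoD(2)[OF tendsto_mult_right_zero] beats(2) \<alpha>) (use \<kappa> \<theta>(1) in auto)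

  have "\<forall>\<^sub>F n in sequentially. \<exists>p. (\<lambda>B. rejection_prob (T3_max S (\<E> n)) n S \<alpha> B (P n)) \<longlonglongrightarrow> p
      \<and> 1 - err n \<le> p \<and> p \<le> 1"
    using ev_n0 ev_sub ev_\<sigma> ev_r ev_small
  proof eventually_elim
    case (elim n)
    note n = elim(1) and sub = elim(2) and \<sigma>b = elim(3) and r = elim(4) and small = elim(5)
    interpret prob_space "P n" by (rule prob[OF n])
    have ne: "F i n \<noteq> {}" if "i \<in> I" for i using envs n FE[OF that n] by auto
    have par: "reg_coef n (CP n) (P n) S (seg n i) = \<beta> i n" "reg_sd n (CP n) (P n) S (seg n i) = \<sigma> i n"
      "regression_on (P n) S (seg n i) (\<beta> i n) (\<sigma> i n)" if i: "i \<in> I" for i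
    proof -
      have i': "i \<in> {1..length (CP n) + 1}" using i cp(1)[OF n] by (simp add: I_def)
      have sub': "F i n \<subseteq> segment n (CP n) i" using sub i by (simp add: seg_def)
      from regression_parameters_on_subset[OF cp(2)[OF n] uniq[OF n] i' ne[OF i] sub']
      show "reg_coef n (CP n) (P n) S (seg n i) = \<beta> i n" "reg_sd n (CP n) (P n) S (seg n i) = \<sigma> i n"
        "regression_on (P n) S (seg n i) (\<beta> i n) (\<sigma> i n)" by (simp_all add: \<beta>_def \<sigma>_def seg_def)
    qed
    have rb: "restr S (\<beta> i n) = \<beta> i n" if "i \<in> I" for i
      using par(3)[OF that] by (auto simp: regression_on_def restr_def vec_eq_iff)
    have row: "gaussian_rows (P n) (\<lambda>t w. snd (w t)) (seg n i) c0 C0" if "i \<in> I" for i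
      using rows[OF n that] sub that by blast
    \<comment> \<open>Ordered so that the environment in the role of e has the larger variance: the variance and coefficient differences then add up.\<close>
    obtain i j where ij: "i \<in> I" "j \<in> I" and aij: "a n = (\<sigma> i n)\<^sup>2 - (\<sigma> j n)\<^sup>2" "0 < a n"
      and bij: "b n = norm (\<beta> i n - \<beta> j n)"
    proof -
      obtain i j where ij: "i \<in> I" "j \<in> I" and *: "a n = \<bar>(\<sigma> i n)\<^sup>2 - (\<sigma> j n)\<^sup>2\<bar>" "0 < a n" "b n = norm (\<beta> i n - \<beta> j n)"
        using alt'[OF n] par by auto
      show ?thesis
      proof (cases "(\<sigma> j n)\<^sup>2 \<le> (\<sigma> i n)\<^sup>2")
        case True
        then show ?thesis using that[OF ij] * by simp
      next
        case False
        then show ?thesis using that[OF ij(2) ij(1)] * by (simp add: norm_minus_commute)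
      qed
    qed
    have "i \<noteq> j" using aij by auto
    have disj: "F i n \<inter> F j n = {}"
    proof (rule ccontr)
      assume "F i n \<inter> F j n \<noteq> {}"
      then obtain t where t: "t \<in> segment n (CP n) i" "t \<in> segment n (CP n) j"
        using sub ij by (auto simp: seg_def)
      have "i = j"
        by (rule segments_disjoint[OF cp(2)[OF n] _ _ t]) (use ij cp(1)[OF n] in \<open>auto simp: I_def\<close>)
      with \<open>i \<noteq> j\<close> show False by simp
    qed
    have u_pos: "0 < u n" using aij(2) by (simp add: u_def)
    have u_le: "u n \<le> U"
    proof -
      have "a n \<le> S0" using aij(1) \<sigma>b ij by (smt (verit) zero_le_power2)
      moreover have "(b n)\<^sup>2 \<le> D\<^sup>2" unfolding bij using D[OF ij] by (intro power_mono) auto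
      moreover note S00 zero_le_power2[of D]
      ultimately show ?thesis unfolding u_def U_def by (intro max.boundedI; linarith)
    qed
    define \<eta> where "\<eta> = \<theta> * u n"
    have \<eta>0: "0 < \<eta>" using \<theta>(1) u_pos by (simp add: \<eta>_def)
    have \<eta>U: "\<eta> \<le> \<theta> * U" unfolding \<eta>_def using u_le \<theta>(1) by (intro mult_left_mono) auto
    have \<eta>1: "\<eta> \<le> 1" using \<eta>U \<theta>(2) by linarith
    have \<eta>2: "q * \<eta> \<le> 1 / 2" using mult_left_mono[OF \<eta>U, of q] q \<theta>(3) by linarith
    have \<eta>3: "(1 + 1 / c1) * \<eta> < (\<sigma> j n)\<^sup>2"
    proof -
      have "(1 + 1 / c1) * \<eta> \<le> (1 + 1 / c1) * (\<theta> * U)" using \<eta>U c1 by (intro mult_left_mono) auto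
      then show ?thesis using \<theta>(4) \<sigma>b ij(2) by (smt (verit))
    qed
    have gain: "4 * (q * \<eta>) < ((\<sigma> i n)\<^sup>2 - (\<sigma> j n)\<^sup>2 + c1 / 2 * (norm (\<beta> i n - \<beta> j n))\<^sup>2 - (2 + 2 * D + 3 / c1) * \<eta>) / ((\<sigma> j n)\<^sup>2 + 1)"
    proof -
      have "m * u n \<le> a n + c1 / 2 * (b n)\<^sup>2"
      proof (cases "(b n)\<^sup>2 \<le> a n")
        case True
        have "m * a n \<le> 1 * a n" using aij(2) by (intro mult_right_mono) (auto simp: m_def)
        moreover have "0 \<le> c1 / 2 * (b n)\<^sup>2" using c1 by simp
        ultimately show ?thesis using True by (simp add: u_def max_def)
      next
        case False
        have "m * (b n)\<^sup>2 \<le> c1 / 2 * (b n)\<^sup>2" by (intro mult_right_mono) (auto simp: m_def)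
        then show ?thesis using False aij(2) by (simp add: u_def max_def)
      qed
      then have low: "(m - Q * \<theta>) * u n \<le> a n + c1 / 2 * (b n)\<^sup>2 - Q * \<eta>"
        by (simp add: \<eta>_def algebra_simps)
      have pos: "0 < (\<sigma> j n)\<^sup>2 + 1" "(\<sigma> j n)\<^sup>2 + 1 \<le> S0 + 1" using \<sigma>b ij(2) by (auto intro: add_nonneg_pos less_imp_le)
      have "4 * (q * \<eta>) * ((\<sigma> j n)\<^sup>2 + 1) \<le> 4 * (q * \<eta>) * (S0 + 1)"
        using pos q \<eta>0 by (intro mult_left_mono) auto
      also have "\<dots> = (4 * (q * \<theta>) * (S0 + 1)) * u n" by (simp add: \<eta>_def)
      also have "\<dots> < (m - Q * \<theta>) * u n" using \<theta>(5) u_pos by (rule mult_strict_right_mono)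
      also note low
      finally show ?thesis using pos(1) by (simp add: pos_less_divide_eq aij(1) bij Q_def)
    qed
    have design: "\<exists>B\<in>sets (P n). measure (P n) B \<le> Dc * (N n * exp (- (\<kappa>d / U\<^sup>2) * ((u n)\<^sup>2 * r n)))
       \<and> (\<forall>w\<in>space (P n) - B. \<forall>g\<in>\<E> n. well_conditioned c1 K (\<lambda>t. snd (w t)) g)"
    proof -
      have each: "\<forall>g\<in>\<E> n. \<exists>B. B \<in> sets (P n) \<and> measure (P n) B \<le> Dc * exp (- \<kappa>d * real (card g))
         \<and> (\<forall>w\<in>space (P n) - B. well_conditioned c1 K (\<lambda>t. snd (w t)) g)"
      proof
        fix g assume g: "g \<in> \<E> n"
        have g': "g \<subseteq> {1..n}" "g \<noteq> {}" using envs n g by auto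
        have "{1..n} \<subseteq> (\<Union>i\<in>{1..L + 1}. seg n i)"
          using segments_cover[OF cp(2)[OF n]] cp(1)[OF n] unfolding seg_def by simp
        then have cover: "g \<subseteq> (\<Union>i\<in>{1..L + 1}. seg n i)" using g'(1) by blast
        have "finite g" using g'(1) by (rule finite_subset) simp
        from wce[OF prob[OF n] this g'(2) _ cover, of "\<lambda>t w. snd (w t)"] row
        show "\<exists>B. B \<in> sets (P n) \<and> measure (P n) B \<le> Dc * exp (- \<kappa>d * real (card g))
         \<and> (\<forall>w\<in>space (P n) - B. well_conditioned c1 K (\<lambda>t. snd (w t)) g)"
          unfolding I_def by blast
      qed
      from bchoice[OF each] obtain Bg where Bg: "\<forall>g\<in>\<E> n. Bg g \<in> sets (P n) \<and> measure (P n) (Bg g) \<le> Dc * exp (- \<kappa>d * real (card g))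
         \<and> (\<forall>w\<in>space (P n) - Bg g. well_conditioned c1 K (\<lambda>t. snd (w t)) g)" by blast
      let ?B = "\<Union>g\<in>\<E> n. Bg g"
      have "?B \<in> sets (P n)" using Bg finE[OF n] by auto
      moreover have "measure (P n) ?B \<le> Dc * (N n * exp (- (\<kappa>d / U\<^sup>2) * ((u n)\<^sup>2 * r n)))"
      proof -
        have "measure (P n) ?B \<le> (\<Sum>g\<in>\<E> n. measure (P n) (Bg g))"
          using Bg finE[OF n] by (intro finite_measure_subadditive_finite) auto
        also have "\<dots> \<le> (\<Sum>g\<in>\<E> n. Dc * exp (- (\<kappa>d / U\<^sup>2) * ((u n)\<^sup>2 * r n)))"
        proof (rule sum_mono)
          fix g assume g: "g \<in> \<E> n"
          have "(u n)\<^sup>2 / U\<^sup>2 \<le> 1" using u_le u_pos U by (simp add: power_mono)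
          then have "(u n)\<^sup>2 / U\<^sup>2 * r n \<le> 1 * r n" using r by (intro mult_right_mono) auto
          also have "\<dots> \<le> real (card g)" using r_le[OF n g] by simp
          finally have "\<kappa>d * ((u n)\<^sup>2 / U\<^sup>2 * r n) \<le> \<kappa>d * real (card g)" using \<kappa>d by (intro mult_left_mono) auto
          then have "exp (- \<kappa>d * real (card g)) \<le> exp (- (\<kappa>d / U\<^sup>2) * ((u n)\<^sup>2 * r n))" by (simp add: mult.assoc)
          then have "Dc * exp (- \<kappa>d * real (card g)) \<le> Dc * exp (- (\<kappa>d / U\<^sup>2) * ((u n)\<^sup>2 * r n))"
            using Dc by (rule mult_left_mono)
          moreover have "measure (P n) (Bg g) \<le> Dc * exp (- \<kappa>d * real (card g))" using Bg g by blast
          ultimately show "measure (P n) (Bg g) \<le> Dc * exp (- (\<kappa>d / U\<^sup>2) * ((u n)\<^sup>2 * r n))" by linarith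
        qed
        also have "\<dots> = Dc * (N n * exp (- (\<kappa>d / U\<^sup>2) * ((u n)\<^sup>2 * r n)))" by (simp add: N_def)
        finally show ?thesis .
      qed
      moreover have "\<forall>w\<in>space (P n) - ?B. \<forall>g\<in>\<E> n. well_conditioned c1 K (\<lambda>t. snd (w t)) g"
        using Bg by blast
      ultimately show ?thesis by blast
    qed
    have errors: "\<exists>B\<in>sets (P n). measure (P n) B \<le> V / \<theta>\<^sup>2 / ((u n)\<^sup>2 * r n)
       \<and> (\<forall>w\<in>space (P n) - B. errors_within \<eta> ((\<sigma> i n)\<^sup>2)
          (\<lambda>t. fst (w t) - restr S (snd (w t)) \<bullet> \<beta> i n) (\<lambda>t. restr S (snd (w t))) (F i n))"
      if i: "i \<in> I" for i
    proof -
      have "F i n \<subseteq> seg n i" using sub i by blast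
      from regression_errors_on_environment[OF prob[OF n] row[OF i] less_imp_le[OF C0] indep[OF n i] par(3)[OF i] this ne[OF i] \<eta>0]
      obtain B where B: "B \<in> sets (P n)"
        "measure (P n) B \<le> (3 * (\<sigma> i n) ^ 4 + real CARD('d) ^ 3 * (\<sigma> i n)\<^sup>2 * C0) / (\<eta>\<^sup>2 * real (card (F i n)))"
        "\<forall>w\<in>space (P n) - B. errors_within \<eta> ((\<sigma> i n)\<^sup>2)
          (\<lambda>t. fst (w t) - restr S (snd (w t)) \<bullet> \<beta> i n) (\<lambda>t. restr S (snd (w t))) (F i n)"
        by blast
      have s: "(\<sigma> i n)\<^sup>2 \<le> S0" using \<sigma>b i by auto
      have "(\<sigma> i n) ^ 4 = ((\<sigma> i n)\<^sup>2)\<^sup>2" by (simp add: power_mult[symmetric])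
      also have "\<dots> \<le> S0\<^sup>2" using s by (intro power_mono) auto
      finally have s4: "(\<sigma> i n) ^ 4 \<le> S0\<^sup>2" .
      have V: "3 * (\<sigma> i n) ^ 4 + real CARD('d) ^ 3 * (\<sigma> i n)\<^sup>2 * C0 \<le> V"
        unfolding V_def using s s4 C0 by (intro add_mono mult_left_mono mult_right_mono) auto
      have V0: "0 \<le> V" unfolding V_def using S00 C0 by simp
      have "measure (P n) B \<le> V / (\<eta>\<^sup>2 * r n)"
        using B(2) frac_le[OF V0 V, of "\<eta>\<^sup>2 * r n" "\<eta>\<^sup>2 * real (card (F i n))"] r \<eta>0 r_le[OF n FE[OF i n]]
        by (smt (verit) mult_left_mono mult_pos_pos zero_less_power)
      also have "\<dots> = V / \<theta>\<^sup>2 / ((u n)\<^sup>2 * r n)" by (simp add: \<eta>_def power_mult_distrib mult_ac)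
      finally show ?thesis using B(1,3) by blast
    qed
    obtain B where B: "B \<in> sets (P n)" "measure (P n) B \<le> Dc * (N n * exp (- (\<kappa>d / U\<^sup>2) * ((u n)\<^sup>2 * r n)))"
      "\<And>w g. w \<in> space (P n) - B \<Longrightarrow> g \<in> \<E> n \<Longrightarrow> well_conditioned c1 K (\<lambda>t. snd (w t)) g"
      using design by blast
    obtain Be where Be: "Be \<in> sets (P n)" "measure (P n) Be \<le> V / \<theta>\<^sup>2 / ((u n)\<^sup>2 * r n)"
      "\<And>w. w \<in> space (P n) - Be \<Longrightarrow> errors_within \<eta> ((\<sigma> i n)\<^sup>2)
          (\<lambda>t. fst (w t) - restr S (snd (w t)) \<bullet> \<beta> i n) (\<lambda>t. restr S (snd (w t))) (F i n)"
      using errors[OF ij(1)] by blast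
    obtain Bf where Bf: "Bf \<in> sets (P n)" "measure (P n) Bf \<le> V / \<theta>\<^sup>2 / ((u n)\<^sup>2 * r n)"
      "\<And>w. w \<in> space (P n) - Bf \<Longrightarrow> errors_within \<eta> ((\<sigma> j n)\<^sup>2)
          (\<lambda>t. fst (w t) - restr S (snd (w t)) \<bullet> \<beta> j n) (\<lambda>t. restr S (snd (w t))) (F j n)"
      using errors[OF ij(2)] by blast
    have E: "\<E> n \<subseteq> Pow {1..n}" "{} \<notin> \<E> n" using envs n by auto
    have small': "2 * (1 + real CARD('d)) * (real (card (\<E> n)) * exp (- \<kappa> * \<eta>\<^sup>2 * r n)) < \<alpha>"
      using small by (simp add: N_def \<eta>_def power_mult_distrib mult_ac)
    obtain p where p: "(\<lambda>B. rejection_prob (T3_max S (\<E> n)) n S \<alpha> B (P n)) \<longlonglongrightarrow> p"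
      "1 - (measure (P n) B + measure (P n) Be + measure (P n) Bf) \<le> p" "p \<le> 1"
      using rejection_prob_lower_bound[OF cp(3)[OF n] \<alpha> E FE[OF ij(1) n] FE[OF ij(2) n] disj c1 K \<eta>0 \<eta>1
          \<eta>2[unfolded q_def] \<eta>3 rb[OF ij(1)] rb[OF ij(2)] D[OF ij] gain[unfolded q_def] B(1,3) Be(1,3) Bf(1,3)
          r_le[OF n] small'[unfolded \<kappa>_def]] by blast
    have "1 - err n \<le> p" using p(2) B(2) Be(2) Bf(2) unfolding err_def by linarith
    with p(1,3) show ?case by blast
  qed
  then have ev: "\<forall>\<^sub>F n in sequentially.
      (\<lambda>B. rejection_prob (T3_max S (\<E> n)) n S \<alpha> B (P n)) \<longlonglongrightarrow> lim (\<lambda>B. rejection_prob (T3_max S (\<E> n)) n S \<alpha> B (P n))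
      \<and> 1 - err n \<le> lim (\<lambda>B. rejection_prob (T3_max S (\<E> n)) n S \<alpha> B (P n))
      \<and> lim (\<lambda>B. rejection_prob (T3_max S (\<E> n)) n S \<alpha> B (P n)) \<le> 1"
    by eventually_elim (metis limI)
  show ?thesis
  proof (intro exI conjI)
    show "\<forall>\<^sub>F n in sequentially.
      (\<lambda>B. rejection_prob (T3_max S (\<E> n)) n S \<alpha> B (P n)) \<longlonglongrightarrow> lim (\<lambda>B. rejection_prob (T3_max S (\<E> n)) n S \<alpha> B (P n))"
      using ev by eventually_elim blast
    show "(\<lambda>n. lim (\<lambda>B. rejection_prob (T3_max S (\<E> n)) n S \<alpha> B (P n))) \<longlonglongrightarrow> 1"
    proof (rule tendsto_sandwich[OF _ _ _ tendsto_const])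
      show "(\<lambda>n. 1 - err n) \<longlonglongrightarrow> 1" using tendsto_diff[OF tendsto_const[of 1] err0] by simp
    qed (use ev in \<open>auto elim: eventually_mono\<close>)
  qed
qed

end
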